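(* Let $\mathcal{P}\subset\overline{\mathbb{H}}^5$ be the right-angled $5$-polytope defined in the context, let $\mathcal{F}$ be any non-empty set of pairwise disjoint facets of $\mathcal{P}$, let $\Gamma_{\mathcal{F}}$ be the right-angled Coxeter group with Fuchsian ends obtained from $\Gamma_{\mathcal{P}}$ by removing the facets in $\mathcal{F}$, and let $\rho_0:\Gamma_{\mathcal{F}}\to\mathrm{Isom}(\mathbb{H}^5)$ be the inclusion map. Then there is a (connected) open neighborhood $U_0\subset\mathrm{Hom}(\Gamma_{\mathcal{F}},\mathrm{Isom}(\mathbb{H}^5))$ of $\rho_0$, all of whose elements send each standard generator of $\Gamma_{\mathcal{F}}$ to a reflection, such that for every $\rho\in U_0$ there exists an isometry $f\in\mathrm{Isom}(\mathbb{H}^5)$ with $f\rho f^{-1}=\rho_0$. That is, all the right-angled Coxeter groups with Fuchsian ends obtained from $\Gamma_{\mathcal{P}}$ are locally rigid.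
   Context: Lorentzian space $\mathbb{R}^{5,1}$ is $\mathbb{R}^6$ with the inner product $\langle x,y\rangle=x_1y_1+\cdots+x_5y_5-x_6y_6$. Hyperbolic $5$-space is $\mathbb{H}^5=\{x\in\mathbb{R}^{5,1}: \langle x,x\rangle=-1,\ x_6>0\}$, with the metric induced by the Lorentzian inner product; $\mathrm{Isom}(\mathbb{H}^5)$ is its full isometry group, and $\overline{\mathbb{H}}^5$ is $\mathbb{H}^5$ together with its boundary at infinity. For a vector $v$ with $\langle v,v\rangle=1$, put $H_v=\{x\in\mathbb{H}^5:\langle x,v\rangle=0\}$ (a hyperplane) and $H_v^-=\{x\in\mathbb{H}^5:\langle x,v\rangle\le 0\}$ (the closed half-space with outer normal $v$). The polytope $\mathcal{P}$ is the intersection of the $48$ half-spaces $H_v^-$, where $v$ runs over the following unit space-like vectors of $\mathbb{R}^{5,1}$: (i) the 8 vectors obtained by permuting the first four coordinates of $(\pm1,0,0,0,1,1)$; (ii) the 8 vectors obtained by permuting the first four coordinates of $(\pm1,0,0,0,-\frac12,\frac12)$; (iii) the 32 vectors obtained by permuting the first four coordinates of $(\pm1,\pm1,\pm1,0,\frac12,\frac32)$ (all choices of signs). The facet of $\mathcal{P}$ defined by $v$ is $F_v=\mathcal{P}\cap H_v$. All dihedral angles of $\mathcal{P}$ are $0$ or $\frac{\pi}{2}$ (angle $0$ meaning that the two bounding hyperplanes meet only at a point at infinity). $\Gamma_{\mathcal{P}}$ is the discrete subgroup of $\mathrm{Isom}(\mathbb{H}^5)$ generated by the reflections in the hyperplanes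 $H_v$ of the 48 facets. For a set $\mathcal{F}$ of pairwise disjoint facets of $\mathcal{P}$ (no two of them meet in $\mathbb{H}^5$; meeting only at a point at infinity is allowed), $\Gamma_{\mathcal{F}}$ is the subgroup of $\mathrm{Isom}(\mathbb{H}^5)$ generated by the reflections $r_v$ in the hyperplanes $H_v$ for all facets $F_v\notin\mathcal{F}$; these reflections are its standard generators. The groups $\Gamma_{\mathcal{F}}$ with $\mathcal{F}$ non-empty are the right-angled Coxeter groups with Fuchsian ends obtained from $\Gamma_{\mathcal{P}}$. For a discrete subgroup $\Gamma$ of $\mathrm{Isom}(\mathbb{H}^5)$, $\mathrm{Hom}(\Gamma,\mathrm{Isom}(\mathbb{H}^5))$ is the space of group homomorphisms with the topology of pointwise convergence. $\mathrm{Isom}(\mathbb{H}^5)$ acts on it by conjugation, $(f\rho f^{-1})(\gamma)=f\rho(\gamma)f^{-1}$. $\Gamma$ is locally rigid if there is a neighborhood of the inclusion $\rho_0$ contained in the conjugation orbit of $\rho_0$. A reflection is the isometric reflection of $\mathbb{H}^5$ in a hyperplane. *)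

theory Defs
  imports "HOL-Analysis.Analysis" "HOL-Algebra.Bij" "HOL-Algebra.Generated_Groups"
begin

text \<open>In the index type of \<^typ>\<open>real^6\<close> the numeral 6 denotes 0; the indices 1, ..., 6 are distinct.\<close>

definition lor :: "real^6 \<Rightarrow> real^6 \<Rightarrow> real" where
  "lor x y = x$1 * y$1 + x$2 * y$2 + x$3 * y$3 + x$4 * y$4 + x$5 * y$5 - x$6 * y$6"

definition H5 :: "(real^6) set" where
  "H5 = {x. lor x x = -1 \<and> x$6 > 0}"

text \<open>The distance function of the Riemannian metric induced on \<^term>\<open>H5\<close> by \<^term>\<open>lor\<close>
  satisfies cosh d = - lor x y. It is only meaningful on \<^term>\<open>H5\<close>.\<close>

definition hdist :: "real^6 \<Rightarrow> real^6 \<Rightarrow> real" where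
  "hdist x y = arcosh (- lor x y)"

text \<open>Isometries are functions on the ambient vector space that are \<^term>\<open>undefined\<close> off
  \<^term>\<open>H5\<close>, as in \<^const>\<open>BijGroup\<close>; orientation-reversing ones are included.\<close>

definition Isom_H5 :: "(real^6 \<Rightarrow> real^6) monoid" where
  "Isom_H5 = (BijGroup H5)
     \<lparr>carrier := {f \<in> Bij H5. \<forall>x\<in>H5. \<forall>y\<in>H5. hdist (f x) (f y) = hdist x y}\<rparr>"

text \<open>Pointwise convergence on \<^term>\<open>H5\<close>. On isometries this is the compact-open topology, hence
  the Lie group topology. The topology of \<^term>\<open>H5\<close> as a metric space is its subspace topology.\<close>

definition Isom_topology :: "(real^6 \<Rightarrow> real^6) topology" where
  "Isom_topology =
     subtopology (product_topology (\<lambda>_. top_of_set H5) H5) (carrier Isom_H5)"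

definition hyperplane_H5 :: "real^6 \<Rightarrow> (real^6) set" where
  "hyperplane_H5 v = {x \<in> H5. lor x v = 0}"

definition halfspace_H5 :: "real^6 \<Rightarrow> (real^6) set" where
  "halfspace_H5 v = {x \<in> H5. lor x v \<le> 0}"

text \<open>Only meaningful for \<^term>\<open>lor v v = 1\<close>.\<close>

definition reflection_in :: "real^6 \<Rightarrow> real^6 \<Rightarrow> real^6" where
  "reflection_in v = (\<lambda>x\<in>H5. x - (2 * lor x v) *\<^sub>R v)"

definition reflections :: "(real^6 \<Rightarrow> real^6) set" where
  "reflections = {reflection_in v | v. lor v v = 1}"

text \<open>Homomorphisms are \<^term>\<open>undefined\<close> off the subgroup, so that they are determined by their
  values on it.\<close>

definition Hom_Isom :: "(real^6 \<Rightarrow> real^6) set \<Rightarrow> ((real^6 \<Rightarrow> real^6) \<Rightarrow> (real^6 \<Rightarrow> real^6)) set" where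
  "Hom_Isom \<Gamma> = hom (Isom_H5\<lparr>carrier := \<Gamma>\<rparr>) Isom_H5 \<inter> extensional \<Gamma>"

definition Hom_topology ::
    "(real^6 \<Rightarrow> real^6) set \<Rightarrow> ((real^6 \<Rightarrow> real^6) \<Rightarrow> (real^6 \<Rightarrow> real^6)) topology" where
  "Hom_topology \<Gamma> = subtopology (product_topology (\<lambda>_. Isom_topology) \<Gamma>) (Hom_Isom \<Gamma>)"

definition inclusion ::
    "(real^6 \<Rightarrow> real^6) set \<Rightarrow> (real^6 \<Rightarrow> real^6) \<Rightarrow> (real^6 \<Rightarrow> real^6)" where
  "inclusion \<Gamma> = (\<lambda>\<gamma>\<in>\<Gamma>. \<gamma>)"

definition conjugate_rep :: "(real^6 \<Rightarrow> real^6) set \<Rightarrow> (real^6 \<Rightarrow> real^6)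
    \<Rightarrow> ((real^6 \<Rightarrow> real^6) \<Rightarrow> (real^6 \<Rightarrow> real^6)) \<Rightarrow> (real^6 \<Rightarrow> real^6) \<Rightarrow> (real^6 \<Rightarrow> real^6)" where
  "conjugate_rep \<Gamma> f \<rho> =
     (\<lambda>\<gamma>\<in>\<Gamma>. f \<otimes>\<^bsub>Isom_H5\<^esub> \<rho> \<gamma> \<otimes>\<^bsub>Isom_H5\<^esub> inv\<^bsub>Isom_H5\<^esub> f)"

definition locally_rigid :: "(real^6 \<Rightarrow> real^6) set \<Rightarrow> bool" where
  "locally_rigid \<Gamma> \<longleftrightarrow>
     (\<exists>U. openin (Hom_topology \<Gamma>) U \<and> inclusion \<Gamma> \<in> U \<and>
          U \<subseteq> {conjugate_rep \<Gamma> f (inclusion \<Gamma>) | f. f \<in> carrier Isom_H5})"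

definition permute_first_four :: "(real^6) set \<Rightarrow> (real^6) set" where
  "permute_first_four W = {\<chi> i. w $ \<sigma> i | w \<sigma>. w \<in> W \<and> \<sigma> permutes {1, 2, 3, 4}}"

definition normals :: "(real^6) set" where
  "normals =
     permute_first_four {vector [a, 0, 0, 0, 1, 1] | a. a \<in> {-1, 1}} \<union>
     permute_first_four {vector [a, 0, 0, 0, -1/2, 1/2] | a. a \<in> {-1, 1}} \<union>
     permute_first_four {vector [a, b, c, 0, 1/2, 3/2] | a b c.
       a \<in> {-1, 1} \<and> b \<in> {-1, 1} \<and> c \<in> {-1, 1}}"

definition polytope_P :: "(real^6) set" where
  "polytope_P = (\<Inter>v\<in>normals. halfspace_H5 v)"

text \<open>Facets contain no ideal points, so facets meeting only at infinity are disjoint.\<close>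

definition facet :: "real^6 \<Rightarrow> (real^6) set" where
  "facet v = polytope_P \<inter> hyperplane_H5 v"

definition facets :: "(real^6) set set" where
  "facets = facet ` normals"

definition standard_generators :: "(real^6) set set \<Rightarrow> (real^6 \<Rightarrow> real^6) set" where
  "standard_generators \<F> = {reflection_in v | v. v \<in> normals \<and> facet v \<notin> \<F>}"

definition Gamma_F :: "(real^6) set set \<Rightarrow> (real^6 \<Rightarrow> real^6) set" where
  "Gamma_F \<F> = generate Isom_H5 (standard_generators \<F>)"

lemma lor_linear: "lor (x - y) z = lor x z - lor y z" "lor z (x - y) = lor z x - lor z y"
  "lor (c *\<^sub>R x) z = c * lor x z" "lor z (c *\<^sub>R x) = c * lor z x" "lor x z = lor z x"
  by (auto simp: lor_def algebra_simps)

lemma vector_6: fixes a b c d e f :: real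
  defines "v \<equiv> (vector [a,b,c,d,e,f] :: real^6)"
  shows "v$1=a" "v$2=b" "v$3=c" "v$4=d" "v$5=e" "v$6=f"
  unfolding v_def vector_def by auto

lemma lor_H5_le: assumes "x \<in> H5" "y \<in> H5" shows "lor x y \<le> -1"
proof -
  define X Y where "X = x$1^2+x$2^2+x$3^2+x$4^2+x$5^2" and "Y = y$1^2+y$2^2+y$3^2+y$4^2+y$5^2"
  define s where "s = x$1*y$1+x$2*y$2+x$3*y$3+x$4*y$4+x$5*y$5"
  have X: "x$6^2 = X+1" and Y: "y$6^2 = Y+1" and p: "x$6>0" "y$6>0"
    using assms by (auto simp: H5_def lor_def X_def Y_def power2_eq_square)
  have XY: "X\<ge>0" "Y\<ge>0" by (auto simp: X_def Y_def)
  have cs: "2 * s \<le> X + Y"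
  proof -
    have "0 \<le> (x$1-y$1)^2+(x$2-y$2)^2+(x$3-y$3)^2+(x$4-y$4)^2+(x$5-y$5)^2" by simp
    thus ?thesis unfolding X_def Y_def s_def by (simp add: power2_eq_square algebra_simps)
  qed
  have cs2: "s^2 \<le> X * Y"
  proof -
    let ?w = "\<lambda>i j. (x$i*y$j - x$j*y$i)^2"
    have "0 \<le> ?w 1 2+?w 1 3+?w 1 4+?w 1 5+?w 2 3+?w 2 4+?w 2 5+?w 3 4+?w 3 5+?w 4 5" by simp
    also have "\<dots> = X*Y - s^2" unfolding X_def Y_def s_def by (simp add: power2_eq_square algebra_simps)
    finally show ?thesis by simp
  qed
  have "(s+1)^2 = s^2 + 2 * s + 1" by (simp only: power2_eq_square) algebra
  also have "\<dots> \<le> X*Y + (X+Y) + 1" using cs cs2 by linarith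
  also have "\<dots> = (X+1)*(Y+1)" by algebra
  also have "\<dots> = (x$6*y$6)^2" by (simp only: power_mult_distrib X Y)
  finally have "(s+1)^2 \<le> (x$6*y$6)^2" .
  hence "s+1 \<le> x$6*y$6" using p by (meson less_imp_le mult_pos_pos power2_le_imp_le)
  thus ?thesis by (simp add: lor_def s_def)
qed

lemma Isom_carrier: "f \<in> carrier Isom_H5 \<longleftrightarrow> f \<in> Bij H5 \<and> (\<forall>x\<in>H5. \<forall>y\<in>H5. hdist (f x) (f y) = hdist x y)"
  by (simp add: Isom_H5_def)

lemma group_Isom_H5: "group Isom_H5"
proof -
  interpret B: group "BijGroup H5" by (rule group_BijGroup)
  have sub: "subgroup {f \<in> Bij H5. \<forall>x\<in>H5. \<forall>y\<in>H5. hdist (f x) (f y) = hdist x y} (BijGroup H5)"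
  proof (rule B.subgroupI, goal_cases)
    case 1 show ?case by (auto simp: BijGroup_def)
  next
    case 2 show ?case using id_Bij by force
  next
    case (3 f)
    hence f: "f \<in> Bij H5" and d: "\<And>x y. x\<in>H5 \<Longrightarrow> y\<in>H5 \<Longrightarrow> hdist (f x) (f y) = hdist x y" by auto
    have fi: "\<And>x. x\<in>H5 \<Longrightarrow> f (inv_into H5 f x) = x"
      using f by (auto simp: Bij_def bij_betw_def intro: f_inv_into_f)
    have "hdist (inv_into H5 f x) (inv_into H5 f y) = hdist x y" if "x\<in>H5" "y\<in>H5" for x y
      using d[of "inv_into H5 f x" "inv_into H5 f y"] fi f that by (simp add: Bij_inv_into_mem)
    thus ?case using f by (auto simp: inv_BijGroup restrict_inv_into_Bij)
  next
    case (4 f g)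
    thus ?case using Bij_imp_funcset[of g H5]
      by (auto simp: BijGroup_def compose_Bij compose_eq Pi_iff)
  qed
  show ?thesis using B.subgroup_imp_group[OF sub] by (simp add: Isom_H5_def)
qed

lemma reflection_in_Isom: assumes v: "lor v v = 1" shows "reflection_in v \<in> carrier Isom_H5"
proof -
  let ?r = "\<lambda>x. x - (2 * lor x v) *\<^sub>R v"
  have iso: "lor (?r x) (?r y) = lor x y" for x y
    using v by (simp add: lor_linear algebra_simps)
  have inv: "?r (?r x) = x" for x using v by (simp add: lor_linear algebra_simps)
  have mem: "?r x \<in> H5" if x: "x \<in> H5" for x
  proof (rule ccontr)
    assume n: "?r x \<notin> H5"
    have q: "lor (?r x) (?r x) = -1" using x iso by (simp add: H5_def)
    hence "(?r x)$6 \<le> 0" using n by (auto simp: H5_def)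
    moreover have "(?r x)$6 \<noteq> 0"
    proof
      assume "(?r x)$6 = 0"
      hence "lor (?r x) (?r x) \<ge> 0" by (simp only: lor_def) simp
      thus False using q by simp
    qed
    moreover have m: "lor y (- z) = - lor y z" "lor (- z) y = - lor z y" for y z
      by (simp_all add: lor_def)
    ultimately have "- ?r x \<in> H5" unfolding H5_def mem_Collect_eq m using q by simp
    from lor_H5_le[OF x this] have "lor x (?r x) \<ge> 1" unfolding m by simp
    moreover have "lor x (?r x) = -1 - 2 * (lor x v)^2"
      using x by (simp add: lor_linear H5_def power2_eq_square)
    ultimately show False by (smt (verit) zero_le_power2)
  qed
  have "bij_betw (reflection_in v) H5 H5"
    by (rule bij_betwI[where g="?r"]) (auto simp: reflection_in_def mem inv)
  thus ?thesis unfolding Isom_carrier Bij_def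
    by (auto simp: reflection_in_def hdist_def iso)
qed

lemma permute_first_four_lor:
  assumes "v \<in> permute_first_four W" obtains w where "w \<in> W" "lor v v = lor w w" "v$5 = w$5" "v$6 = w$6"
proof -
  obtain w \<sigma> where w: "w \<in> W" and s: "\<sigma> permutes {1,2,3,4}" and v: "v = (\<chi> i. w $ \<sigma> i)"
    using assms by (auto simp: permute_first_four_def)
  have n: "lor u u = (\<Sum>i\<in>{1,2,3,4}. u$i * u$i) + u$5*u$5 - u$6*u$6" for u
    by (simp add: lor_def)
  have "\<sigma> 5 = 5" by (rule permutes_not_in[OF s]) simp
  moreover have "\<sigma> 6 = 6" by (rule permutes_not_in[OF s]) simp
  moreover have "(\<Sum>i\<in>{1,2,3,4}. v$i * v$i) = (\<Sum>i\<in>{1,2,3,4}. w$i * w$i)"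
    using sum.permute[OF s, of "\<lambda>i. w$i * w$i"] by (simp only: v o_def vec_lambda_beta)
  ultimately show thesis using that[OF w] by (simp only: n) (simp add: v)
qed

lemma normals_unit: assumes "v \<in> normals" shows "lor v v = 1"
  using assms unfolding normals_def
  by (elim UnE; elim permute_first_four_lor) (auto simp: lor_def vector_6 power2_eq_square)

end

(*
A representation near the inclusion sends each generator to an involution close to a reflection,
hence to a reflection, so it amounts to a family of unit vectors near the given normals in which
adjacent normals stay orthogonal.  It remains to see that such a family is unique up to Lorentz
transformations.  Infinitesimally, a cusp of the polytope has four pairs of parallel facets and
pairwise disjoint facets can occupy only one of these pairs; the remaining three pairs force
the products -1 of parallel normals at the cusp to be preserved as well.  Orthogonality and
parallelism together determine all remaining normals from a few of them, one after the other, so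
only trivial deformations exist to first order.  As the constraints are quadratic, a bound for the
linearised constraints from below excludes nearby solutions after the Lorentz group has been
divided out by fixing four orthonormal normals and one more product.
*)
theory Submission imports Defs begin

text \<open>All that survives of the choice of removed facets is that two orthogonal normals are
  never both removed; this replaces an enumeration of the possible sets. Three pairs at a cusp are
  called for because comparing two pairs of parallel facets only makes their velocities proportional
  with opposite sign: one comparison leaves a free parameter, while a triangle of comparisons
  reverses the sign of each velocity and so makes it zero. Once the products at the cusps are
  preserved, finding the velocities is linear algebra in six coordinates, and only two shapes of the
  remaining set must be told apart: at one of the ideal points \<open>n\<close>, \<open>m\<close>
  every axis keeps a normal, or each of the two has lost both normals on some axis. The gauge is
  chosen accordingly. Since the neighborhood should also be connected, conjugation uses even
  products of reflections only. They suffice to move a nearby configuration back, and their orbit is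
  connected because the unit space-like vectors form a connected set.\<close>

section \<open>Algebra of the Lorentzian form\<close>

lemma lor_add: "lor (x + y) z = lor x z + lor y z" "lor z (x + y) = lor z x + lor z y"
  by (auto simp: lor_def algebra_simps)

lemma lor_minus: "lor (- x) z = - lor x z" "lor z (- x) = - lor z x"
  by (auto simp: lor_def algebra_simps)

lemma lor_zero: "lor 0 z = 0" "lor z 0 = 0"
  by (auto simp: lor_def)

lemma lor_sum: "lor (\<Sum>i\<in>A. f i) z = (\<Sum>i\<in>A. lor (f i) z)" "lor z (\<Sum>i\<in>A. f i) = (\<Sum>i\<in>A. lor z (f i))"
  by (induction A rule: infinite_finite_induct) (auto simp: lor_add lor_zero)

lemma lor_commute: "lor x y = lor y x"
  by (simp add: lor_def mult.commute)

lemmas lor_simps = lor_add lor_minus lor_linear(1-4) lor_zero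

lemma UNIV_6: "(UNIV :: 6 set) = {1,2,3,4,5,6}"
proof -
  have "card {1,2,3,4,5,6::6} = 6" by simp
  thus ?thesis by (intro sym[OF card_subset_eq]) auto
qed

lemma forall_6: "(\<forall>i::6. P i) \<longleftrightarrow> P 1 \<and> P 2 \<and> P 3 \<and> P 4 \<and> P 5 \<and> P 6"
  using UNIV_6 by (metis UNIV_I empty_iff insert_iff)

lemma lor_axis: "lor x (axis i 1) = (if i = 6 then - x$6 else x$i)"
proof -
  have "\<forall>i. lor x (axis i 1) = (if i = 6 then - x$6 else x$i)"
    unfolding forall_6 by (simp add: lor_def axis_def)
  thus ?thesis by blast
qed

subsection \<open>Frames adapted to the normals\<close>

definition cone_normals :: "(4 \<Rightarrow> real^6) \<Rightarrow> real^6 \<Rightarrow> (real^6) set" where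
  "cone_normals E n = {s *\<^sub>R E i + n | s i. s \<in> {-1, 1}}"

text \<open>The index \<open>z\<close> marks the coordinate that is zero in a vector of type (iii);
  \<open>n + m\<close> supplies the last two coordinates 1/2 and 3/2.\<close>

definition mixed_normal :: "(4 \<Rightarrow> real^6) \<Rightarrow> real^6 \<Rightarrow> real^6 \<Rightarrow> (4 \<Rightarrow> real) \<Rightarrow> 4 \<Rightarrow> real^6" where
  "mixed_normal E n m s z = (\<Sum>i\<in>UNIV - {z}. s i *\<^sub>R E i) + n + m"

definition mixed_normals :: "(4 \<Rightarrow> real^6) \<Rightarrow> real^6 \<Rightarrow> real^6 \<Rightarrow> (real^6) set" where
  "mixed_normals E n m = {mixed_normal E n m s z | s z. \<forall>i. s i \<in> {-1, 1}}"

lemma cone_normals_cases: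
  assumes "v \<in> cone_normals E n" obtains s i where "s \<in> {-1, 1}" "v = s *\<^sub>R E i + n"
  using assms unfolding cone_normals_def by blast

lemma mixed_normals_cases:
  assumes "v \<in> mixed_normals E n m"
  obtains s z where "\<forall>i. s i \<in> {-1, 1}" "v = mixed_normal E n m s z"
  using assms unfolding mixed_normals_def by blast

text \<open>The normals of types (i) and (ii) are the facets through the ideal points \<open>n\<close> and \<open>m\<close>, and
  those of type (iii) are the mixed ones.  Signed permutations and swapping \<open>n\<close> and \<open>m\<close> preserve frames,
  which replaces the use of the symmetry group of the polytope.\<close>

definition frame :: "(4 \<Rightarrow> real^6) \<Rightarrow> real^6 \<Rightarrow> real^6 \<Rightarrow> bool" where
  "frame E n m \<longleftrightarrow>
     (\<forall>i j. lor (E i) (E j) = (if i = j then 1 else 0)) \<and>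
     (\<forall>i. lor (E i) n = 0 \<and> lor (E i) m = 0) \<and>
     lor n n = 0 \<and> lor m m = 0 \<and> lor n m = -1 \<and>
     (\<forall>z. (\<forall>i. lor z (E i) = 0) \<longrightarrow> lor z n = 0 \<longrightarrow> lor z m = 0 \<longrightarrow> z = 0) \<and>
     normals = cone_normals E n \<union> cone_normals E m \<union> mixed_normals E n m"

definition std_E :: "4 \<Rightarrow> real^6" where
  "std_E i = axis (if i = 1 then 1 else if i = 2 then 2 else if i = 3 then 3 else 4) 1"

text \<open>What remains of the normals of types (i) and (ii) without their unit axis. Both vectors
  are null and have product -1, so they represent ideal points; each is orthogonal to eight
  normals.\<close>

definition std_n :: "real^6" where "std_n = vector [0,0,0,0,1,1]"
definition std_m :: "real^6" where "std_m = vector [0,0,0,0,-1/2,1/2]"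

section \<open>The 48 normals in the standard frame\<close>

lemma permute_cone:
  "permute_first_four {vector [a, 0, 0, 0, x, y] | a. a \<in> {-1, 1}} =
   cone_normals std_E (vector [0,0,0,0,x,y])" (is "?L = ?R")
proof (intro subset_antisym subsetI)
  fix v assume "v \<in> ?L"
  then obtain a \<sigma> where a: "a \<in> {-1, 1::real}" and s: "\<sigma> permutes {1,2,3,4::6}"
    and v: "v = (\<chi> i. (vector [a,0,0,0,x,y] :: real^6) $ \<sigma> i)"
    by (auto simp: permute_first_four_def)
  have 56: "\<sigma> 5 = 5" "\<sigma> 6 = 6" by (rule permutes_not_in[OF s], simp)+
  \<comment> \<open>\<open>j\<close> is the position that receives the sign; the other three of the
    first four positions receive zeros.\<close>
  obtain j where j: "j \<in> {1,2,3,4}" "\<sigma> j = 1"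
  proof -
    have "1 \<in> \<sigma> ` {1,2,3,4}" using permutes_image[OF s] by simp
    thus ?thesis using that by (metis (no_types, lifting) imageE)
  qed
  have o: "\<sigma> i \<in> {2,3,4}" if "i \<in> {1,2,3,4}" "i \<noteq> j" for i
  proof -
    have "\<sigma> i \<in> {1,2,3,4}" using permutes_in_image[OF s] that by blast
    moreover have "\<sigma> i \<noteq> 1" using j that permutes_inj[OF s] by (metis injD)
    ultimately show ?thesis by blast
  qed
  have oz: "(vector [a,0,0,0,x,y] :: real^6) $ \<sigma> i = 0" if "i \<in> {1,2,3,4}" "i \<noteq> j" for i
    using o[OF that] by (auto simp: vector_6)
  obtain k :: 4 where k: "std_E k = axis j 1"
  proof -
    have "std_E 1 = axis 1 1" "std_E 2 = axis 2 1" "std_E 3 = axis 3 1" "std_E 4 = axis 4 1"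
      by (simp_all add: std_E_def)
    thus ?thesis using j(1) that by (metis empty_iff insert_iff)
  qed
  have "v = a *\<^sub>R axis j 1 + vector [0,0,0,0,x,y]"
    using j(1)
  proof (elim insertE emptyE)
    assume "j = 1" thus ?thesis using j(2) 56 oz[of 2] oz[of 3] oz[of 4]
      unfolding vec_eq_iff forall_6 v by (simp add: vector_6 axis_def)
  next
    assume "j = 2" thus ?thesis using j(2) 56 oz[of 1] oz[of 3] oz[of 4]
      unfolding vec_eq_iff forall_6 v by (simp add: vector_6 axis_def)
  next
    assume "j = 3" thus ?thesis using j(2) 56 oz[of 2] oz[of 1] oz[of 4]
      unfolding vec_eq_iff forall_6 v by (simp add: vector_6 axis_def)
  next
    assume "j = 4" thus ?thesis using j(2) 56 oz[of 2] oz[of 3] oz[of 1]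
      unfolding vec_eq_iff forall_6 v by (simp add: vector_6 axis_def)
  qed
  thus "v \<in> ?R" using a k unfolding cone_normals_def by (metis (mono_tags, lifting) mem_Collect_eq)
next
  fix v assume "v \<in> ?R"
  then obtain a k where a: "a \<in> {-1,1}" and v: "v = a *\<^sub>R std_E k + vector [0,0,0,0,x,y]"
    by (auto simp: cone_normals_def)
  obtain j :: 6 where j: "std_E k = axis j 1" "j \<in> {1,2,3,4}" by (auto simp: std_E_def)
  \<comment> \<open>For the converse a single transposition carries the sign from the first position
    to position \<open>j\<close>.\<close>
  have "v = (\<chi> i. (vector [a,0,0,0,x,y] :: real^6) $ (Transposition.transpose 1 j i))"
    using j(2) unfolding vec_eq_iff forall_6 v j(1)
    by (elim insertE emptyE) (simp_all add: vector_6 axis_def Transposition.transpose_def)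
  moreover have "Transposition.transpose 1 j permutes {1,2,3,4::6}" using j(2) by (intro permutes_swap_id) auto
  ultimately show "v \<in> ?L" unfolding permute_first_four_def using a by blast
qed

lemma sum_delete_4: "(\<Sum>i\<in>UNIV - {z::4}. f i) = sum f UNIV - (f z :: 'a :: ab_group_add)"
  by (simp add: sum_diff1)

lemma mixed_normal_std:
  "mixed_normal std_E std_n std_m s z =
   vector [if z = 1 then 0 else s 1, if z = 2 then 0 else s 2, if z = 3 then 0 else s 3,
     if z = 4 then 0 else s 4, 1/2, 3/2]"
  unfolding mixed_normal_def sum_delete_4 sum_4 vec_eq_iff forall_6 using exhaust_4[of z]
  by (auto simp: vector_6 std_E_def std_n_def std_m_def axis_def)

lemma permute_mixed:
  "permute_first_four {vector [a, b, c, 0, 1/2, 3/2] | a b c.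
       a \<in> {-1, 1} \<and> b \<in> {-1, 1} \<and> c \<in> {-1, 1}} =
   mixed_normals std_E std_n std_m" (is "?L = ?R")
proof (intro subset_antisym subsetI)
  fix v assume "v \<in> ?L"
  then obtain a b c \<sigma> where abc: "a \<in> {-1, 1::real}" "b \<in> {-1, 1::real}" "c \<in> {-1, 1::real}"
    and s: "\<sigma> permutes {1,2,3,4::6}"
    and v: "v = (\<chi> i. (vector [a,b,c,0,1/2,3/2] :: real^6) $ \<sigma> i)"
    unfolding permute_first_four_def by blast
  have 56: "\<sigma> 5 = 5" "\<sigma> 6 = 6" by (rule permutes_not_in[OF s], simp)+
  obtain j where j: "j \<in> {1,2,3,4}" "\<sigma> j = 4"
  proof -
    have "4 \<in> \<sigma> ` {1,2,3,4}" using permutes_image[OF s] by simp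
    thus ?thesis using that by (metis (no_types, lifting) imageE)
  qed
  \<comment> \<open>Signs have to lie in \<open>{-1, 1}\<close> at every index, so the vanishing
    coordinate gets the default sign 1.\<close>
  define t where "t i = (if v $ i = 0 then 1 else v $ i)" for i
  have o: "\<sigma> i \<in> {1,2,3}" if "i \<in> {1,2,3,4}" "i \<noteq> j" for i
  proof -
    have "\<sigma> i \<in> {1,2,3,4}" using permutes_in_image[OF s] that by blast
    moreover have "\<sigma> i \<noteq> 4" using j that permutes_inj[OF s] by (metis injD)
    ultimately show ?thesis by blast
  qed
  have vv: "v $ i \<in> {-1,1}" if "i \<in> {1,2,3,4}" "i \<noteq> j" for i
    using o[OF that] abc by (auto simp: vector_6 v)
  have tv: "t i = v $ i" if "i \<in> {1,2,3,4}" "i \<noteq> j" for i using vv[OF that] by (auto simp: t_def)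
  have vj: "v $ j = 0" by (simp add: v j vector_6)
  have tj: "t i \<in> {-1,1}" if "i \<in> {1,2,3,4}" for i
    using vv[OF that] vj by (cases "i = j") (auto simp: t_def)
  define s where "s i = (if i = 1 then t 1 else if i = 2 then t 2 else if i = 3 then t 3 else t 4)" for i :: 4
  have s: "\<forall>i. s i \<in> {-1,1}" using tj by (simp add: s_def)
  have v56: "v $ 5 = 1/2" "v $ 6 = 3/2" by (simp_all add: v 56 vector_6)
  have "\<exists>z. v = mixed_normal std_E std_n std_m s z"
    using j(1)
  proof (elim insertE emptyE)
    assume "j = 1" thus ?thesis using vj v56 tv[of 2] tv[of 3] tv[of 4]
      unfolding mixed_normal_std vec_eq_iff forall_6 by (intro exI[of _ 1]) (simp add: vector_6 s_def)
  next
    assume "j = 2" thus ?thesis using vj v56 tv[of 1] tv[of 3] tv[of 4]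
      unfolding mixed_normal_std vec_eq_iff forall_6 by (intro exI[of _ 2]) (simp add: vector_6 s_def)
  next
    assume "j = 3" thus ?thesis using vj v56 tv[of 2] tv[of 1] tv[of 4]
      unfolding mixed_normal_std vec_eq_iff forall_6 by (intro exI[of _ 3]) (simp add: vector_6 s_def)
  next
    assume "j = 4" thus ?thesis using vj v56 tv[of 2] tv[of 3] tv[of 1]
      unfolding mixed_normal_std vec_eq_iff forall_6 by (intro exI[of _ 4]) (simp add: vector_6 s_def)
  qed
  thus "v \<in> ?R" using s unfolding mixed_normals_def by blast
next
  fix v assume "v \<in> ?R"
  then obtain s z where s: "\<And>i. s i \<in> {-1, 1}" and v: "v = mixed_normal std_E std_n std_m s z"
    unfolding mixed_normals_def by blast
  \<comment> \<open>The transposition of 4 and \<open>j\<close> moves the zero to place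
    \<open>j\<close>; the sign of coordinate 4 is therefore listed in slot \<open>j\<close>, except
    when \<open>j\<close> is 4.\<close>
  have "\<exists>a b c j. a \<in> {-1,1} \<and> b \<in> {-1,1} \<and> c \<in> {-1,1} \<and> j \<in> {1,2,3,4} \<and>
      v = (\<chi> i. (vector [a,b,c,0,1/2,3/2] :: real^6) $ (Transposition.transpose 4 j i))"
    using exhaust_4[of z]
  proof (elim disjE)
    assume "z = 1" thus ?thesis unfolding vec_eq_iff forall_6 v mixed_normal_std using s
      by (intro exI[of _ "s 4"] exI[of _ "s 2"] exI[of _ "s 3"] exI[of _ 1])
         (simp add: vector_6 Transposition.transpose_def)
  next
    assume "z = 2" thus ?thesis unfolding vec_eq_iff forall_6 v mixed_normal_std using s
      by (intro exI[of _ "s 1"] exI[of _ "s 4"] exI[of _ "s 3"] exI[of _ 2])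
         (simp add: vector_6 Transposition.transpose_def)
  next
    assume "z = 3" thus ?thesis unfolding vec_eq_iff forall_6 v mixed_normal_std using s
      by (intro exI[of _ "s 1"] exI[of _ "s 2"] exI[of _ "s 4"] exI[of _ 3])
         (simp add: vector_6 Transposition.transpose_def)
  next
    assume "z = 4" thus ?thesis unfolding vec_eq_iff forall_6 v mixed_normal_std using s
      by (intro exI[of _ "s 1"] exI[of _ "s 2"] exI[of _ "s 3"] exI[of _ 4])
         (simp add: vector_6 Transposition.transpose_def)
  qed
  then obtain a b c j where "a \<in> {-1,1}" "b \<in> {-1,1}" "c \<in> {-1,1}" and j: "j \<in> {1,2,3,4}"
    and v': "v = (\<chi> i. (vector [a,b,c,0,1/2,3/2] :: real^6) $ (Transposition.transpose 4 j i))" by blast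
  moreover have "Transposition.transpose 4 j permutes {1,2,3,4::6}" using j by (intro permutes_swap_id) auto
  ultimately show "v \<in> ?L" unfolding permute_first_four_def by blast
qed

lemma frame_std: "frame std_E std_n std_m"
  unfolding frame_def
proof (intro conjI allI impI)
  show "normals = cone_normals std_E std_n \<union> cone_normals std_E std_m \<union> mixed_normals std_E std_n std_m"
    unfolding normals_def permute_cone permute_mixed std_n_def std_m_def ..
  show "lor (std_E i) (std_E j) = (if i = j then 1 else 0)" for i j
    using exhaust_4[of i] exhaust_4[of j] by (elim disjE) (simp_all add: lor_def std_E_def axis_def)
  show "lor (std_E i) std_n = 0" "lor (std_E i) std_m = 0" for i
    by (simp_all add: lor_def std_E_def axis_def std_n_def std_m_def vector_6)
  show "lor std_n std_n = 0" "lor std_m std_m = 0" "lor std_n std_m = -1"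
    by (simp_all add: lor_def std_n_def std_m_def vector_6)
  fix z assume e: "\<forall>i. lor z (std_E i) = 0" and nm: "lor z std_n = 0" "lor z std_m = 0"
  have "z $ 1 = 0" "z $ 2 = 0" "z $ 3 = 0" "z $ 4 = 0"
    using spec[OF e, of 1] spec[OF e, of 2] spec[OF e, of 3] spec[OF e, of 4]
    by (simp_all add: std_E_def lor_axis)
  thus "z = 0" using nm unfolding vec_eq_iff forall_6
    by (simp add: lor_def std_n_def std_m_def vector_6)
qed

lemma frame_swap: "frame E n m \<Longrightarrow> frame E m n"
proof -
  have "mixed_normals E m n = mixed_normals E n m"
    by (simp add: mixed_normals_def mixed_normal_def add.assoc add.commute[of m n])
  thus "frame E n m \<Longrightarrow> frame E m n"
    unfolding frame_def by (simp add: lor_commute[of m n] Un_ac)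
qed

lemma frame_signed_permutation:
  assumes f: "frame E n m" and p: "bij p" and t: "\<And>i. t i \<in> {-1, 1}"
  shows "frame (\<lambda>i. t i *\<^sub>R E (p i)) n m"
proof -
  obtain q where pq: "\<And>i. p (q i) = i" "\<And>i. q (p i) = i"
    using p by (metis bij_pointE)
  have tt: "t i * t i = 1" for i using t[of i] by auto
  have pi: "p i = p j \<longleftrightarrow> i = j" for i j using p by (simp add: bij_def inj_eq)
  have "cone_normals (\<lambda>i. t i *\<^sub>R E (p i)) k = cone_normals E k" for k
  proof -
    have "s *\<^sub>R t i *\<^sub>R E (p i) + k \<in> cone_normals E k" if "s \<in> {-1,1}" for s i
      unfolding cone_normals_def mem_Collect_eq using that t[of i]
      by (intro exI[of _ "s * t i"] exI[of _ "p i"]) auto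
    moreover have "s *\<^sub>R E i + k \<in> cone_normals (\<lambda>i. t i *\<^sub>R E (p i)) k" if "s \<in> {-1,1}" for s i
      unfolding cone_normals_def mem_Collect_eq using that t[of "q i"] p
      by (intro exI[of _ "s * t (q i)"] exI[of _ "q i"]) (auto simp: pq tt mult.assoc)
    ultimately show ?thesis
      by (intro subset_antisym subsetI) (metis (no_types, lifting) cone_normals_cases)+
  qed
  moreover have "mixed_normals (\<lambda>i. t i *\<^sub>R E (p i)) n m = mixed_normals E n m"
  proof -
    \<comment> \<open>The factor \<open>t i\<close> enters both through the new axes and through the
      new signs. Its square is 1, so only the reindexing by \<open>p\<close> remains.\<close>
    have *: "mixed_normal (\<lambda>i. t i *\<^sub>R E (p i)) n m (\<lambda>i. t i * s (p i)) z = mixed_normal E n m s (p z)" for s z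
    proof -
      have "(\<Sum>i\<in>UNIV - {z}. (t i * s (p i)) *\<^sub>R t i *\<^sub>R E (p i)) = (\<Sum>i\<in>UNIV - {z}. s (p i) *\<^sub>R E (p i))"
        by (rule sum.cong) (use tt in \<open>simp_all add: algebra_simps\<close>)
      also have "\<dots> = (\<Sum>i\<in>p ` (UNIV - {z}). s i *\<^sub>R E i)"
        by (subst sum.reindex) (use p in \<open>auto simp: bij_def inj_on_def\<close>)
      also have "p ` (UNIV - {z}) = UNIV - {p z}"
        using p by (simp add: bij_def image_set_diff)
      finally show ?thesis by (simp add: mixed_normal_def)
    qed
    have "mixed_normal E n m s z \<in> mixed_normals (\<lambda>i. t i *\<^sub>R E (p i)) n m" if "\<forall>i. s i \<in> {-1,1}" for s z
    proof -
      have "mixed_normal E n m s z = mixed_normal (\<lambda>i. t i *\<^sub>R E (p i)) n m (\<lambda>i. t i * s (p i)) (q z)"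
        unfolding * using p by (simp add: pq)
      moreover have "\<forall>i. t i * s (p i) \<in> {-1,1}"
        using that t by (metis (no_types, lifting) insert_iff empty_iff mult_minus1 mult_cancel_right1 minus_mult_minus mult.left_neutral minus_equation_iff)
      ultimately show ?thesis unfolding mixed_normals_def by blast
    qed
    moreover have "mixed_normal (\<lambda>i. t i *\<^sub>R E (p i)) n m s z \<in> mixed_normals E n m" if s: "\<forall>i. s i \<in> {-1,1}" for s z
    proof -
      define r where "r i = t (q i) * s (q i)" for i
      have "s = (\<lambda>i. t i * r (p i))" using p by (auto simp: r_def pq mult.assoc[symmetric] tt)
      hence "mixed_normal (\<lambda>i. t i *\<^sub>R E (p i)) n m s z = mixed_normal E n m r (p z)" using *[of r z] by simp
      moreover have "r i \<in> {-1,1}" for i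
        unfolding r_def using spec[OF s, of "q i"] t[of "q i"] by auto
      ultimately show ?thesis unfolding mixed_normals_def by blast
    qed
    ultimately show ?thesis
      by (intro subset_antisym subsetI) (metis (no_types, lifting) mixed_normals_cases)+
  qed
  moreover have "z = 0" if "\<forall>i. lor z (t i *\<^sub>R E (p i)) = 0" "lor z n = 0" "lor z m = 0" for z
  proof -
    have "lor z (E i) = 0" for i
      using spec[OF that(1), of "q i"] t[of "q i"] p by (auto simp: lor_simps pq)
    thus ?thesis using f that(2,3) unfolding frame_def by blast
  qed
  ultimately show ?thesis using f t unfolding frame_def
    by (auto simp: lor_simps tt pi)
qed

subsection \<open>First-order deformations\<close>

lemma frame_lor:
  assumes "frame E n m"
  shows "lor (E i) (E j) = (if i = j then 1 else 0)" "lor (E i) n = 0" "lor n (E i) = 0"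
    "lor (E i) m = 0" "lor m (E i) = 0" "lor n n = 0" "lor m m = 0" "lor n m = -1" "lor m n = -1"
  using assms unfolding frame_def by (auto simp: lor_commute)

lemma frame_zero:
  assumes "frame E n m" "\<And>i. lor z (E i) = 0" "lor z n = 0" "lor z m = 0" shows "z = 0"
  using assms unfolding frame_def by blast

definition cone_normal :: "(4 \<Rightarrow> real^6) \<Rightarrow> real^6 \<Rightarrow> real \<Rightarrow> 4 \<Rightarrow> real^6" where
  "cone_normal E n s i = s *\<^sub>R E i + n"

lemma frame_normals:
  assumes "frame E n m" "s \<in> {-1, 1}"
  shows "cone_normal E n s i \<in> normals" "cone_normal E m s i \<in> normals"
  using assms unfolding frame_def cone_normal_def cone_normals_def by blast+

lemma frame_mixed_normals:
  assumes "frame E n m" "\<And>i. r i \<in> {-1, 1}"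
  shows "mixed_normal E n m r z \<in> normals"
  using assms unfolding frame_def mixed_normals_def by blast

lemma frame_normals_cases:
  assumes "frame E n m" "v \<in> normals"
  obtains s i where "s \<in> {-1, 1}" "v = cone_normal E n s i"
  | s i where "s \<in> {-1, 1}" "v = cone_normal E m s i"
  | r z where "\<And>i. r i \<in> {-1, 1}" "v = mixed_normal E n m r z"
  using assms unfolding frame_def mixed_normals_def cone_normals_def cone_normal_def by blast

lemma mixed_normal_swap: "mixed_normal E n m = mixed_normal E m n"
  by (simp add: fun_eq_iff mixed_normal_def add.assoc add.commute[of n m])

lemma mixed_normal_expand:
  assumes "distinct [i,j,k,z]"
  shows "mixed_normal E n m r z = r i *\<^sub>R E i + r j *\<^sub>R E j + r k *\<^sub>R E k + n + m"
proof -
  have "card {i,j,k,z} = card (UNIV :: 4 set)" using assms by simp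
  hence "UNIV = {i,j,k,z}" using card_subset_eq[of UNIV "{i,j,k,z}"] by simp
  hence "UNIV - {z} = {i,j,k}" using assms by auto
  thus ?thesis using assms by (simp add: mixed_normal_def add.assoc)
qed

lemma others_4: obtains j k l :: 4 where "distinct [i,j,k,l]"
proof -
  have "distinct [1,2,3,4::4]" "distinct [2,1,3,4::4]" "distinct [3,1,2,4::4]" "distinct [4,1,2,3::4]"
    by simp_all
  thus ?thesis using exhaust_4[of i] that by metis
qed

lemma others_2_4: assumes "i \<noteq> j" obtains k l :: 4 where "distinct [i,j,k,l]"
proof -
  have "card {i,j} = 2" using assms by simp
  hence "card (UNIV - {i,j}) = 2" by (subst card_Diff_subset) simp_all
  then obtain k l where kl: "UNIV - {i,j} = {k,l}" "k \<noteq> l" by (auto simp: card_2_iff)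
  hence "k \<notin> {i,j}" "l \<notin> {i,j}" by blast+
  thus ?thesis using that[of k l] kl(2) assms by auto
qed

section \<open>Preserved products at the cusps\<close>

text \<open>\<open>y\<close> assigns a velocity to each normal and is constrained on
  \<open>K\<close> only. \<open>unit\<close> and \<open>orth\<close> are the derivatives of the
  conditions that normals keep norm 1 and that orthogonal ones stay orthogonal; \<open>cover\<close>
  is what is retained of the disjointness of the removed facets.\<close>

locale first_order =
  fixes K :: "(real^6) set" and y :: "real^6 \<Rightarrow> real^6"
  assumes K: "K \<subseteq> normals"
    and cover: "\<And>v w. v \<in> normals \<Longrightarrow> w \<in> normals \<Longrightarrow> lor v w = 0 \<Longrightarrow> v \<in> K \<or> w \<in> K"
    and unit: "\<And>v. v \<in> K \<Longrightarrow> lor (y v) v = 0"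
    and orth: "\<And>v w. v \<in> K \<Longrightarrow> w \<in> K \<Longrightarrow> lor v w = 0 \<Longrightarrow> lor (y v) w + lor v (y w) = 0"
begin

text \<open>The derivative of the product of the two normals vanishes. For orthogonal normals in
  \<open>K\<close> this is \<open>orth\<close>; the cusps contribute the pairs with product
  -1.\<close>

definition preserved :: "real^6 \<Rightarrow> real^6 \<Rightarrow> bool" where
  "preserved v w \<longleftrightarrow> lor (y v) w + lor v (y w) = 0"

lemma preserved_sym: "preserved v w \<Longrightarrow> preserved w v"
  by (simp add: preserved_def lor_commute)

text \<open>The radial velocities \<open>t\<^sub>a\<close> of three orthogonal pairs of parallel facets of a cusp satisfy
  \<open>t\<^sub>a / \<alpha> = - t\<^sub>b / \<beta>\<close> for any two of the pairs, hence vanish.\<close>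

lemma cusp_three_pairs:
  assumes K: "a \<in> K" "a' \<in> K" "b \<in> K" "b' \<in> K" "c \<in> K" "c' \<in> K"
    and ab: "lor a b = 0" "lor a b' = 0" "lor a' b = 0" "lor a' b' = 0"
    and ac: "lor a c = 0" "lor a c' = 0" "lor a' c = 0" "lor a' c' = 0"
    and bc: "lor b c = 0" "lor b c' = 0" "lor b' c = 0" "lor b' c' = 0"
    and sums: "a + a' = \<alpha> *\<^sub>R N" "b + b' = \<beta> *\<^sub>R N" "c + c' = \<gamma> *\<^sub>R N"
    and nz: "\<alpha> \<noteq> 0" "\<beta> \<noteq> 0" "\<gamma> \<noteq> 0"
  shows "preserved a a'"
proof -
  define t where "t v w = lor (y v + y w) N" for v w
  have two: "\<beta>' * t v v' + \<alpha>' * t w w' = 0"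
    if "v \<in> K" "v' \<in> K" "w \<in> K" "w' \<in> K" "lor v w = 0" "lor v w' = 0" "lor v' w = 0" "lor v' w' = 0"
      and s: "v + v' = \<alpha>' *\<^sub>R N" "w + w' = \<beta>' *\<^sub>R N" for v v' w w' \<alpha>' \<beta>'
  proof -
    \<comment> \<open>Adding the four orthogonality equations between two pairs leaves only the sums
      of the pairs, which are multiples of the same null vector \<open>N\<close>.\<close>
    have "lor (y v + y v') (w + w') + lor (v + v') (y w + y w') = 0"
      using orth[of v w] orth[of v w'] orth[of v' w] orth[of v' w'] that(1-8) by (simp add: lor_add)
    thus ?thesis unfolding s by (simp add: t_def lor_linear(3,4) lor_commute)
  qed
  have "\<beta> * t a a' + \<alpha> * t b b' = 0" by (rule two) fact+
  moreover have "\<gamma> * t a a' + \<alpha> * t c c' = 0" by (rule two) fact+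
  moreover have "\<gamma> * t b b' + \<beta> * t c c' = 0" by (rule two) fact+
  \<comment> \<open>\<open>\<gamma>\<close> times the first plus \<open>\<beta>\<close> times the
    second minus \<open>\<alpha>\<close> times the third equation.\<close>
  ultimately have "2 * \<beta> * \<gamma> * t a a' = 0" using nz by algebra
  hence "t a a' = 0" using nz by simp
  \<comment> \<open>By \<open>unit\<close>, \<open>y a\<close> is orthogonal to \<open>a\<close>, so
    it pairs with \<open>a'\<close> as it does with a multiple of \<open>N\<close>; the same holds
    with \<open>a\<close> and \<open>a'\<close> exchanged.\<close>
  have a': "a' = \<alpha> *\<^sub>R N - a" and a: "a = \<alpha> *\<^sub>R N - a'" using sums(1) by (auto simp: algebra_simps)
  have "lor (y a) a' = \<alpha> * lor (y a) N"
    by (subst a') (use unit[OF K(1)] in \<open>simp add: lor_linear\<close>)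
  moreover have "lor a (y a') = \<alpha> * lor (y a') N"
    by (subst a) (use unit[OF K(2)] in \<open>simp add: lor_linear(1-4) lor_commute\<close>)
  ultimately show ?thesis using \<open>t a a' = 0\<close> nz unfolding preserved_def t_def
    by (simp add: lor_add flip: distrib_left)
qed

text \<open>At most one of the four pairs of a cusp loses a facet.\<close>

lemma cusp_four_pairs:
  assumes K: "a \<in> K" "a' \<in> K" and N: "b \<in> normals" "b' \<in> normals" "c \<in> normals" "c' \<in> normals"
      "d \<in> normals" "d' \<in> normals"
    and ab: "lor a b = 0" "lor a b' = 0" "lor a' b = 0" "lor a' b' = 0"
    and ac: "lor a c = 0" "lor a c' = 0" "lor a' c = 0" "lor a' c' = 0"
    and ad: "lor a d = 0" "lor a d' = 0" "lor a' d = 0" "lor a' d' = 0"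
    and bc: "lor b c = 0" "lor b c' = 0" "lor b' c = 0" "lor b' c' = 0"
    and bd: "lor b d = 0" "lor b d' = 0" "lor b' d = 0" "lor b' d' = 0"
    and cd: "lor c d = 0" "lor c d' = 0" "lor c' d = 0" "lor c' d' = 0"
    and sums: "a + a' = \<alpha> *\<^sub>R N" "b + b' = \<beta> *\<^sub>R N" "c + c' = \<gamma> *\<^sub>R N" "d + d' = \<delta> *\<^sub>R N"
    and nz: "\<alpha> \<noteq> 0" "\<beta> \<noteq> 0" "\<gamma> \<noteq> 0" "\<delta> \<noteq> 0"
  shows "preserved a a'"
proof -
  have "b \<in> K \<and> b' \<in> K \<or> c \<in> K \<and> c' \<in> K" "b \<in> K \<and> b' \<in> K \<or> d \<in> K \<and> d' \<in> K"
    "c \<in> K \<and> c' \<in> K \<or> d \<in> K \<and> d' \<in> K"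
    using cover N bc bd cd by meson+
  then consider "b \<in> K" "b' \<in> K" "c \<in> K" "c' \<in> K" | "b \<in> K" "b' \<in> K" "d \<in> K" "d' \<in> K"
    | "c \<in> K" "c' \<in> K" "d \<in> K" "d' \<in> K" by blast
  thus ?thesis
  proof cases
    case 1 thus ?thesis
      by (intro cusp_three_pairs[OF K _ _ _ _ ab ac bc sums(1-3) nz(1-3)])
  next
    case 2 thus ?thesis
      by (intro cusp_three_pairs[OF K _ _ _ _ ab ad bd sums(1,2,4) nz(1,2,4)])
  next
    case 3 thus ?thesis
      by (intro cusp_three_pairs[OF K _ _ _ _ ac ad cd sums(1,3,4) nz(1,3,4)])
  qed
qed

context
  fixes E n m assumes frame: "frame E n m"
begin

lemmas frame_gram = frame_lor[OF frame] lor_simps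

text \<open>At the ideal point \<open>n\<close> the four pairs are the opposite normals on the four
  axes; each pair adds up to twice \<open>n\<close>.\<close>

lemma preserved_opposite:
  assumes "cone_normal E n 1 i \<in> K" "cone_normal E n (-1) i \<in> K"
  shows "preserved (cone_normal E n 1 i) (cone_normal E n (-1) i)"
proof -
  obtain j k l where d: "distinct [i,j,k,l]" by (rule others_4)
  show ?thesis
    by (rule cusp_four_pairs[where N = n and \<alpha> = 2 and \<beta> = 2 and \<gamma> = 2 and \<delta> = 2, OF assms
        frame_normals(1)[OF frame, of 1 j] frame_normals(1)[OF frame, of "-1" j]
        frame_normals(1)[OF frame, of 1 k] frame_normals(1)[OF frame, of "-1" k]
        frame_normals(1)[OF frame, of 1 l] frame_normals(1)[OF frame, of "-1" l]])
       (use d in \<open>simp_all add: cone_normal_def frame_gram scaleR_2\<close>)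
qed

lemma preserved_cone_cone:
  assumes "s \<in> {-1,1}" "t \<in> {-1,1}" "cone_normal E n s i \<in> K" "cone_normal E n t j \<in> K"
  shows "preserved (cone_normal E n s i) (cone_normal E n t j)"
proof (cases "i = j")
  case True
  thus ?thesis using assms preserved_opposite[of i] preserved_sym unit
    by (auto simp: preserved_def lor_commute)
next
  case False
  thus ?thesis using orth[OF assms(3,4)] by (simp add: preserved_def cone_normal_def frame_gram)
qed

text \<open>On different axes the two facets are parallel, with ideal point
  \<open>s E i + t E j + n + m\<close>; on the same axis with equal signs they are orthogonal. The
  excluded case has product -2, where the hyperplanes are a positive distance apart.\<close>

lemma preserved_cones:
  assumes st: "s \<in> {-1,1}" "t \<in> {-1,1}" and K: "cone_normal E n s i \<in> K" "cone_normal E m t j \<in> K"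
    and "i \<noteq> j \<or> s = t"
  shows "preserved (cone_normal E n s i) (cone_normal E m t j)"
proof (cases "i = j")
  case True
  thus ?thesis using orth[OF K] assms by (auto simp: preserved_def cone_normal_def frame_gram)
next
  case ij: False
  then obtain k l where d: "distinct [i,j,k,l]" by (rule others_2_4)
  hence ne: "i \<noteq> j" "i \<noteq> k" "i \<noteq> l" "j \<noteq> k" "j \<noteq> l" "k \<noteq> l" by auto
  \<comment> \<open>\<open>r\<close> and \<open>r'\<close> agree on \<open>i\<close> and
    \<open>j\<close> and are opposite on the third axis, so the two mixed normals omitting the same
    one of \<open>k\<close>, \<open>l\<close> add up to twice the ideal point.\<close>
  define r where "r = (\<lambda>h. if h = i then s else if h = j then t else 1)"
  define r' where "r' = (\<lambda>h. if h = i then s else if h = j then t else -1)"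
  have r: "r h \<in> {-1,1}" "r' h \<in> {-1,1}" for h using st by (auto simp: r_def r'_def)
  have m: "mixed_normal E n m r l = s *\<^sub>R E i + t *\<^sub>R E j + E k + n + m"
      "mixed_normal E n m r' l = s *\<^sub>R E i + t *\<^sub>R E j - E k + n + m"
    using d by (auto simp: mixed_normal_expand[of i j k l] r_def r'_def)
  have "distinct [i,j,l,k]" using d by auto
  hence m': "mixed_normal E n m r k = s *\<^sub>R E i + t *\<^sub>R E j + E l + n + m"
      "mixed_normal E n m r' k = s *\<^sub>R E i + t *\<^sub>R E j - E l + n + m"
    using d by (auto simp: mixed_normal_expand[of i j l k] r_def r'_def)
  have ss: "s * s = 1" "t * t = 1" using st by auto
  note M = frame_mixed_normals[OF frame, of r] frame_mixed_normals[OF frame, of r']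
  show ?thesis
    by (rule cusp_four_pairs[where N = "s *\<^sub>R E i + t *\<^sub>R E j + n + m"
        and \<alpha> = 1 and \<beta> = 1 and \<gamma> = 2 and \<delta> = 2, OF K
        frame_normals(1)[OF frame, of t j] frame_normals(2)[OF frame, of s i]
        M(1)[of l] M(2)[of l] M(1)[of k] M(2)[of k]])
       (use st r ss in \<open>simp_all add: ne ne[symmetric] m m' cone_normal_def frame_gram scaleR_2\<close>)
qed

text \<open>The cusp is the sum of all four signed axes, \<open>2 n\<close> and \<open>m\<close>:
  for each axis, the normal at \<open>n\<close> on it and the mixed normal omitting it add up to
  this null vector.\<close>

lemma preserved_mixed_opposite:
  assumes r: "\<And>i. r i \<in> {-1,1}" and K: "cone_normal E n (r i) i \<in> K" "mixed_normal E n m r i \<in> K"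
  shows "preserved (cone_normal E n (r i) i) (mixed_normal E n m r i)"
proof -
  obtain j k l where d: "distinct [i,j,k,l]" by (rule others_4)
  hence ne: "i \<noteq> j" "i \<noteq> k" "i \<noteq> l" "j \<noteq> k" "j \<noteq> l" "k \<noteq> l" by auto
  have rr: "r h * r h = 1" for h using r[of h] by auto
  have d': "distinct [j,k,l,i]" "distinct [i,k,l,j]" "distinct [i,j,l,k]" using d by auto
  note M = frame_mixed_normals[OF frame, of r]
  show ?thesis
    by (rule cusp_four_pairs[where
          N = "r i *\<^sub>R E i + r j *\<^sub>R E j + r k *\<^sub>R E k + r l *\<^sub>R E l + n + n + m"
        and \<alpha> = 1 and \<beta> = 1 and \<gamma> = 1 and \<delta> = 1, OF K
        frame_normals(1)[OF frame, of "r j" j] M(1)[of j] frame_normals(1)[OF frame, of "r k" k] M(1)[of k]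
        frame_normals(1)[OF frame, of "r l" l] M(1)[of l]])
      (use rr r in \<open>simp_all add: ne ne[symmetric] mixed_normal_expand[OF d'(1)] mixed_normal_expand[OF d'(2)]
        mixed_normal_expand[OF d'(3)] mixed_normal_expand[OF d] cone_normal_def frame_gram\<close>)
qed

text \<open>The product is -1 on the omitted axis, and 0 on another axis with matching sign.\<close>

lemma preserved_cone_mixed:
  assumes r: "\<And>i. r i \<in> {-1,1}" and t: "t \<in> {-1,1}"
    and K: "cone_normal E n t i \<in> K" "mixed_normal E n m r z \<in> K" and i: "i = z \<or> t = r i"
  shows "preserved (cone_normal E n t i) (mixed_normal E n m r z)"
proof (cases "i = z")
  case True
  \<comment> \<open>The sum skips \<open>z\<close>, so the sign there may be set to
    \<open>t\<close>.\<close>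
  have "mixed_normal E n m (r(z := t)) z = mixed_normal E n m r z" by (simp add: mixed_normal_def)
  thus ?thesis using preserved_mixed_opposite[of "r(z := t)" z] True assms by auto
next
  case False
  then obtain k l where d: "distinct [i,z,k,l]" by (rule others_2_4)
  have d': "distinct [i,k,l,z]" using d by auto
  have "t * t = 1" using t by auto
  hence "lor (cone_normal E n t i) (mixed_normal E n m r z) = 0"
    using i False d unfolding mixed_normal_expand[OF d'] by (simp add: cone_normal_def frame_gram)
  thus ?thesis using orth[OF K] by (simp add: preserved_def)
qed

end

section \<open>Propagation of zero velocities\<close>

definition solved :: "real^6 \<Rightarrow> bool" where
  "solved v \<longleftrightarrow> v \<in> K \<and> y v = 0"

lemma solved_preserved: "solved u \<Longrightarrow> preserved u w \<Longrightarrow> lor (y w) u = 0"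
  by (simp add: solved_def preserved_def lor_simps lor_commute)

lemma solved_orth: "solved u \<Longrightarrow> w \<in> K \<Longrightarrow> lor u w = 0 \<Longrightarrow> lor (y w) u = 0"
  using orth[of u w] by (simp add: solved_def lor_zero lor_commute)

context
  fixes E n m assumes frame: "frame E n m"
begin

lemmas frame_gram' = frame_lor[OF frame] lor_simps

lemma solvedI:
  assumes "v \<in> K" "lor (y v) (E 1) = 0" "lor (y v) (E 2) = 0" "lor (y v) (E 3) = 0"
    "lor (y v) (E 4) = 0" "lor (y v) n = 0" "lor (y v) m = 0"
  shows "solved v"
proof -
  have "lor (y v) (E i) = 0" for i using exhaust_4[of i] assms by auto
  thus ?thesis using frame_zero[OF frame] assms by (simp add: solved_def)
qed

text \<open>A solved partner has zero velocity, so a preserved product turns into one linear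
  equation between frame coordinates of the unknown velocity. The equations that follow have the
  same origin or express the unit condition.\<close>

lemma cone_cone_eq:
  assumes "solved (cone_normal E n t j)" "t \<in> {-1,1}" "s \<in> {-1,1}" "cone_normal E n s i \<in> K"
  shows "t * lor (y (cone_normal E n s i)) (E j) + lor (y (cone_normal E n s i)) n = 0"
  using solved_preserved[OF assms(1) preserved_cone_cone[OF frame assms(2,3) _ assms(4)]] assms(1)
  by (simp add: solved_def frame_gram' cone_normal_def[of E n t])

lemma other_cone_eq:
  assumes "solved (cone_normal E m t j)" "t \<in> {-1,1}" "s \<in> {-1,1}" "cone_normal E n s i \<in> K" "i \<noteq> j \<or> s = t"
  shows "t * lor (y (cone_normal E n s i)) (E j) + lor (y (cone_normal E n s i)) m = 0"
  using solved_preserved[OF assms(1) preserved_sym[OF preserved_cones[OF frame assms(3,2,4) _ assms(5)]]] assms(1)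
  by (simp add: solved_def frame_gram' cone_normal_def[of E m t])

lemma cone_self_eq:
  assumes "cone_normal E n s i \<in> K"
  shows "s * lor (y (cone_normal E n s i)) (E i) + lor (y (cone_normal E n s i)) n = 0"
proof -
  have "lor (y v) (cone_normal E n s i) = s * lor (y v) (E i) + lor (y v) n" for v
    by (simp add: cone_normal_def frame_gram')
  thus ?thesis using unit[OF assms] by simp
qed

lemma mixed_cone_eq:
  assumes "solved (cone_normal E n t i)" "t \<in> {-1,1}" "mixed_normal E n m r z \<in> K"
    "\<And>i. r i \<in> {-1,1}" "i = z \<or> t = r i"
  shows "t * lor (y (mixed_normal E n m r z)) (E i) + lor (y (mixed_normal E n m r z)) n = 0"
  using solved_preserved[OF assms(1) preserved_cone_mixed[OF frame assms(4,2) _ assms(3,5)]] assms(1)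
  by (simp add: solved_def frame_gram' cone_normal_def[of E n t])

lemma mixed_self_eq:
  assumes "mixed_normal E n m r z \<in> K" "distinct [i,j,k,z]"
  shows "r i * lor (y (mixed_normal E n m r z)) (E i) + r j * lor (y (mixed_normal E n m r z)) (E j) +
    r k * lor (y (mixed_normal E n m r z)) (E k) + lor (y (mixed_normal E n m r z)) n +
    lor (y (mixed_normal E n m r z)) m = 0"
proof -
  have "lor (y v) (mixed_normal E n m r z) = r i * lor (y v) (E i) + r j * lor (y v) (E j) +
    r k * lor (y v) (E k) + lor (y v) n + lor (y v) m" for v
    unfolding mixed_normal_expand[OF assms(2)] by (simp add: frame_gram')
  thus ?thesis using unit[OF assms(1)] by simp
qed

end

lemma all_4I: assumes "distinct [i,j,k,z::4]" "P i" "P j" "P k" "P z" shows "P h"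
proof -
  have "card {i,j,k,z} = card (UNIV :: 4 set)" using assms(1) by simp
  hence "UNIV = {i,j,k,z}" using card_subset_eq[of UNIV "{i,j,k,z}"] by simp
  thus ?thesis using assms(2-) by (metis UNIV_I empty_iff insert_iff)
qed

lemma mixed_other_eq:
  assumes "frame E n m" "solved (cone_normal E m t i)" "t \<in> {-1,1}" "mixed_normal E n m r z \<in> K"
    "\<And>i. r i \<in> {-1,1}" "i = z \<or> t = r i"
  shows "t * lor (y (mixed_normal E n m r z)) (E i) + lor (y (mixed_normal E n m r z)) m = 0"
  using assms(4) unfolding mixed_normal_swap[of E n m]
  by (intro mixed_cone_eq[OF frame_swap[OF assms(1)] assms(2,3)] assms(5,6))

lemma cover_cones:
  assumes "frame E n m" "s \<in> {-1,1}" "t \<in> {-1,1}" "i \<noteq> j"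
  shows "cone_normal E n s i \<in> K \<or> cone_normal E n t j \<in> K"
  using assms by (intro cover frame_normals(1)) (auto simp: cone_normal_def frame_lor[OF assms(1)] lor_simps)

lemma cover_cone_pair:
  assumes "frame E n m" "s \<in> {-1,1}"
  shows "cone_normal E n s i \<in> K \<or> cone_normal E m s i \<in> K"
  using assms by (intro cover frame_normals[OF assms(1)]) (auto simp: cone_normal_def frame_lor[OF assms(1)] lor_simps)

text \<open>The order is: negative normals at \<open>n\<close> on at least two axes, all normals at
  \<open>m\<close>, the remaining negative normals at \<open>n\<close>, the mixed normals. Which of
  these belong to \<open>K\<close> is unknown, so each stage relies on \<open>cover\<close> to
  provide enough solved partners.\<close>

lemma solve_full_side:
  assumes f: "frame E n m" and A: "\<And>j. solved (cone_normal E n 1 j)"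
    and k: "solved (cone_normal E m 1 k)"
  shows "\<forall>v\<in>K. y v = 0"
proof -
  \<comment> \<open>The four positive normals and the unit condition determine five coordinates; a
    solved normal at \<open>m\<close> on another axis determines the sixth.\<close>
  have A_neg: "solved (cone_normal E n (-1) i)"
    if K: "cone_normal E n (-1) i \<in> K" and B: "solved (cone_normal E m t j)" "t \<in> {-1,1}" "j \<noteq> i" for i j t
  proof -
    let ?w = "cone_normal E n (-1) i"
    have a: "lor (y ?w) (E h) + lor (y ?w) n = 0" for h
      using cone_cone_eq[OF f A _ _ K, of h] by simp
    hence n: "lor (y ?w) n = 0" using cone_self_eq[OF f K] a[of i] by simp
    hence e: "lor (y ?w) (E h) = 0" for h using a by simp
    have "lor (y ?w) m = 0" using other_cone_eq[OF f B(1,2) _ K] B(3) e[of j] by simp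
    thus ?thesis using solvedI[OF f K] n e by blast
  qed
  \<comment> \<open>Missing normals at \<open>n\<close> all lie on one axis, so among three axes
    other than \<open>k\<close> at least two keep their negative normal. Two are wanted so that one
    of them differs from any given axis.\<close>
  obtain h1 h2 where h: "h1 \<noteq> h2" "solved (cone_normal E n (-1) h1)" "solved (cone_normal E n (-1) h2)"
  proof -
    obtain a b c where d: "distinct [k,a,b,c]" by (rule others_4)
    have "cone_normal E n (-1) a \<in> K \<and> cone_normal E n (-1) b \<in> K \<or>
          cone_normal E n (-1) a \<in> K \<and> cone_normal E n (-1) c \<in> K \<or>
          cone_normal E n (-1) b \<in> K \<and> cone_normal E n (-1) c \<in> K"
      using d cover_cones[OF f, of "-1" "-1" a b] cover_cones[OF f, of "-1" "-1" a c]
        cover_cones[OF f, of "-1" "-1" b c] by auto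
    thus ?thesis using A_neg[OF _ k] d that by auto
  qed
  have B: "solved (cone_normal E m s i)" if K: "cone_normal E m s i \<in> K" and s: "s \<in> {-1,1}" for s i
  proof -
    let ?w = "cone_normal E m s i"
    obtain h where h: "h \<noteq> i" "solved (cone_normal E n (-1) h)" using h by metis
    note f' = frame_swap[OF f]
    have a: "lor (y ?w) (E j) + lor (y ?w) n = 0" if "j \<noteq> i \<or> s = 1" for j
      using other_cone_eq[OF f' A _ s K, of j] that by auto
    moreover have "lor (y ?w) n = lor (y ?w) (E h)"
      using other_cone_eq[OF f' h(2) _ s K] h(1) by auto
    ultimately have n: "lor (y ?w) n = 0" using h(1) by fastforce
    hence e: "lor (y ?w) (E j) = 0" if "j \<noteq> i \<or> s = 1" for j using a that by simp
    have self: "s * lor (y ?w) (E i) + lor (y ?w) m = 0" by (rule cone_self_eq[OF f' K])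
    have kk: "lor (y ?w) (E k) + lor (y ?w) m = 0"
      using cone_cone_eq[OF f' k _ s K] by simp
    have "lor (y ?w) (E i) = 0 \<and> lor (y ?w) m = 0"
    proof (cases "s = 1")
      case True thus ?thesis using e[of i] self by simp
    next
      case False
      thus ?thesis using s self kk e[of k] by (cases "k = i") auto
    qed
    thus ?thesis using solvedI[OF f K] n e by metis
  qed
  \<comment> \<open>With the side of \<open>m\<close> solved, a partner on another axis exists for
    every \<open>i\<close>, also for \<open>i = k\<close>.\<close>
  have An: "solved (cone_normal E n (-1) i)" if K: "cone_normal E n (-1) i \<in> K" for i
  proof -
    obtain a b c where d: "distinct [i,a,b,c]" by (rule others_4)
    have "cone_normal E m 1 a \<in> K \<or> cone_normal E m 1 b \<in> K"
      using d cover_cones[OF frame_swap[OF f], of 1 1 a b] by auto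
    thus ?thesis using A_neg[OF K B] d by auto
  qed
  have A': "solved (cone_normal E n s i)" if "cone_normal E n s i \<in> K" "s \<in> {-1,1}" for s i
    using that A An by auto
  have "solved (mixed_normal E n m r z)" if K: "mixed_normal E n m r z \<in> K" and r: "\<And>i. r i \<in> {-1,1}" for r z
  proof -
    let ?w = "mixed_normal E n m r z"
    let ?a = "\<lambda>i. lor (y ?w) (E i)" let ?n = "lor (y ?w) n" let ?m = "lor (y ?w) m"
    have Aeq: "t * ?a i + ?n = 0" if "cone_normal E n t i \<in> K" "t \<in> {-1,1}" "i = z \<or> t = r i" for t i
      by (rule mixed_cone_eq[OF f A'[OF that(1,2)] that(2) K r that(3)])
    have Beq: "t * ?a i + ?m = 0" if "cone_normal E m t i \<in> K" "t \<in> {-1,1}" "i = z \<or> t = r i" for t i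
      by (rule mixed_other_eq[OF f B[OF that(1,2)] that(2) K r that(3)])
    have Br: "r h * ?a h + ?m = 0" if "cone_normal E m (r h) h \<in> K" for h
      using Beq[OF that r] by simp
    have Ap: "cone_normal E n 1 i \<in> K" for i using A by (simp add: solved_def)
    obtain i j k where d: "distinct [z,i,j,k]" by (rule others_4)
    hence d': "distinct [i,j,k,z]" by auto
    note self = mixed_self_eq[OF f K d']
    note az = Aeq[OF Ap[of z]]
    \<comment> \<open>If the positive normal on axis \<open>z\<close> is missing at
      \<open>m\<close>, all normals at \<open>m\<close> on the other axes are present and give
      substitute equations.\<close>
    have Bz: "?a z + ?m = 0 \<or> (\<forall>h\<in>{i,j,k}. r h * ?a h + ?m = 0)"
    proof (cases "cone_normal E m 1 z \<in> K")
      case True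
      thus ?thesis using Beq[of 1 z] by simp
    next
      case False
      have "cone_normal E m (r h) h \<in> K" if "h \<in> {i,j,k}" for h
        using False cover_cones[OF frame_swap[OF f] _ r, of 1 z h] that d by auto
      thus ?thesis using Br by blast
    qed
    have nz: "r h \<noteq> 0" for h using r[of h] by auto
    have "?a i = 0 \<and> ?a j = 0 \<and> ?a k = 0 \<and> ?a z = 0 \<and> ?n = 0 \<and> ?m = 0"
    \<comment> \<open>If both signs on axis \<open>z\<close> are present at \<open>n\<close>, the
      coordinates for \<open>z\<close> and \<open>n\<close> vanish at once. Otherwise all normals at
      \<open>n\<close> on the other axes are present, and so is \<open>- E z + m\<close>, which is
      orthogonal to the missing one.\<close>
    proof (cases "cone_normal E n (-1) z \<in> K")
      case True
      hence z0: "?a z = 0" "?n = 0" using Aeq[of "-1" z] az by auto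
      have e: "?a h = 0" if "cone_normal E n (r h) h \<in> K" for h
        using Aeq[OF that r] z0 r[of h] by auto
      \<comment> \<open>At most one of the three normals with signs \<open>r\<close> is missing at
        \<open>n\<close>, so at most one of the three coordinates is nonzero; \<open>Bz\<close> and
        \<open>self\<close> eliminate it.\<close>
      have two: "?a h = 0 \<or> ?a h' = 0" if "h \<noteq> h'" for h h'
        using e[of h] e[of h'] cover_cones[OF f r r that] by blast
      show ?thesis
        using Bz z0 self two[of i j] two[of i k] two[of j k] d nz[of i] nz[of j] nz[of k]
        by (auto simp: add_eq_0_iff)
    next
      case False
      have e: "r h * ?a h + ?n = 0" if "h \<in> {i,j,k}" for h
      proof (rule Aeq[OF _ r])
        show "cone_normal E n (r h) h \<in> K"
          using False cover_cones[OF f r, of "-1" h z] that d by auto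
      qed simp
      have "cone_normal E m (-1) z \<in> K" using False cover_cone_pair[OF f, of "-1" z] by auto
      hence m: "- ?a z + ?m = 0" using Beq[of "-1" z] by auto
      have "cone_normal E m (r i) i \<in> K \<or> cone_normal E m (r j) j \<in> K"
        using d cover_cones[OF frame_swap[OF f] r r] by auto
      hence "?m = ?n" using Br[of i] Br[of j] e[of i] e[of j] by auto
      thus ?thesis using m az e[of i] e[of j] e[of k] nz[of i] nz[of j] nz[of k] by auto
    qed
    hence z0: "?a i = 0" "?a j = 0" "?a k = 0" "?a z = 0" "?n = 0" "?m = 0" by blast+
    have "?a h = 0" for h by (rule all_4I[OF d' z0(1-4)])
    thus ?thesis using z0 by (intro solvedI[OF f K])
  qed
  note C = this
  have "solved v" if "v \<in> K" for v
  proof (rule frame_normals_cases[OF f])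
    show "v \<in> normals" using that K by blast
  qed (use that A' B C in auto)
  thus ?thesis by (simp add: solved_def)
qed


text \<open>Axis 1 at \<open>n\<close> and axis 2 at \<open>m\<close> have lost both normals, but
  all other normals at \<open>n\<close> and \<open>m\<close> are present. The equations lost on
  these two axes are recovered from the mixed normals omitting 4, 2 and 1.\<close>

lemma solve_two_full_sides:
  assumes f: "frame E n m"
    and A: "\<And>i t. i \<noteq> 1 \<Longrightarrow> t \<in> {-1,1} \<Longrightarrow> cone_normal E n t i \<in> K"
      "\<And>t. t \<in> {-1,1} \<Longrightarrow> cone_normal E n t 1 \<notin> K"
    and B: "\<And>i t. i \<noteq> 2 \<Longrightarrow> t \<in> {-1,1} \<Longrightarrow> cone_normal E m t i \<in> K"
      "\<And>t. t \<in> {-1,1} \<Longrightarrow> cone_normal E m t 2 \<notin> K"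
    and base: "solved (cone_normal E n 1 3)" "solved (cone_normal E m 1 3)"
      "solved (mixed_normal E n m (\<lambda>_. 1) 4)" "solved (mixed_normal E n m (\<lambda>_. 1) 2)"
      "solved (mixed_normal E n m (\<lambda>_. 1) 1)"
  shows "\<forall>v\<in>K. y v = 0"
proof -
  note f' = frame_swap[OF f]
  let ?one = "\<lambda>_::4. 1::real"
  have d: "distinct [1,2,3,4::4]" "distinct [1,3,4,2::4]" "distinct [2,3,4,1::4]" by simp_all
  have C: "lor x (mixed_normal E n m ?one 4) = lor x (E 1) + lor x (E 2) + lor x (E 3) + lor x n + lor x m"
    "lor x (mixed_normal E n m ?one 2) = lor x (E 1) + lor x (E 3) + lor x (E 4) + lor x n + lor x m"
    "lor x (mixed_normal E n m ?one 1) = lor x (E 2) + lor x (E 3) + lor x (E 4) + lor x n + lor x m" for x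
    unfolding mixed_normal_expand[OF d(1)] mixed_normal_expand[OF d(2)] mixed_normal_expand[OF d(3)]
    by (simp_all add: lor_simps)
  have Ceq: "lor (y (cone_normal E n 1 i)) (mixed_normal E n m ?one z) = 0"
    if "solved (mixed_normal E n m ?one z)" "cone_normal E n 1 i \<in> K" for i z
    using solved_preserved[OF that(1) preserved_sym[OF preserved_cone_mixed[OF f _ _ that(2)]]] that(1)
    by (simp add: solved_def)
  have Ceq': "lor (y (cone_normal E m 1 i)) (mixed_normal E n m ?one z) = 0"
    if "solved (mixed_normal E n m ?one z)" "cone_normal E m 1 i \<in> K" for i z
    using that unfolding mixed_normal_swap[of E n m]
    using solved_preserved[OF _ preserved_sym[OF preserved_cone_mixed[OF f' _ _ that(2)]], of ?one z]
    by (simp add: solved_def)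
  have A_pos: "solved (cone_normal E n 1 i)" if "i \<in> {2,3,4}" for i
  proof -
    let ?w = "cone_normal E n 1 i"
    have K: "?w \<in> K" using A(1)[of i 1] that by auto
    have e: "lor (y ?w) (E 3) + lor (y ?w) n = 0" "lor (y ?w) (E 3) + lor (y ?w) m = 0"
      "lor (y ?w) (E i) + lor (y ?w) n = 0"
      using cone_cone_eq[OF f base(1) _ _ K] other_cone_eq[OF f base(2) _ _ K] cone_self_eq[OF f K] by auto
    note c = Ceq[OF base(3) K, unfolded C] Ceq[OF base(4) K, unfolded C] Ceq[OF base(5) K, unfolded C]
    show ?thesis
    proof (cases "i = 3")
      case False
      hence "lor (y ?w) (E 1) = lor (y ?w) (E 3) \<or> lor (y ?w) (E 2) = lor (y ?w) (E 3) \<or>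
        lor (y ?w) (E 4) = lor (y ?w) (E 3)" using that e by auto
      thus ?thesis using e c by (intro solvedI[OF f K]; elim disjE; linarith)
    qed (use base(1) in simp)
  qed
  have B_pos: "solved (cone_normal E m 1 i)" if "i \<in> {1,3,4}" for i
  proof -
    let ?w = "cone_normal E m 1 i"
    have K: "?w \<in> K" using B(1)[of i 1] that by auto
    have e: "lor (y ?w) (E 3) + lor (y ?w) m = 0" "lor (y ?w) (E 3) + lor (y ?w) n = 0"
      "lor (y ?w) (E i) + lor (y ?w) m = 0"
      using cone_cone_eq[OF f' base(2) _ _ K] other_cone_eq[OF f' base(1) _ _ K] cone_self_eq[OF f' K] by auto
    note c = Ceq'[OF base(3) K, unfolded C] Ceq'[OF base(4) K, unfolded C] Ceq'[OF base(5) K, unfolded C]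
    show ?thesis
    proof (cases "i = 3")
      case False
      hence "lor (y ?w) (E 1) = lor (y ?w) (E 3) \<or> lor (y ?w) (E 2) = lor (y ?w) (E 3) \<or>
        lor (y ?w) (E 4) = lor (y ?w) (E 3)" using that e by auto
      thus ?thesis using e c by (intro solvedI[OF f K]; elim disjE; linarith)
    qed (use base(2) in simp)
  qed
  have A_neg: "solved (cone_normal E n (-1) i)" if "i \<in> {2,3,4}" for i
  proof -
    let ?w = "cone_normal E n (-1) i"
    have K: "?w \<in> K" using A(1)[of i "-1"] that by auto
    \<comment> \<open>The partner at \<open>m\<close> must lie on an axis other than
      \<open>i\<close>, because \<open>- E i + n\<close> and \<open>E i + m\<close> have product -2;
      axis 3 or 4 always serves.\<close>
    define j :: 4 where "j = (if i = 3 then 4 else 3)"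
    hence j: "j \<in> {3,4}" "j \<noteq> i" by auto
    have "lor (y ?w) n = 0"
      using cone_cone_eq[OF f A_pos[OF that] _ _ K] cone_self_eq[OF f K] by simp
    hence e: "lor (y ?w) (E h) = 0" "lor (y ?w) n = 0" if "h \<in> {2,3,4}" for h
      using cone_cone_eq[OF f A_pos[OF that] _ _ K] by simp_all
    have "lor (y ?w) m = 0" using other_cone_eq[OF f B_pos _ _ K, of j] j e(1)[of j] by auto
    moreover have "lor (y ?w) (E 1) = - lor (y ?w) m" 
      using other_cone_eq[OF f B_pos _ _ K, of 1] that by auto
    ultimately show ?thesis using e[of 2] e[of 3] e[of 4] by (intro solvedI[OF f K]) simp_all
  qed
  have B_neg: "solved (cone_normal E m (-1) i)" if "i \<in> {1,3,4}" for i
  proof -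
    let ?w = "cone_normal E m (-1) i"
    have K: "?w \<in> K" using B(1)[of i "-1"] that by auto
    define j :: 4 where "j = (if i = 3 then 4 else 3)"
    hence j: "j \<in> {3,4}" "j \<noteq> i" by auto
    have "lor (y ?w) m = 0"
      using cone_cone_eq[OF f' B_pos[OF that] _ _ K] cone_self_eq[OF f' K] by simp
    hence e: "lor (y ?w) (E h) = 0" "lor (y ?w) m = 0" if "h \<in> {1,3,4}" for h
      using cone_cone_eq[OF f' B_pos[OF that] _ _ K] by simp_all
    have "lor (y ?w) n = 0" using other_cone_eq[OF f' A_pos _ _ K, of j] j e(1)[of j] by auto
    moreover have "lor (y ?w) (E 2) = - lor (y ?w) n" 
      using other_cone_eq[OF f' A_pos _ _ K, of 2] that by auto
    ultimately show ?thesis using e[of 1] e[of 3] e[of 4] by (intro solvedI[OF f K]) simp_all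
  qed
  have A': "solved (cone_normal E n t i)" if "i \<noteq> 1" "t \<in> {-1,1}" for i t
    using that A_pos[of i] A_neg[of i] exhaust_4[of i] by auto
  have B': "solved (cone_normal E m t i)" if "i \<noteq> 2" "t \<in> {-1,1}" for i t
    using that B_pos[of i] B_neg[of i] exhaust_4[of i] by auto
  have C: "solved (mixed_normal E n m r z)" if K: "mixed_normal E n m r z \<in> K" and r: "\<And>i. r i \<in> {-1,1}" for r z
  proof -
    let ?w = "mixed_normal E n m r z"
    let ?a = "\<lambda>i. lor (y ?w) (E i)" let ?n = "lor (y ?w) n" let ?m = "lor (y ?w) m"
    have Aeq: "t * ?a i + ?n = 0" if "i \<noteq> 1" "t \<in> {-1,1}" "i = z \<or> t = r i" for t i
      by (rule mixed_cone_eq[OF f A'[OF that(1,2)] that(2) K r that(3)])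
    have Beq: "t * ?a i + ?m = 0" if "i \<noteq> 2" "t \<in> {-1,1}" "i = z \<or> t = r i" for t i
      by (rule mixed_other_eq[OF f B'[OF that(1,2)] that(2) K r that(3)])
    have Ar: "r h * ?a h + ?n = 0" if "h \<noteq> 1" for h using Aeq[OF that r] by simp
    have Br: "r h * ?a h + ?m = 0" if "h \<noteq> 2" for h using Beq[OF that r] by simp
    \<comment> \<open>Both signs on axis \<open>z\<close> are present at one of the two ideal
      points, at \<open>m\<close> if \<open>z = 1\<close> and at \<open>n\<close> otherwise.\<close>
    have z: "?a z = 0"
      using Aeq[of z 1] Aeq[of z "-1"] Beq[of z 1] Beq[of z "-1"] by (cases "z = 1") auto
    have nz: "r i \<noteq> 0" for i using r[of i] by auto
    have "?n = 0 \<and> ?m = 0"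
    proof -
      consider "z = 1" | "z = 2" | "z \<noteq> 1" "z \<noteq> 2" by blast
      thus ?thesis
      proof cases
        case 1
        hence m: "?m = 0" using Beq[of 1 1] z by simp
        hence "?a 3 = 0" using Br[of 3] nz[of 3] by simp
        thus ?thesis using m Ar[of 3] by simp
      next
        case 2
        hence n: "?n = 0" using Aeq[of 2 1] z by simp
        hence "?a 3 = 0" using Ar[of 3] nz[of 3] by simp
        thus ?thesis using n Br[of 3] by simp
      next
        case 3
        thus ?thesis using Aeq[of z 1] Beq[of z 1] z by simp
      qed
    qed
    moreover have "?a i = 0" for i
      using calculation Ar[of i] Br[of i] nz[of i] by (cases "i = 1") auto
    ultimately show ?thesis by (intro solvedI[OF f K]) auto
  qed
  have "solved v" if "v \<in> K" for v
  proof (rule frame_normals_cases[OF f])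
    show "v \<in> normals" using that K by blast
    show "solved v" if "s \<in> {-1,1}" "v = cone_normal E n s i" for s i
      using that \<open>v \<in> K\<close> A'[of i s] A(2)[of s] by (cases "i = 1") auto
    show "solved v" if "s \<in> {-1,1}" "v = cone_normal E m s i" for s i
      using that \<open>v \<in> K\<close> B'[of i s] B(2)[of s] by (cases "i = 2") auto
  qed (use that C in auto)
  thus ?thesis by (simp add: solved_def)
qed

end

subsection \<open>Gauges\<close>

definition covering :: "(real^6) set \<Rightarrow> bool" where
  "covering K \<longleftrightarrow> K \<subseteq> normals \<and> (\<forall>v\<in>normals. \<forall>w\<in>normals. lor v w = 0 \<longrightarrow> v \<in> K \<or> w \<in> K)"

text \<open>A gauge: the vectors \<open>p i\<close> and the plane spanned by the null vectors \<open>n\<close>, \<open>N\<close> decompose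
  the space; fixing the \<open>p i\<close> and the pairing of \<open>q\<close> with \<open>n\<close> rules out all Lorentz
  transformations close to the identity.\<close>

definition gauge :: "(real^6) set \<Rightarrow> (4 \<Rightarrow> real^6) \<Rightarrow> real^6 \<Rightarrow> real^6 \<Rightarrow> real^6 \<Rightarrow> bool" where
  "gauge K p q n N \<longleftrightarrow> range p \<subseteq> K \<and> q \<in> K \<and>
     (\<forall>i j. lor (p i) (p j) = (if i = j then 1 else 0)) \<and>
     (\<forall>i. lor (p i) n = 0 \<and> lor (p i) N = 0) \<and>
     lor n n = 0 \<and> lor N N = 0 \<and> lor n N = -1 \<and> lor q n \<noteq> 0"

text \<open>The second conjunct says that no nonzero first-order deformation on \<open>K\<close>
  respects the gauge, so the existence of such a gauge is infinitesimal rigidity modulo Lorentz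
  transformations.\<close>

definition rigid_gauge :: "(real^6) set \<Rightarrow> (4 \<Rightarrow> real^6) \<Rightarrow> real^6 \<Rightarrow> real^6 \<Rightarrow> real^6 \<Rightarrow> bool" where
  "rigid_gauge K p q n N \<longleftrightarrow> gauge K p q n N \<and>
     (\<forall>y. first_order K y \<longrightarrow> (\<forall>i. y (p i) = 0) \<longrightarrow> lor (y q) n = 0 \<longrightarrow> (\<forall>v\<in>K. y v = 0))"

lemma rigid_gauge_full_side:
  assumes K: "covering K" and f: "frame E n m" and A: "\<And>i. cone_normal E n 1 i \<in> K"
  shows "\<exists>p q n N. rigid_gauge K p q n N"
proof -
  note gram = frame_lor[OF f] lor_simps cone_normal_def
  have "cone_normal E m 1 1 \<in> K \<or> cone_normal E m 1 2 \<in> K"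
    using K frame_normals(2)[OF f, of 1] by (simp add: covering_def gram)
  then obtain k where k: "cone_normal E m 1 k \<in> K" by blast
  let ?p = "\<lambda>i. cone_normal E n 1 i" and ?q = "cone_normal E m 1 k"
  \<comment> \<open>\<open>?N\<close> is the second null direction in the plane orthogonal to the
    four \<open>?p i\<close>, the first one being \<open>n\<close>; the two are the ends of the
    geodesic common to the four hyperplanes.\<close>
  let ?N = "(\<Sum>i\<in>UNIV. E i) + m + 2 *\<^sub>R n"
  have "gauge K ?p ?q n ?N"
    unfolding gauge_def using A k by (auto simp: gram lor_sum)
  moreover have "\<forall>v\<in>K. y v = 0"
    if y: "first_order K y" "\<And>i. y (?p i) = 0" "lor (y ?q) n = 0" for y
  proof -
    interpret first_order K y by (rule y)
    have s: "solved (?p i)" for i using A y(2) by (simp add: solved_def)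
    have e: "lor (y ?q) (E i) = 0" for i
      using other_cone_eq[OF frame_swap[OF f] s _ _ k] y(3) by simp
    have "solved ?q"
      using cone_self_eq[OF frame_swap[OF f] k] e y(3) by (intro solvedI[OF f k]) auto
    thus ?thesis using solve_full_side[OF f s] by blast
  qed
  ultimately show ?thesis unfolding rigid_gauge_def by blast
qed

text \<open>Neither \<open>n\<close> nor \<open>m\<close> has normals left on all four axes, so the
  gauge consists of five pairwise orthogonal normals of several kinds. Each is in \<open>K\<close>
  because it is orthogonal to a missing normal.\<close>

lemma rigid_gauge_two_full_sides:
  assumes K: "covering K" and f: "frame E n m"
    and A: "\<And>t. t \<in> {-1,1} \<Longrightarrow> cone_normal E n t 1 \<notin> K"
    and B: "\<And>t. t \<in> {-1,1} \<Longrightarrow> cone_normal E m t 2 \<notin> K"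
  shows "\<exists>p q n N. rigid_gauge K p q n N"
proof -
  note gram = frame_lor[OF f] lor_simps
  have cov: "w \<in> K" if "w \<in> normals" "v \<in> normals" "v \<notin> K" "lor v w = 0" for v w
    using K that by (auto simp: covering_def)
  have A': "cone_normal E n t i \<in> K" if "i \<noteq> 1" "t \<in> {-1,1}" for i t
    by (rule cov[OF frame_normals(1)[OF f that(2)] frame_normals(1)[OF f, of 1 1] A[of 1]])
       (use that in \<open>auto simp: cone_normal_def gram\<close>)
  have B': "cone_normal E m t i \<in> K" if "i \<noteq> 2" "t \<in> {-1,1}" for i t
    by (rule cov[OF frame_normals(2)[OF f that(2)] frame_normals(2)[OF f, of 1 2] B[of 1]])
       (use that in \<open>auto simp: cone_normal_def gram\<close>)
  define C where "C = mixed_normal E n m (\<lambda>_. 1)"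
  have "distinct [1,2,3,4::4]" "distinct [1,3,4,2::4]" "distinct [2,3,4,1::4]" by simp_all
  note C = this[THEN mixed_normal_expand, of E n m "\<lambda>_. 1", folded C_def, simplified]
  have CN: "C z \<in> normals" for z using frame_mixed_normals[OF f, of "\<lambda>_. 1"] by (simp add: C_def)
  have CK: "C 4 \<in> K" "C 2 \<in> K" "C 1 \<in> K"
  proof -
    show "C 4 \<in> K" "C 2 \<in> K"
      by (rule cov[OF CN frame_normals(1)[OF f, of 1 1] A[of 1]]; simp add: C cone_normal_def gram)+
    show "C 1 \<in> K"
      by (rule cov[OF CN frame_normals(2)[OF f, of 1 2] B[of 1]]; simp add: C cone_normal_def gram)
  qed
  define p where "p i = (if i = 1 then cone_normal E n 1 3 else if i = 2 then cone_normal E m 1 3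
    else if i = 3 then C 4 else C 2)" for i :: 4
  have p: "p 1 = cone_normal E n 1 3" "p 2 = cone_normal E m 1 3" "p 3 = C 4" "p 4 = C 2"
    by (simp_all add: p_def)
  \<comment> \<open>\<open>\<tau>\<close> is a unit time-like vector orthogonal to the five
    orthonormal vectors \<open>p i\<close> and \<open>C 1\<close>. The null directions of the plane
    of \<open>\<tau>\<close> and \<open>C 1\<close> are those of \<open>?n\<close> and
    \<open>?N\<close>, scaled to have product -1.\<close>
  define \<tau> where "\<tau> = E 1 + E 2 + 2 *\<^sub>R E 3 + E 4 + 2 *\<^sub>R n + 2 *\<^sub>R m"
  let ?n = "C 1 + \<tau>" and ?N = "(1/2) *\<^sub>R (\<tau> - C 1)"
  have "gauge K p (C 1) ?n ?N"
    unfolding gauge_def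
  proof (intro conjI allI)
    show "lor (p i) (p j) = (if i = j then 1 else 0)" for i j
      using exhaust_4[of i] exhaust_4[of j] by (elim disjE) (simp_all add: p C cone_normal_def gram)
    show "lor (p i) ?n = 0" "lor (p i) ?N = 0" for i
    proof -
      have "lor (p i) (C 1) = 0 \<and> lor (p i) \<tau> = 0"
        using exhaust_4[of i] by (elim disjE) (simp_all add: p C \<tau>_def cone_normal_def gram)
      thus "lor (p i) ?n = 0" "lor (p i) ?N = 0" by (simp_all add: lor_simps)
    qed
    show "range p \<subseteq> K" using A'[of 3 1] B'[of 3 1] CK by (simp add: p_def image_subset_iff)
    have "lor (C 1) (C 1) = 1" "lor (C 1) \<tau> = 0" "lor \<tau> (C 1) = 0" "lor \<tau> \<tau> = -1"
      by (simp_all add: C \<tau>_def gram)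
    thus "lor ?n ?n = 0" "lor ?N ?N = 0" "lor ?n ?N = -1" "lor (C 1) ?n \<noteq> 0"
      by (simp_all add: lor_simps)
  qed (use CK in simp)
  moreover have "\<forall>v\<in>K. y v = 0"
    if y: "first_order K y" "\<And>i. y (p i) = 0" "lor (y (C 1)) ?n = 0" for y
  proof -
    interpret first_order K y by (rule y)
    have s: "solved (cone_normal E n 1 3)" "solved (cone_normal E m 1 3)" "solved (C 4)" "solved (C 2)"
      using y(2)[of 1] y(2)[of 2] y(2)[of 3] y(2)[of 4] CK A'[of 3 1] B'[of 3 1] by (simp_all add: p solved_def)
    have o: "lor (y (C 1)) v = 0" if "solved v" "lor v (C 1) = 0" for v
      using solved_orth[OF that(1) CK(3) that(2)] .
    have O: "lor (cone_normal E n 1 3) (C 1) = 0" "lor (cone_normal E m 1 3) (C 1) = 0"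
      "lor (C 4) (C 1) = 0" "lor (C 2) (C 1) = 0"
      by (simp_all add: C cone_normal_def gram)
    have "lor (y (C 1)) (cone_normal E n 1 3) = 0" "lor (y (C 1)) (cone_normal E m 1 3) = 0"
      "lor (y (C 1)) (C 4) = 0" "lor (y (C 1)) (C 2) = 0"
      using o[OF s(1)] o[OF s(2)] o[OF s(3)] o[OF s(4)] O by blast+
    moreover have "lor z (cone_normal E n 1 3) = lor z (E 3) + lor z n"
      "lor z (cone_normal E m 1 3) = lor z (E 3) + lor z m"
      "lor z (C 4) = lor z (E 1) + lor z (E 2) + lor z (E 3) + lor z n + lor z m"
      "lor z (C 2) = lor z (E 1) + lor z (E 3) + lor z (E 4) + lor z n + lor z m"
      "lor z (C 1) = lor z (E 2) + lor z (E 3) + lor z (E 4) + lor z n + lor z m"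
      "lor z ?n = lor z (C 1) + lor z \<tau>"
      "lor z \<tau> = lor z (E 1) + lor z (E 2) + 2 * lor z (E 3) + lor z (E 4) + 2 * lor z n + 2 * lor z m"
      for z by (simp_all only: C \<tau>_def cone_normal_def lor_add(2) lor_linear(4) scaleR_one)
    \<comment> \<open>Orthogonality to the four \<open>p i\<close>, the unit condition and the
      pairing with \<open>?n\<close> are six independent linear conditions.\<close>
    ultimately have "solved (C 1)"
      using unit[OF CK(3)] y(3) by (intro solvedI[OF f CK(3)]; simp)
    thus ?thesis using s by (intro solve_two_full_sides[OF f A' A B' B]) (simp_all add: C_def)
  qed
  ultimately show ?thesis unfolding rigid_gauge_def by blast
qed

text \<open>Changing the signs of the axes turns the selected normals into positive ones.\<close>

lemma rigid_gauge_signs: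
  assumes K: "covering K" and f: "frame E n m" and A: "\<And>i. \<exists>s\<in>{-1,1}. cone_normal E n s i \<in> K"
  shows "\<exists>p q n N. rigid_gauge K p q n N"
proof -
  obtain s where s: "\<And>i. s i \<in> {-1,1}" "\<And>i. cone_normal E n (s i) i \<in> K" using A by metis
  have "frame (\<lambda>i. s i *\<^sub>R E (id i)) n m" by (rule frame_signed_permutation[OF f bij_id s(1)])
  moreover have "cone_normal (\<lambda>i. s i *\<^sub>R E (id i)) n 1 i \<in> K" for i
    using s(2)[of i] by (simp add: cone_normal_def)
  ultimately show ?thesis by (rule rigid_gauge_full_side[OF K])
qed

text \<open>If both ideal points have lost an axis, the two axes differ, because
  \<open>E i + n\<close> and \<open>E i + m\<close> are orthogonal; a permutation moves them to 1
  and 2.\<close>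

lemma rigid_gauge_exists:
  assumes K: "covering K"
  shows "\<exists>p q n N. rigid_gauge K p q n N"
proof -
  let ?E = std_E and ?n = std_n and ?m = std_m
  note f = frame_std
  consider "\<forall>i. \<exists>s\<in>{-1,1}. cone_normal ?E ?n s i \<in> K" | "\<forall>i. \<exists>s\<in>{-1,1}. cone_normal ?E ?m s i \<in> K"
    | i j where "\<forall>s\<in>{-1,1}. cone_normal ?E ?n s i \<notin> K" "\<forall>s\<in>{-1,1}. cone_normal ?E ?m s j \<notin> K"
    by blast
  thus ?thesis
  proof cases
    case 1 thus ?thesis using rigid_gauge_signs[OF K f] by blast
  next
    case 2 thus ?thesis using rigid_gauge_signs[OF K frame_swap[OF f]] by blast
  next
    case (3 i j)
    have "i \<noteq> j"
    proof
      assume "i = j"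
      moreover have "lor (cone_normal ?E ?n 1 i) (cone_normal ?E ?m 1 i) = 0"
        by (simp add: cone_normal_def frame_lor[OF f] lor_simps)
      ultimately show False using 3 K frame_normals[OF f, of 1 i] by (auto simp: covering_def)
    qed
    then obtain k l where d: "distinct [i,j,k,l]" by (rule others_2_4)
    define p where "p h = (if h = 1 then i else if h = 2 then j else if h = 3 then k else l)" for h :: 4
    have "inj p" unfolding inj_def p_def using d exhaust_4 by auto
    hence "bij p" by (simp add: bij_def finite_UNIV_inj_surj)
    hence "frame (\<lambda>i. 1 *\<^sub>R ?E (p i)) ?n ?m" by (intro frame_signed_permutation[OF f]) auto
    thus ?thesis
      by (rule rigid_gauge_two_full_sides[OF K]) (use 3 in \<open>auto simp: cone_normal_def p_def\<close>)
  qed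
qed

lemma bounded_bilinear_lor: "bounded_bilinear lor"
proof -
  have "bilinear lor"
    unfolding bilinear_def by (auto intro!: linearI simp: lor_simps)
  thus ?thesis by (simp add: bilinear_conv_bounded_bilinear)
qed

lemmas continuous_on_lor [continuous_intros] = bounded_bilinear.continuous_on[OF bounded_bilinear_lor]
lemmas isCont_lor [continuous_intros] = bounded_bilinear.continuous[OF bounded_bilinear_lor]

subsection \<open>Even products of reflections\<close>

definition lrefl :: "real^6 \<Rightarrow> real^6 \<Rightarrow> real^6" where
  "lrefl a x = x - (2 * lor x a) *\<^sub>R a"

text \<open>Reflections are added in pairs on the outside, so that an induction step can make the
  outer pair cancel; this is what connects the orbit to the inclusion.\<close>

inductive_set even_maps :: "(real^6 \<Rightarrow> real^6) set" where
  even_id: "(\<lambda>x. x) \<in> even_maps"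
| even_step: "L \<in> even_maps \<Longrightarrow> lor a a = 1 \<Longrightarrow> lor b b = 1 \<Longrightarrow> (\<lambda>x. lrefl a (lrefl b (L x))) \<in> even_maps"

lemma lrefl_lrefl: "lor a a = 1 \<Longrightarrow> lrefl a (lrefl a x) = x"
  by (simp add: lrefl_def lor_simps)

lemma lor_lrefl: "lor a a = 1 \<Longrightarrow> lor (lrefl a x) (lrefl a y) = lor x y"
  by (simp add: lrefl_def lor_simps lor_commute algebra_simps)

lemma lrefl_self_adjoint: "lor (lrefl a x) y = lor x (lrefl a y)"
  by (simp add: lrefl_def lor_simps lor_commute algebra_simps)

lemma linear_lrefl: "linear (lrefl a)"
  by (rule linearI) (simp_all add: lrefl_def lor_simps algebra_simps)

lemma lrefl_orthogonal: "lor x a = 0 \<Longrightarrow> lrefl a x = x"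
  by (simp add: lrefl_def)

lemma lrefl_self: "lor a a = 1 \<Longrightarrow> lrefl a a = - a"
  by (simp add: lrefl_def algebra_simps flip: scaleR_2)

lemma even_maps_linear: "L \<in> even_maps \<Longrightarrow> linear L"
proof (induction rule: even_maps.induct)
  case even_id show ?case using linear_id by (simp add: id_def)
next
  case (even_step L a b)
  show ?case
    using linear_compose[OF linear_compose[OF even_step.IH linear_lrefl[of b]] linear_lrefl[of a]]
    by (simp add: o_def)
qed

lemma even_maps_lor: "L \<in> even_maps \<Longrightarrow> lor (L x) (L y) = lor x y"
  by (induction rule: even_maps.induct) (simp_all add: lor_lrefl)

lemma even_maps_comp: "L \<in> even_maps \<Longrightarrow> M \<in> even_maps \<Longrightarrow> (\<lambda>x. L (M x)) \<in> even_maps"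
  by (induction rule: even_maps.induct) (auto intro: even_maps.intros)

lemma even_maps_two: "lor a a = 1 \<Longrightarrow> lor b b = 1 \<Longrightarrow> (\<lambda>x. lrefl a (lrefl b x)) \<in> even_maps"
  using even_step[OF even_id] by simp

lemma even_maps_inverse:
  "L \<in> even_maps \<Longrightarrow> \<exists>M\<in>even_maps. (\<forall>x. M (L x) = x) \<and> (\<forall>x. L (M x) = x)"
proof (induction rule: even_maps.induct)
  case even_id show ?case by (rule bexI[OF _ even_maps.even_id]) simp
next
  case (even_step L a b)
  then obtain M where M: "M \<in> even_maps" "\<And>x. M (L x) = x" "\<And>x. L (M x) = x" by blast
  have "(\<lambda>x. M (lrefl b (lrefl a x))) \<in> even_maps"
    using even_maps_comp[OF M(1) even_maps_two[OF even_step.hyps(3,2)]] .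
  thus ?case by (rule bexI[rotated]) (simp add: M even_step.hyps lrefl_lrefl)
qed

subsection \<open>Configurations of normal vectors\<close>

lemma finite_permute_first_four: "finite W \<Longrightarrow> finite (permute_first_four W)"
proof -
  assume "finite W"
  moreover have "permute_first_four W = (\<lambda>(w, \<sigma>). \<chi> i. w $ \<sigma> i) ` (W \<times> {\<sigma>. \<sigma> permutes {1,2,3,4}})"
    unfolding permute_first_four_def by auto
  ultimately show ?thesis using finite_permutations[of "{1,2,3,4::6}"] by simp
qed

lemma finite_normals: "finite normals"
proof -
  have "{vector [a, b, c, 0, 1/2, 3/2] | a b c. a \<in> {-1, 1} \<and> b \<in> {-1, 1} \<and> c \<in> {-1, 1::real}} =
      (\<lambda>(a, b, c). vector [a, b, c, 0, 1/2, 3/2] :: real^6) ` ({-1,1} \<times> {-1,1} \<times> {-1,1})"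
    by auto
  thus ?thesis unfolding normals_def by (auto intro!: finite_permute_first_four)
qed

text \<open>With a finite index type, families of normals become points of a Euclidean space whose
  unit sphere is compact.\<close>

typedef normal_index = normals
  using frame_normals(1)[OF frame_std, of 1 1] by auto

instance normal_index :: finite
proof
  have "inj Rep_normal_index" by (simp add: inj_def Rep_normal_index_inject)
  moreover have "finite (range Rep_normal_index)"
    using finite_normals by (rule finite_subset[rotated]) (use Rep_normal_index in auto)
  ultimately show "finite (UNIV :: normal_index set)" using finite_imageD by blast
qed

abbreviation nrm :: "normal_index \<Rightarrow> real^6" where "nrm \<equiv> Rep_normal_index"

type_synonym config = "real^6^normal_index"

definition base_config :: config where "base_config = (\<chi> i. nrm i)"

definition act :: "(real^6 \<Rightarrow> real^6) \<Rightarrow> config \<Rightarrow> config" where "act L x = (\<chi> i. L (x $ i))"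

definition admissible :: "(real^6) set \<Rightarrow> config \<Rightarrow> bool" where
  "admissible K x \<longleftrightarrow> (\<forall>i. nrm i \<in> K \<longrightarrow> lor (x$i) (x$i) = 1) \<and>
     (\<forall>i j. nrm i \<in> K \<longrightarrow> nrm j \<in> K \<longrightarrow> lor (nrm i) (nrm j) = 0 \<longrightarrow> lor (x$i) (x$j) = 0)"

text \<open>The minimum of \<open>h\<close> on the compact unit sphere is positive, and homogeneity
  carries this bound to vectors of any length.\<close>

lemma homogeneous_lower_bound:
  fixes h :: "'a::euclidean_space \<Rightarrow> real"
  assumes cont: "continuous_on UNIV h" and h0: "\<And>d. 0 \<le> h d"
    and scale: "\<And>t d. h (t *\<^sub>R d) = \<bar>t\<bar> * h d" and pos: "\<And>d. h d = 0 \<Longrightarrow> d = 0"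
  shows "\<exists>c>0. \<forall>d. c * norm d \<le> h d"
proof -
  let ?S = "sphere (0::'a) 1"
  have "(SOME b::'a. b \<in> Basis) \<in> ?S" using SOME_Basis norm_Basis by auto
  hence "?S \<noteq> {}" by blast
  then obtain d0 where d0: "d0 \<in> ?S" "\<And>d. d \<in> ?S \<Longrightarrow> h d0 \<le> h d"
    using continuous_attains_inf[OF compact_sphere _ continuous_on_subset[OF cont subset_UNIV]] by blast
  have "d0 \<noteq> 0" using d0(1) by auto
  hence "h d0 > 0" using pos[of d0] h0[of d0] by linarith
  moreover have "h d0 * norm d \<le> h d" for d
  proof (cases "d = 0")
    case True thus ?thesis using h0 by simp
  next
    case False
    have "h d0 \<le> h ((1 / norm d) *\<^sub>R d)" using False by (intro d0(2)) simp
    thus ?thesis using False unfolding scale by (simp add: field_simps)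
  qed
  ultimately show ?thesis by blast
qed

text \<open>The constraints are quadratic and their linearisation \<open>h\<close> at the base configuration is
  bounded below, so a solution at distance \<open>d\<close> satisfies \<open>c d \<le> C d\<^sup>2\<close>.\<close>

lemma base_config_isolated:
  assumes K: "covering K" and G: "rigid_gauge K p q n N"
  shows "\<exists>\<epsilon>>0. \<forall>x. dist x base_config < \<epsilon> \<longrightarrow> admissible K x \<longrightarrow>
    (\<forall>i. nrm i \<notin> K \<or> nrm i \<in> range p \<longrightarrow> x$i = nrm i) \<longrightarrow>
    (\<forall>i. nrm i = q \<longrightarrow> lor (x$i) n = lor q n) \<longrightarrow> x = base_config"
proof -
  \<comment> \<open>\<open>P\<close> contains the diagonal, so the unit conditions are treated along
    with the orthogonality conditions. \<open>Q\<close> also pins the entries off \<open>K\<close>,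
    about which the constraints say nothing.\<close>
  define P where "P i j \<longleftrightarrow> nrm i \<in> K \<and> nrm j \<in> K \<and> (i = j \<or> lor (nrm i) (nrm j) = 0)" for i j
  define Q where "Q i \<longleftrightarrow> nrm i \<notin> K \<or> nrm i \<in> range p" for i
  define h :: "config \<Rightarrow> real" where "h d =
      (\<Sum>i\<in>UNIV. \<Sum>j\<in>UNIV. (if P i j then \<bar>lor (d$i) (nrm j) + lor (nrm i) (d$j)\<bar> else 0)) +
      (\<Sum>i\<in>UNIV. (if Q i then norm (d$i) else 0)) +
      (\<Sum>i\<in>UNIV. (if nrm i = q then \<bar>lor (d$i) n\<bar> else 0))" for d
  have cont: "continuous_on UNIV h"
  proof -
    have *: "continuous_on UNIV (\<lambda>d. if b then f d else 0)" if "continuous_on UNIV f" for b and f :: "config \<Rightarrow> real"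
      using that by (cases b) simp_all
    thus ?thesis unfolding h_def by (intro * continuous_intros)
  qed
  have h0: "0 \<le> h d" for d unfolding h_def by (intro add_nonneg_nonneg sum_nonneg) auto
  have scale: "h (t *\<^sub>R d) = \<bar>t\<bar> * h d" for t d
  proof -
    have "\<bar>lor ((t *\<^sub>R d)$i) (nrm j) + lor (nrm i) ((t *\<^sub>R d)$j)\<bar> =
        \<bar>t\<bar> * \<bar>lor (d$i) (nrm j) + lor (nrm i) (d$j)\<bar>" "\<bar>lor ((t *\<^sub>R d)$i) n\<bar> = \<bar>t\<bar> * \<bar>lor (d$i) n\<bar>" for i j
      by (simp_all add: lor_simps abs_mult flip: distrib_left)
    thus ?thesis unfolding h_def
      by (simp add: distrib_left sum_distrib_left if_distrib[of "\<lambda>r. \<bar>t\<bar> * r"] cong: if_cong)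
  qed
  have pos: "d = 0" if "h d = 0" for d
  proof -
    have s: "(\<Sum>i\<in>UNIV. \<Sum>j\<in>UNIV. (if P i j then \<bar>lor (d$i) (nrm j) + lor (nrm i) (d$j)\<bar> else 0)) = 0"
      "(\<Sum>i\<in>UNIV. (if Q i then norm (d$i) else 0)) = 0"
      "(\<Sum>i\<in>UNIV. (if nrm i = q then \<bar>lor (d$i) n\<bar> else 0)) = 0"
    proof -
      have "0 \<le> (\<Sum>i\<in>UNIV. \<Sum>j\<in>UNIV. (if P i j then \<bar>lor (d$i) (nrm j) + lor (nrm i) (d$j)\<bar> else 0))"
        "0 \<le> (\<Sum>i\<in>UNIV. (if Q i then norm (d$i) else 0))"
        "0 \<le> (\<Sum>i\<in>UNIV. (if nrm i = q then \<bar>lor (d$i) n\<bar> else 0))"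
        by (intro sum_nonneg; simp)+
      thus "(\<Sum>i\<in>UNIV. \<Sum>j\<in>UNIV. (if P i j then \<bar>lor (d$i) (nrm j) + lor (nrm i) (d$j)\<bar> else 0)) = 0"
      "(\<Sum>i\<in>UNIV. (if Q i then norm (d$i) else 0)) = 0"
      "(\<Sum>i\<in>UNIV. (if nrm i = q then \<bar>lor (d$i) n\<bar> else 0)) = 0"
        using that unfolding h_def by linarith+
    qed
    have dP: "lor (d$i) (nrm j) + lor (nrm i) (d$j) = 0" if "P i j" for i j
    proof -
      have "(\<Sum>j\<in>UNIV. (if P i j then \<bar>lor (d$i) (nrm j) + lor (nrm i) (d$j)\<bar> else 0)) = 0"
        using s(1) by (subst (asm) sum_nonneg_eq_0_iff) (auto intro!: sum_nonneg)
      thus ?thesis using that by (subst (asm) sum_nonneg_eq_0_iff) (auto split: if_splits)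
    qed
    have dQ: "d$i = 0" if "Q i" for i
      using s(2) that by (subst (asm) sum_nonneg_eq_0_iff) (auto split: if_splits)
    have dq: "lor (d$i) n = 0" if "nrm i = q" for i
      using s(3) that by (subst (asm) sum_nonneg_eq_0_iff) (auto split: if_splits)
    define y where "y v = d $ Abs_normal_index v" for v
    have yd: "y (nrm i) = d$i" for i by (simp add: y_def Rep_normal_index_inverse)
    have exK: "\<exists>i. v = nrm i" if "v \<in> K" for v
      using that K Abs_normal_index_inverse[of v] unfolding covering_def by (metis subsetD)
    have "first_order K y"
    proof
      show "K \<subseteq> normals" using K by (simp add: covering_def)
      show "v \<in> K \<or> w \<in> K" if "v \<in> normals" "w \<in> normals" "lor v w = 0" for v w
        using K that by (auto simp: covering_def)
      show "lor (y v) v = 0" if v: "v \<in> K" for v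
      proof -
        obtain i where "v = nrm i" using exK[OF v] by blast
        thus ?thesis using dP[of i i] v by (simp add: P_def yd lor_commute)
      qed
      show "lor (y v) w + lor v (y w) = 0" if vw: "v \<in> K" "w \<in> K" "lor v w = 0" for v w
      proof -
        obtain i j where "v = nrm i" "w = nrm j" using exK[OF vw(1)] exK[OF vw(2)] by blast
        thus ?thesis using dP[of i j] vw by (simp add: P_def yd)
      qed
    qed
    moreover have "y (p i) = 0" for i
    proof -
      obtain k where "p i = nrm k"
        using exK[of "p i"] G unfolding rigid_gauge_def gauge_def by blast
      thus ?thesis using dQ[of k] by (metis Q_def rangeI yd)
    qed
    moreover have "lor (y q) n = 0"
    proof -
      obtain k where "q = nrm k"
        using exK[of q] G unfolding rigid_gauge_def gauge_def by blast
      thus ?thesis using dq[of k] by (simp add: yd)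
    qed
    ultimately have "y v = 0" if "v \<in> K" for v using G that unfolding rigid_gauge_def by blast
    hence "d$i = 0" for i using dQ[of i] yd[of i] by (cases "nrm i \<in> K") (auto simp: Q_def)
    thus "d = 0" by (simp add: vec_eq_iff)
  qed
  obtain c where c: "c > 0" "\<And>d. c * norm d \<le> h d"
    using homogeneous_lower_bound[of h, OF cont h0 scale pos] by blast
  obtain B where B: "B > 0" "\<And>a b. \<bar>lor a b\<bar> \<le> norm a * norm b * B"
    using bounded_bilinear.pos_bounded[OF bounded_bilinear_lor] by auto
  \<comment> \<open>One bound \<open>(norm d)^2 * B\<close> for every ordered pair of
    indices.\<close>
  define C where "C = real (CARD(normal_index) * CARD(normal_index)) * B"
  have C: "C > 0" using B by (simp add: C_def)
  show ?thesis
  proof (intro exI[of _ "c / C"] conjI allI impI)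
    show "c / C > 0" using c C by simp
    fix x assume near: "dist x base_config < c / C" and A: "admissible K x"
      and fixd: "\<forall>i. nrm i \<notin> K \<or> nrm i \<in> range p \<longrightarrow> x$i = nrm i"
      and q: "\<forall>i. nrm i = q \<longrightarrow> lor (x$i) n = lor q n"
    define d where "d = x - base_config"
    have di: "x$i = nrm i + d$i" for i by (simp add: d_def base_config_def)
    have "\<bar>lor (d$i) (nrm j) + lor (nrm i) (d$j)\<bar> \<le> (norm d)^2 * B" if "P i j" for i j
    proof -
      have "lor (x$i) (x$j) = lor (nrm i) (nrm j)"
        using A that normals_unit[OF Rep_normal_index, of i] unfolding admissible_def P_def by metis
      hence "lor (d$i) (nrm j) + lor (nrm i) (d$j) = - lor (d$i) (d$j)"
        unfolding di by (simp add: lor_simps)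
      moreover have "norm (d$i) * norm (d$j) * B \<le> (norm d * norm d) * B"
        using B(1) by (intro mult_mono mult_right_mono Finite_Cartesian_Product.norm_nth_le) auto
      ultimately show ?thesis using B(2)[of "d$i" "d$j"] by (simp add: power2_eq_square)
    qed
    hence "(if P i j then \<bar>lor (d$i) (nrm j) + lor (nrm i) (d$j)\<bar> else 0) \<le> (norm d)^2 * B" for i j
      using B(1) by auto
    hence "(\<Sum>i\<in>UNIV. \<Sum>j\<in>UNIV. (if P i j then \<bar>lor (d$i) (nrm j) + lor (nrm i) (d$j)\<bar> else 0))
        \<le> (\<Sum>i\<in>(UNIV::normal_index set). \<Sum>j\<in>(UNIV::normal_index set). (norm d)^2 * B)"
      by (intro sum_mono)
    also have "\<dots> = C * (norm d)^2" by (simp add: C_def)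
    finally have "h d \<le> C * (norm d)^2"
      using fixd q unfolding h_def by (simp add: Q_def di lor_simps cong: if_cong)
    hence "c * norm d \<le> C * norm d * norm d" using c(2)[of d] by (simp add: power2_eq_square mult.assoc)
    moreover have "C * norm d < c" using near C by (simp add: d_def dist_norm field_simps)
    ultimately have "norm d = 0"
      by (metis mult_less_cancel_right_pos norm_ge_zero less_eq_real_def not_less)
    thus "x = base_config" by (simp add: d_def)
  qed
qed

section \<open>Moving a nearby configuration into the gauge\<close>

lemma act_comp: "act L (act M x) = act (\<lambda>v. L (M v)) x"
  by (simp add: act_def vec_eq_iff)

lemma isCont_vec_lambda: "(\<And>i. isCont (\<lambda>x. f x i) a) \<Longrightarrow> isCont (\<lambda>x. \<chi> i. f x i) a"
  by (simp add: isCont_def tendsto_vec_lambda)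

text \<open>With \<open>e\<close> and \<open>e'\<close> unit vectors close to each other, reflecting in \<open>e + e'\<close> and then in
  \<open>e\<close> moves \<open>e'\<close> to \<open>e\<close>.\<close>

lemma rotate_to_base:
  assumes e: "lor (base_config$k) (base_config$k) = 1" and \<epsilon>: "\<epsilon> > 0"
  shows "\<exists>\<delta>>0. \<forall>x. dist x base_config < \<delta> \<longrightarrow> lor (x$k) (x$k) = 1 \<longrightarrow>
    (\<exists>L\<in>even_maps. L (x$k) = base_config$k \<and>
      (\<forall>z. lor z (x$k) = 0 \<longrightarrow> lor z (base_config$k) = 0 \<longrightarrow> L z = z) \<and>
      dist (act L x) base_config < \<epsilon>)"
proof -
  define e where "e = base_config$k"
  have ee: "lor e e = 1" using assms by (simp add: e_def)
  \<comment> \<open>Dividing by \<open>lor w w\<close> instead of normalizing \<open>w\<close> keeps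
    the reflection rational in \<open>w\<close>, hence continuous near \<open>e + e\<close>, where
    it is the reflection in \<open>e\<close>.\<close>
  define R where "R w v = v - (2 * lor v w / lor w w) *\<^sub>R w" for w v
  have R: "R w v = lrefl ((1 / sqrt (lor w w)) *\<^sub>R w) v" if "lor w w > 0" for w v
    using that by (simp add: R_def lrefl_def lor_simps)
  define T :: "config \<Rightarrow> config" where "T x = (\<chi> i. lrefl e (R (e + x$k) (x$i)))" for x
  have e2: "lor (e + base_config$k) (e + base_config$k) = 4"
    using ee unfolding e_def[symmetric] lor_add by simp
  have "isCont T base_config"
    unfolding T_def lrefl_def R_def using e2 by (intro isCont_vec_lambda continuous_intros) auto
  moreover have "T base_config = base_config"
  proof -
    have s: "(1 / sqrt (lor (e + e) (e + e))) *\<^sub>R (e + e) = e"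
    proof -
      have "lor (e + e) (e + e) = 2\<^sup>2" using ee unfolding lor_add by simp
      hence "sqrt (lor (e + e) (e + e)) = 2" by simp
      thus ?thesis by (simp only: flip: scaleR_2) simp
    qed
    have "R (e + e) v = lrefl e v" for v
      using R[of "e + e" v] e2 unfolding s by (simp add: e_def)
    hence "lrefl e (R (e + base_config$k) v) = v" for v
      using lrefl_lrefl[OF ee] by (simp only: e_def[symmetric])
    thus ?thesis by (simp add: T_def)
  qed
  ultimately obtain \<delta>1 where \<delta>1: "\<delta>1 > 0" "\<And>x. dist x base_config < \<delta>1 \<Longrightarrow> dist (T x) base_config < \<epsilon>"
    using \<epsilon> unfolding continuous_at_eps_delta by metis
  have "isCont (\<lambda>x. lor (e + x$k) (e + x$k)) base_config" by (intro continuous_intros)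
  then obtain \<delta>2 where \<delta>2: "\<delta>2 > 0" "\<And>x. dist x base_config < \<delta>2 \<Longrightarrow> lor (e + x$k) (e + x$k) > 0"
    unfolding continuous_at_eps_delta e2 dist_real_def by (metis zero_less_numeral abs_diff_less_iff diff_self)
  show ?thesis
  proof (intro exI[of _ "min \<delta>1 \<delta>2"] conjI allI impI)
    show "min \<delta>1 \<delta>2 > 0" using \<delta>1 \<delta>2 by simp
    fix x assume x: "dist x base_config < min \<delta>1 \<delta>2" and u: "lor (x$k) (x$k) = 1"
    let ?w = "e + x$k"
    define a where "a = (1 / sqrt (lor ?w ?w)) *\<^sub>R ?w"
    have w: "lor ?w ?w > 0" using \<delta>2 x by simp
    have a: "lor a a = 1" using w by (simp add: a_def lor_linear(3,4))
    have L: "(\<lambda>v. lrefl e (lrefl a v)) \<in> even_maps" by (rule even_maps_two[OF ee a])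
    have T: "act (\<lambda>v. lrefl e (lrefl a v)) x = T x" using R[OF w] by (simp add: act_def T_def a_def)
    \<comment> \<open>\<open>e\<close> and \<open>x$k\<close> have equal norm, so the reflection in
      their sum sends each to minus the other.\<close>
    have "lrefl a (x$k) = - e"
    proof -
      have "lor ?w ?w = 2 * lor (x$k) ?w" using ee u by (simp add: lor_simps lor_commute)
      hence "R ?w (x$k) = - e" using w by (simp add: R_def)
      thus ?thesis using R[OF w] by (simp add: a_def)
    qed
    hence "lrefl e (lrefl a (x$k)) = e" using lrefl_self[OF ee] by (simp add: lrefl_def lor_simps)
    moreover have "lrefl e (lrefl a z) = z" if "lor z (x$k) = 0" "lor z e = 0" for z
      using that by (simp add: a_def lrefl_orthogonal lor_simps)
    ultimately show "\<exists>L\<in>even_maps. L (x$k) = base_config$k \<and>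
      (\<forall>z. lor z (x$k) = 0 \<longrightarrow> lor z (base_config$k) = 0 \<longrightarrow> L z = z) \<and>
      dist (act L x) base_config < \<epsilon>"
      using L \<delta>1(2)[of x] x T unfolding e_def[symmetric] by (intro bexI[OF _ L]) simp
  qed
qed

text \<open>The vectors are put in place one at a time. One already in place is orthogonal to both
  the present and the final position of the next, so the next rotation fixes it. Tolerances are
  chosen backwards from the last rotation.\<close>

lemma rotate_all_to_base:
  assumes orth: "\<And>i j. lor (base_config$k i) (base_config$k j) = (if i = j then 1 else 0)"
    and "finite S" "\<epsilon> > 0"
  shows "\<exists>\<delta>>0. \<forall>x. dist x base_config < \<delta> \<longrightarrow>
    (\<forall>i j. lor (x$k i) (x$k j) = (if i = j then 1 else 0)) \<longrightarrow>
    (\<exists>L\<in>even_maps. (\<forall>i\<in>S. L (x$k i) = base_config$k i) \<and> dist (act L x) base_config < \<epsilon>)"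
  using \<open>finite S\<close> \<open>\<epsilon> > 0\<close>
proof (induction S arbitrary: \<epsilon>)
  case empty
  show ?case
    by (intro exI[of _ \<epsilon>] conjI allI impI bexI[OF _ even_id]) (use empty in \<open>auto simp: act_def\<close>)
next
  case (insert i S)
  obtain \<delta>1 where \<delta>1: "\<delta>1 > 0" and rot: "\<And>x. dist x base_config < \<delta>1 \<Longrightarrow> lor (x$k i) (x$k i) = 1 \<Longrightarrow>
    (\<exists>L\<in>even_maps. L (x$k i) = base_config$k i \<and>
      (\<forall>z. lor z (x$k i) = 0 \<longrightarrow> lor z (base_config$k i) = 0 \<longrightarrow> L z = z) \<and>
      dist (act L x) base_config < \<epsilon>)"
    using rotate_to_base[of "k i", OF _ insert.prems] orth[of i i] by auto
  obtain \<delta> where \<delta>: "\<delta> > 0" and IH: "\<And>x. dist x base_config < \<delta> \<Longrightarrow>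
    (\<forall>i j. lor (x$k i) (x$k j) = (if i = j then 1 else 0)) \<Longrightarrow>
    (\<exists>L\<in>even_maps. (\<forall>i\<in>S. L (x$k i) = base_config$k i) \<and> dist (act L x) base_config < \<delta>1)"
    using insert.IH[OF \<delta>1] by auto
  show ?case
  proof (intro exI[of _ \<delta>] conjI allI impI)
    show "\<delta> > 0" by (rule \<delta>)
    fix x assume x: "dist x base_config < \<delta>" "\<forall>i j. lor (x$k i) (x$k j) = (if i = j then 1 else 0)"
    obtain L where L: "L \<in> even_maps" "\<And>j. j \<in> S \<Longrightarrow> L (x$k j) = base_config$k j"
      "dist (act L x) base_config < \<delta>1" using IH[OF x] by blast
    have ax: "lor (act L x $ k a) (act L x $ k b) = (if a = b then 1 else 0)" for a b
      using x(2) by (simp add: act_def even_maps_lor[OF L(1)])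
    obtain M where M: "M \<in> even_maps" "M (act L x $ k i) = base_config$k i"
      "\<And>z. lor z (act L x $ k i) = 0 \<Longrightarrow> lor z (base_config$k i) = 0 \<Longrightarrow> M z = z"
      "dist (act M (act L x)) base_config < \<epsilon>"
      using rot[OF L(3)] ax[of i i] by auto
    have "M (L (x$k j)) = base_config$k j" if "j \<in> insert i S" for j
    proof (cases "j = i")
      case True thus ?thesis using M(2) by (simp add: act_def)
    next
      case False
      hence j: "L (x$k j) = base_config$k j" using that L(2) by simp
      moreover have "lor (base_config$k j) (act L x $ k i) = 0"
        using ax[of j i] False j by (simp add: act_def)
      ultimately show ?thesis using M(3) orth[of j i] False by simp
    qed
    thus "\<exists>L\<in>even_maps. (\<forall>i\<in>insert i S. L (x$k i) = base_config$k i) \<and> dist (act L x) base_config < \<epsilon>"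
      using M(4) unfolding act_comp by (intro bexI[OF _ even_maps_comp[OF M(1) L(1)]]) simp
  qed
qed

text \<open>A boost in the plane of \<open>n\<close> and \<open>N\<close>, written as the product of two reflections
  interchanging the lines of \<open>n\<close> and \<open>N\<close>.\<close>

lemma boost_to_base:
  assumes n: "lor n n = 0" "lor N N = 0" "lor n N = -1" and q: "lor (base_config$k) n \<noteq> 0" and \<epsilon>: "\<epsilon> > 0"
  shows "\<exists>\<delta>>0. \<forall>x. dist x base_config < \<delta> \<longrightarrow>
    (\<exists>L\<in>even_maps. lor (L (x$k)) n = lor (base_config$k) n \<and>
      (\<forall>z. lor z n = 0 \<longrightarrow> lor z N = 0 \<longrightarrow> L z = z) \<and> dist (act L x) base_config < \<epsilon>)"
proof -
  define b where "b \<mu> = (1 / sqrt 2) *\<^sub>R (\<mu> *\<^sub>R n - (1 / \<mu>) *\<^sub>R N)" for \<mu>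
  have N: "lor N n = -1" using n by (simp add: lor_commute)
  have b: "lor (b \<mu>) (b \<mu>) = 1" if "\<mu> \<noteq> 0" for \<mu>
    using that n N by (simp add: b_def lor_simps field_simps)
  \<comment> \<open>Reflecting in \<open>b 1\<close> and then in \<open>b \<mu>\<close> divides the
    pairing with \<open>n\<close> by \<open>\<mu>\<^sup>2\<close>, which dictates this square
    root.\<close>
  define \<mu> where "\<mu> x = sqrt (lor (x$k) n / lor (base_config$k) n)" for x :: config
  define T :: "config \<Rightarrow> config" where "T x = (\<chi> i. lrefl (b (\<mu> x)) (lrefl (b 1) (x$i)))" for x
  have \<mu>1: "\<mu> base_config = 1" using q by (simp add: \<mu>_def)
  have c\<mu>: "isCont \<mu> base_config" unfolding \<mu>_def using q by (intro continuous_intros) auto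
  hence "isCont T base_config"
    unfolding T_def lrefl_def b_def by (intro isCont_vec_lambda continuous_intros) (auto simp: \<mu>1)
  moreover have "T base_config = base_config"
    by (simp add: T_def \<mu>1 vec_eq_iff lrefl_lrefl b)
  ultimately obtain \<delta>1 where \<delta>1: "\<delta>1 > 0" "\<And>x. dist x base_config < \<delta>1 \<Longrightarrow> dist (T x) base_config < \<epsilon>"
    using \<epsilon> unfolding continuous_at_eps_delta by metis
  obtain \<delta>2 where \<delta>2: "\<delta>2 > 0" "\<And>x. dist x base_config < \<delta>2 \<Longrightarrow> \<mu> x > 0"
    using c\<mu> unfolding continuous_at_eps_delta \<mu>1 dist_real_def by (metis zero_less_one abs_diff_less_iff diff_self)
  show ?thesis
  proof (intro exI[of _ "min \<delta>1 \<delta>2"] conjI allI impI)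
    show "min \<delta>1 \<delta>2 > 0" using \<delta>1 \<delta>2 by simp
    fix x assume x: "dist x base_config < min \<delta>1 \<delta>2"
    have \<mu>: "\<mu> x > 0" using x \<delta>2 by simp
    let ?L = "\<lambda>v. lrefl (b (\<mu> x)) (lrefl (b 1) v)"
    have L: "?L \<in> even_maps" using \<mu> by (intro even_maps_two b) auto
    have s: "1 / sqrt 2 * (1 / sqrt 2) = 1 / 2" by simp
    have "lrefl (b (\<mu> x)) n = (1 / (\<mu> x)\<^sup>2) *\<^sub>R N"
    proof -
      have "2 * lor n (b (\<mu> x)) / sqrt 2 = 1 / \<mu> x" using n \<mu> by (simp add: b_def lor_simps field_simps)
      hence "lrefl (b (\<mu> x)) n = n - (1 / \<mu> x) *\<^sub>R (\<mu> x *\<^sub>R n - (1 / \<mu> x) *\<^sub>R N)"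
        by (simp add: lrefl_def b_def[of "\<mu> x"])
      thus ?thesis using \<mu> by (simp add: scaleR_diff_right power2_eq_square)
    qed
    moreover have "lrefl (b 1) N = n"
    proof -
      have "2 * lor N (b 1) / sqrt 2 = - 1" using n N by (simp add: b_def lor_simps)
      hence "lrefl (b 1) N = N - (-1) *\<^sub>R (n - N)"
        by (simp add: lrefl_def b_def[of 1])
      thus ?thesis by simp
    qed
    ultimately have "lor (?L v) n = lor v n / (\<mu> x)\<^sup>2" for v
      using linear_scale[OF linear_lrefl[of "b 1"]] by (simp add: lrefl_self_adjoint lor_simps)
    moreover have "(\<mu> x)\<^sup>2 = lor (x$k) n / lor (base_config$k) n"
      using \<mu> by (simp add: \<mu>_def)
    ultimately have "lor (?L (x$k)) n = lor (base_config$k) n" using \<mu> q by (auto simp: field_simps)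
    moreover have "?L z = z" if "lor z n = 0" "lor z N = 0" for z
      using that by (simp add: b_def lrefl_orthogonal lor_simps)
    moreover have "act ?L x = T x" by (simp add: act_def T_def)
    ultimately show "\<exists>L\<in>even_maps. lor (L (x$k)) n = lor (base_config$k) n \<and>
      (\<forall>z. lor z n = 0 \<longrightarrow> lor z N = 0 \<longrightarrow> L z = z) \<and> dist (act L x) base_config < \<epsilon>"
      using \<delta>1(2)[of x] x by (intro bexI[OF _ L]) simp
  qed
qed

text \<open>First the \<open>p i\<close> are rotated into place, then a boost corrects the pairing
  of \<open>q\<close> with \<open>n\<close>; it fixes the \<open>p i\<close>, which are orthogonal
  to \<open>n\<close> and \<open>N\<close>. Isolation then identifies the result with the base
  configuration.\<close>

lemma admissible_locally_rigid:
  assumes K: "covering K"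
  shows "\<exists>\<epsilon>>0. \<forall>x. dist x base_config < \<epsilon> \<longrightarrow> admissible K x \<longrightarrow>
    (\<exists>L\<in>even_maps. \<forall>i. nrm i \<in> K \<longrightarrow> L (x$i) = nrm i)"
proof -
  obtain p q n N where RG: "rigid_gauge K p q n N" using rigid_gauge_exists[OF K] by blast
  hence G: "gauge K p q n N" by (simp add: rigid_gauge_def)
  have idx: "\<exists>i. v = nrm i" if "v \<in> K" for v
    using that K Abs_normal_index_inverse[of v] unfolding covering_def by (metis subsetD)
  obtain k where k: "\<And>i. nrm (k i) = p i"
  proof -
    have "\<forall>i. \<exists>j. nrm j = p i" using idx G unfolding gauge_def by (metis range_subsetD)
    thus ?thesis using that by metis
  qed
  obtain l where l: "nrm l = q" using idx G unfolding gauge_def by metis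
  have bc: "base_config $ i = nrm i" for i by (simp add: base_config_def)
  obtain \<epsilon> where \<epsilon>: "\<epsilon> > 0" and isolated: "\<And>x. dist x base_config < \<epsilon> \<Longrightarrow> admissible K x \<Longrightarrow>
    (\<forall>i. nrm i \<notin> K \<or> nrm i \<in> range p \<longrightarrow> x$i = nrm i) \<Longrightarrow>
    (\<forall>i. nrm i = q \<longrightarrow> lor (x$i) n = lor q n) \<Longrightarrow> x = base_config"
    using base_config_isolated[OF K RG] by blast
  obtain \<delta>1 where \<delta>1: "\<delta>1 > 0" and boost: "\<And>x. dist x base_config < \<delta>1 \<Longrightarrow>
    (\<exists>L\<in>even_maps. lor (L (x$l)) n = lor (base_config$l) n \<and>
      (\<forall>z. lor z n = 0 \<longrightarrow> lor z N = 0 \<longrightarrow> L z = z) \<and> dist (act L x) base_config < \<epsilon>)"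
    using boost_to_base[of n N l \<epsilon>] G \<epsilon> unfolding gauge_def bc l by auto
  have orth: "lor (base_config$k i) (base_config$k j) = (if i = j then 1 else 0)" for i j
    using G unfolding gauge_def bc k by blast
  obtain \<delta> where \<delta>: "\<delta> > 0" and rotate: "\<And>x. dist x base_config < \<delta> \<Longrightarrow>
    (\<forall>i j. lor (x$k i) (x$k j) = (if i = j then 1 else 0)) \<Longrightarrow>
    (\<exists>L\<in>even_maps. (\<forall>i. L (x$k i) = base_config$k i) \<and> dist (act L x) base_config < \<delta>1)"
    using rotate_all_to_base[of k UNIV, OF orth _ \<delta>1] by auto
  show ?thesis
  proof (intro exI[of _ \<delta>] conjI allI impI)
    show "\<delta> > 0" by (rule \<delta>)
    fix x assume x: "dist x base_config < \<delta>" and A: "admissible K x"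
    have "nrm (k i) \<in> K" for i using G unfolding gauge_def k by blast
    hence "lor (x$k i) (x$k j) = (if i = j then 1 else 0)" for i j
      using A orth[of i j] unfolding admissible_def bc by (cases "i = j") auto
    then obtain L where L: "L \<in> even_maps" "\<And>i. L (x$k i) = p i" "dist (act L x) base_config < \<delta>1"
      using rotate[OF x] unfolding bc k by blast
    obtain M where M: "M \<in> even_maps" "lor (M (L (x$l))) n = lor q n"
      "\<And>z. lor z n = 0 \<Longrightarrow> lor z N = 0 \<Longrightarrow> M z = z" "dist (act M (act L x)) base_config < \<epsilon>"
      using boost[OF L(3)] unfolding bc l by (auto simp: act_def)
    \<comment> \<open>Entries off \<open>K\<close> are unconstrained and are reset to their base
      values, which can only decrease the distance.\<close>
    define x' :: config where "x' = (\<chi> i. if nrm i \<in> K then M (L (x$i)) else nrm i)"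
    have "x' = base_config"
    proof (rule isolated)
      have "norm ((x' - base_config)$i) \<le> norm ((act M (act L x) - base_config)$i)" for i
        by (simp add: x'_def act_def bc)
      hence "dist x' base_config \<le> dist (act M (act L x)) base_config"
        unfolding dist_norm norm_vec_def[of "x' - base_config"]
          norm_vec_def[of "act M (act L x) - base_config"] by (intro L2_set_mono) auto
      thus "dist x' base_config < \<epsilon>" using M(4) by simp
      show "admissible K x'"
        using A by (simp add: admissible_def x'_def even_maps_lor[OF M(1)] even_maps_lor[OF L(1)])
      show "\<forall>i. nrm i \<notin> K \<or> nrm i \<in> range p \<longrightarrow> x'$i = nrm i"
      proof (intro allI impI)
        fix i assume "nrm i \<notin> K \<or> nrm i \<in> range p"
        moreover have "x'$i = nrm i" if "nrm i = p j" for j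
        proof -
          have "i = k j" using that k by (simp flip: Rep_normal_index_inject)
          thus ?thesis using L(2)[of j] M(3)[of "p j"] G k[of j]
            by (simp add: x'_def gauge_def)
        qed
        moreover have "x'$i = nrm i" if "nrm i \<notin> K" using that by (simp add: x'_def)
        ultimately show "x'$i = nrm i" by blast
      qed
      show "\<forall>i. nrm i = q \<longrightarrow> lor (x'$i) n = lor q n"
      proof (intro allI impI)
        fix i assume i: "nrm i = q"
        hence "i = l" using l by (simp flip: Rep_normal_index_inject)
        thus "lor (x'$i) n = lor q n" using M(2) l by (simp add: x'_def)
      qed
    qed
    hence "M (L (x$i)) = nrm i" if "nrm i \<in> K" for i
      using that bc[of i] by (metis (mono_tags, lifting) vec_lambda_beta x'_def)
    thus "\<exists>L\<in>even_maps. \<forall>i. nrm i \<in> K \<longrightarrow> L (x$i) = nrm i"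
      by (intro bexI[OF _ even_maps_comp[OF M(1) L(1)]]) simp
  qed
qed

subsection \<open>Facets\<close>

text \<open>In frame coordinates all products are integers. The decisive case is two mixed normals
  omitting the same axis: they differ in at least one of three signs, so the sign products sum to at
  most 1, while \<open>n + m\<close> contributes -2.\<close>

lemma lor_normals_nonpos:
  assumes "u \<in> normals" "v \<in> normals" "u \<noteq> v"
  shows "lor u v \<le> 0"
proof -
  note f = frame_std
  note gram = frame_lor[OF f] lor_simps
  let ?E = std_E and ?n = std_n and ?m = std_m
  have pm: "s * t \<le> 1" if "s \<in> {-1,1}" "t \<in> {-1,1}" for s t :: real using that by auto
  have cc: "lor (cone_normal ?E k s i) (cone_normal ?E k t j) \<le> 0"
    if "k \<in> {?n,?m}" "cone_normal ?E k s i \<noteq> cone_normal ?E k t j" "s \<in> {-1,1}" "t \<in> {-1,1}" for k s t i j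
    using that by (auto simp: cone_normal_def gram)
  have co: "lor (cone_normal ?E ?n s i) (cone_normal ?E ?m t j) \<le> 0" if "s \<in> {-1,1}" "t \<in> {-1,1}" for s t i j
    using that by (auto simp: cone_normal_def gram)
  have cm: "lor (cone_normal ?E k s i) (mixed_normal ?E ?n ?m r z) \<le> 0"
    if "k \<in> {?n,?m}" "s \<in> {-1,1}" "\<And>i. r i \<in> {-1,1}" for k s i r z
  proof (cases "i = z")
    case True
    obtain a b c where d: "distinct [z,a,b,c]" by (rule others_4)
    hence "distinct [a,b,c,z]" by auto
    thus ?thesis using True d that(1) by (auto simp: mixed_normal_expand cone_normal_def gram)
  next
    case False
    then obtain b c where d: "distinct [i,z,b,c]" by (rule others_2_4)
    hence "distinct [i,b,c,z]" by auto
    thus ?thesis using pm[OF that(2) that(3)[of i]] d that(1)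
      by (auto simp: mixed_normal_expand cone_normal_def gram mult.commute)
  qed
  have mm: "lor (mixed_normal ?E ?n ?m r z) (mixed_normal ?E ?n ?m r' z') \<le> 0"
    if r: "\<And>i. r i \<in> {-1,1}" "\<And>i. r' i \<in> {-1,1}"
      and ne: "mixed_normal ?E ?n ?m r z \<noteq> mixed_normal ?E ?n ?m r' z'" for r r' z z'
  proof (cases "z = z'")
    case True
    obtain a b c where d: "distinct [z,a,b,c]" by (rule others_4)
    hence d': "distinct [a,b,c,z]" by auto
    have e: "r i * r' i = 1 \<longleftrightarrow> r i = r' i" "r i * r' i = -1 \<longleftrightarrow> r i \<noteq> r' i" for i
      using r(1)[of i] r(2)[of i] by auto
    have "r a \<noteq> r' a \<or> r b \<noteq> r' b \<or> r c \<noteq> r' c"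
      using ne unfolding True[symmetric] mixed_normal_expand[OF d'] by auto
    hence "r a * r' a + r b * r' b + r c * r' c \<le> 1"
      using e(2)[of a] e(2)[of b] e(2)[of c] pm[OF r(1) r(2)[of a], of a]
        pm[OF r(1) r(2)[of b], of b] pm[OF r(1) r(2)[of c], of c] by argo
    thus ?thesis using d unfolding True[symmetric] mixed_normal_expand[OF d'] by (auto simp: gram mult.commute)
  next
    case False
    then obtain b c where d: "distinct [z,z',b,c]" by (rule others_2_4)
    hence d': "distinct [z',b,c,z]" "distinct [z,b,c,z']" by auto
    show ?thesis using d pm[OF r(1) r(2)[of b], of b] pm[OF r(1) r(2)[of c], of c]
      unfolding mixed_normal_expand[OF d'(1)] mixed_normal_expand[OF d'(2)] by (auto simp: gram mult.commute)
  qed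
  show ?thesis
  proof (rule frame_normals_cases[OF f assms(1)]; rule frame_normals_cases[OF f assms(2)])
  qed (use assms(3) cc co cm mm in \<open>simp_all add: lor_commute[of "cone_normal ?E ?m _ _" "cone_normal ?E ?n _ _"]
         lor_commute[of "mixed_normal _ _ _ _ _" "cone_normal _ _ _ _"]\<close>)
qed

text \<open>A multiple of an interior point of the polytope, symmetric in the two ideal points and
  orthogonal to the four axes.\<close>

definition center :: "real^6" where "center = vector [0,0,0,0,1/2,3/2]"

lemma center_eq: "center = std_n + std_m"
  by (simp add: center_def std_n_def std_m_def vec_eq_iff forall_6 vector_6)

lemma lor_center_normals: assumes "v \<in> normals" shows "lor center v < 0"
proof -
  note gram = frame_lor[OF frame_std] lor_simps
  show ?thesis
  proof (rule frame_normals_cases[OF frame_std assms])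
    fix r z assume v: "v = mixed_normal std_E std_n std_m r z"
    obtain a b c where "distinct [z,a,b,c]" by (rule others_4)
    hence "distinct [a,b,c,z]" by auto
    thus ?thesis unfolding v center_eq by (simp add: mixed_normal_expand gram)
  qed (simp_all add: cone_normal_def center_eq gram)
qed

lemma normals_nth_6: assumes "v \<in> normals" shows "v$6 > 0"
proof -
  have "v$6 \<in> {1, 1/2, 3/2}"
    using assms unfolding normals_def by (elim UnE; elim permute_first_four_lor) (auto simp: vector_6)
  thus ?thesis by auto
qed

lemma H5_normalize: assumes "lor x x < 0" "x$6 > 0" shows "(1 / sqrt (- lor x x)) *\<^sub>R x \<in> H5"
  using assms by (simp add: H5_def lor_linear(3,4) field_simps)

text \<open>The projection of the center to the intersection of orthogonal facets stays in the
  polytope because all normals have non-positive products.\<close>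

lemma adjacent_facets_meet:
  assumes v: "v \<in> normals" and w: "w \<in> normals" and vw: "lor v w = 0"
  shows "facet v \<inter> facet w \<noteq> {}" "facet v \<noteq> facet w"
proof -
  have u: "lor v v = 1" "lor w w = 1" "lor w v = 0"
    using normals_unit v w vw by (simp_all add: lor_commute)
  have c: "lor center center = -2" "center$6 > 0" by (simp_all add: center_def lor_def vector_6)
  define s t where "s = - lor center v" and "t = - lor center w"
  have st: "s > 0" "t > 0" using lor_center_normals v w by (simp_all add: s_def t_def)
  have cv: "lor center v = - s" "lor v center = - s" "lor center w = - t" "lor w center = - t"
    by (simp_all add: s_def t_def lor_commute)
  define P where "P x = (1 / sqrt (- lor x x)) *\<^sub>R x" for x :: "real^6"
  have PH: "P x \<in> H5" if "lor x x < 0" "x$6 > 0" for x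
    using H5_normalize[OF that] by (simp add: P_def)
  have Plor: "lor (P x) y = 1 / sqrt (- lor x x) * lor x y" for x y
    by (simp add: P_def lor_linear(3))
  have Pf: "P x \<in> facet y" if x: "lor x x < 0" "x$6 > 0" and y: "lor x y = 0" "\<And>u. u \<in> normals \<Longrightarrow> lor x u \<le> 0" for x y
    using PH[OF x] x y(1) y(2)
    unfolding facet_def polytope_P_def halfspace_H5_def hyperplane_H5_def
    by (auto simp: Plor intro!: mult_nonneg_nonpos divide_nonpos_pos)
  define x where "x = center + s *\<^sub>R v + t *\<^sub>R w"
  \<comment> \<open>Projecting to the hyperplane of \<open>v\<close> alone gives a point of its
    facet off the facet of \<open>w\<close>. Distinctness matters because pairwise disjointness
    speaks about distinct facets only.\<close>
  define x' where "x' = center + s *\<^sub>R v"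
  have xle: "lor x y \<le> 0" if "y \<in> normals" for y
  proof -
    have "s * lor v y \<le> 0" if "v \<noteq> y" using lor_normals_nonpos[OF v \<open>y \<in> normals\<close> that] st
      by (simp add: mult_nonneg_nonpos)
    moreover have "t * lor w y \<le> 0" if "w \<noteq> y" using lor_normals_nonpos[OF w \<open>y \<in> normals\<close> that] st
      by (simp add: mult_nonneg_nonpos)
    moreover have "lor x y = lor center y + s * lor v y + t * lor w y" by (simp add: x_def lor_simps)
    ultimately show ?thesis using lor_center_normals[OF that] u vw cv st by (cases "y = v"; cases "y = w") auto
  qed
  have x'le: "lor x' y \<le> 0" if "y \<in> normals" for y
  proof -
    have "s * lor v y \<le> 0" if "v \<noteq> y" using lor_normals_nonpos[OF v \<open>y \<in> normals\<close> that] st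
      by (simp add: mult_nonneg_nonpos)
    moreover have "lor x' y = lor center y + s * lor v y" by (simp add: x'_def lor_simps)
    ultimately show ?thesis using lor_center_normals[OF that] u vw cv st by (cases "y = v") auto
  qed
  have "lor x x = -2 - s * s - t * t" "lor x' x' = -2 - s * s"
    by (simp_all add: x_def x'_def lor_simps u vw cv c algebra_simps)
  moreover have "0 \<le> s * s" "0 \<le> t * t" by simp_all
  ultimately have neg: "lor x x < 0" "lor x' x' < 0" by linarith+
  have p6: "x$6 > 0" "x'$6 > 0"
    using normals_nth_6[OF v] normals_nth_6[OF w] st c by (simp_all add: x_def x'_def add_pos_pos)
  have x0: "lor x v = 0" "lor x w = 0" "lor x' v = 0" "lor x' w = - t"
    by (simp_all add: x_def x'_def lor_simps u vw cv)
  have "P x \<in> facet v \<inter> facet w" using Pf[OF neg(1) p6(1)] xle x0 by blast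
  thus "facet v \<inter> facet w \<noteq> {}" by blast
  have "P x' \<in> facet v" using Pf[OF neg(2) p6(2)] x'le x0 by blast
  moreover have "P x' \<notin> facet w"
    using x0 st neg by (simp add: facet_def hyperplane_H5_def Plor)
  ultimately show "facet v \<noteq> facet w" by blast
qed

text \<open>Orthogonal normals belong to distinct facets that meet, so the two facets cannot both
  lie in a pairwise disjoint set.\<close>

lemma covering_remaining_facets:
  assumes "pairwise disjnt \<F>"
  shows "covering {v \<in> normals. facet v \<notin> \<F>}"
  unfolding covering_def
proof (intro conjI ballI impI)
  fix v w assume vw: "v \<in> normals" "w \<in> normals" "lor v w = 0"
  note adjacent_facets_meet[OF vw]
  hence "\<not> (facet v \<in> \<F> \<and> facet w \<in> \<F>)"
    using assms by (auto simp: pairwise_def disjnt_def)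
  thus "v \<in> {v \<in> normals. facet v \<notin> \<F>} \<or> w \<in> {v \<in> normals. facet v \<notin> \<F>}" using vw by auto
qed auto

subsection \<open>Isometries\<close>

lemma Isom_mult:
  assumes "f \<in> carrier Isom_H5" "g \<in> carrier Isom_H5" "x \<in> H5"
  shows "(f \<otimes>\<^bsub>Isom_H5\<^esub> g) x = f (g x)"
  using assms by (simp add: Isom_H5_def BijGroup_def compose_eq)

lemma Isom_one: "x \<in> H5 \<Longrightarrow> \<one>\<^bsub>Isom_H5\<^esub> x = x"
  by (simp add: Isom_H5_def BijGroup_def)

lemma Isom_mem: "f \<in> carrier Isom_H5 \<Longrightarrow> x \<in> H5 \<Longrightarrow> f x \<in> H5"
  using Bij_imp_funcset[of f H5] by (auto simp: Isom_carrier)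

lemma Isom_ext:
  assumes "f \<in> carrier Isom_H5" "g \<in> carrier Isom_H5" "\<And>x. x \<in> H5 \<Longrightarrow> f x = g x"
  shows "f = g"
  using assms Bij_imp_extensional by (intro extensionalityI[of f H5 g]) (auto simp: Isom_carrier)

text \<open>\<open>arcosh\<close> is injective from 1 upwards, and \<open>lor_H5_le\<close> places
  both arguments there.\<close>

lemma Isom_lor:
  assumes "f \<in> carrier Isom_H5" "x \<in> H5" "y \<in> H5"
  shows "lor (f x) (f y) = lor x y"
proof -
  have "arcosh (- lor (f x) (f y)) = arcosh (- lor x y)"
    using assms by (auto simp: Isom_carrier hdist_def)
  moreover have "- lor (f x) (f y) \<ge> 1" "- lor x y \<ge> 1"
    using lor_H5_le[of "f x" "f y"] lor_H5_le[of x y] Isom_mem[OF assms(1)] assms(2,3) by auto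
  ultimately have "- lor (f x) (f y) = - lor x y" by (metis cosh_arcosh_real)
  thus ?thesis by simp
qed

lemma reflection_in_lrefl: "x \<in> H5 \<Longrightarrow> reflection_in v x = lrefl v x"
  by (simp add: reflection_in_def lrefl_def)

lemma lrefl_H5: "lor a a = 1 \<Longrightarrow> x \<in> H5 \<Longrightarrow> lrefl a x \<in> H5"
  using Isom_mem[OF reflection_in_Isom] by (metis reflection_in_lrefl)

lemma even_maps_H5: "L \<in> even_maps \<Longrightarrow> x \<in> H5 \<Longrightarrow> L x \<in> H5"
  by (induction rule: even_maps.induct) (auto simp: lrefl_H5)

definition H5_map :: "(real^6 \<Rightarrow> real^6) \<Rightarrow> real^6 \<Rightarrow> real^6" where "H5_map L = restrict L H5"

lemma H5_map_carrier: assumes L: "L \<in> even_maps" shows "H5_map L \<in> carrier Isom_H5"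
proof -
  obtain M where M: "M \<in> even_maps" "\<And>x. M (L x) = x" "\<And>x. L (M x) = x"
    using even_maps_inverse[OF L] by blast
  have "bij_betw (H5_map L) H5 H5"
    by (rule bij_betwI[where g = M])
      (auto simp: H5_map_def even_maps_H5[OF L] even_maps_H5[OF M(1)] M)
  thus ?thesis unfolding Isom_carrier Bij_def
    by (auto simp: H5_map_def hdist_def even_maps_lor[OF L])
qed

lemma H5_map_inverse:
  assumes L: "L \<in> even_maps" and M: "M \<in> even_maps" "\<And>x. L (M x) = x"
  shows "inv\<^bsub>Isom_H5\<^esub> (H5_map L) = H5_map M"
proof -
  interpret group Isom_H5 by (rule group_Isom_H5)
  have "H5_map L \<otimes>\<^bsub>Isom_H5\<^esub> H5_map M = \<one>\<^bsub>Isom_H5\<^esub>"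
  proof (rule Isom_ext)
    fix x assume "x \<in> H5"
    thus "(H5_map L \<otimes>\<^bsub>Isom_H5\<^esub> H5_map M) x = \<one>\<^bsub>Isom_H5\<^esub> x"
      using M even_maps_H5[OF M(1)]
      by (simp add: Isom_mult[OF H5_map_carrier[OF L] H5_map_carrier[OF M(1)]] Isom_one) (simp add: H5_map_def)
  qed (use H5_map_carrier L M in auto)
  thus ?thesis using H5_map_carrier L M by (metis inv_equality inv_inv inv_closed)
qed

lemma conjugate_H5_map:
  assumes L: "L \<in> even_maps" and M: "M \<in> even_maps" "\<And>x. L (M x) = x"
    and g: "g \<in> carrier Isom_H5" and x: "x \<in> H5"
  shows "(H5_map L \<otimes>\<^bsub>Isom_H5\<^esub> g \<otimes>\<^bsub>Isom_H5\<^esub> inv\<^bsub>Isom_H5\<^esub> (H5_map L)) x = L (g (M x))"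
proof -
  interpret group Isom_H5 by (rule group_Isom_H5)
  show ?thesis unfolding H5_map_inverse[OF L M]
    using H5_map_carrier[OF L] H5_map_carrier[OF M(1)] g x
    by (simp add: Isom_mult H5_map_def even_maps_H5[OF M(1)] Isom_mem)
qed

subsection \<open>Involutions close to a reflection\<close>

text \<open>Six points of \<open>H5\<close> that span the ambient space; the coefficient
  \<open>sqrt 2\<close> gives norm 1 - 2 = -1.\<close>

definition H5_basis :: "6 \<Rightarrow> real^6" where
  "H5_basis i = (if i = 6 then axis 6 1 else axis i 1 + sqrt 2 *\<^sub>R axis 6 1)"

lemma H5_basis_H5: "H5_basis i \<in> H5"
proof -
  have "\<forall>i. H5_basis i \<in> H5"
    unfolding forall_6 by (simp add: H5_basis_def H5_def lor_def axis_def)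
  thus ?thesis by blast
qed

lemma H5_basis_zero: assumes "\<And>i. lor y (H5_basis i) = 0" shows "y = 0"
proof -
  have "y $ 6 = 0" using assms[of 6] by (simp add: H5_basis_def lor_axis)
  moreover have "y $ i = 0" if "i \<noteq> 6" for i
    using assms[of i] calculation that by (simp add: H5_basis_def lor_axis lor_simps)
  ultimately show ?thesis unfolding vec_eq_iff by (metis zero_index)
qed

lemma H5_zero: "(\<And>x. x \<in> H5 \<Longrightarrow> lor y x = 0) \<Longrightarrow> y = 0"
  using H5_basis_zero H5_basis_H5 by blast

text \<open>With \<open>c\<close> a point off the hyperplane, the candidate \<open>v'\<close> is the unit normal of the
  bisector of \<open>c\<close> and \<open>g c\<close>; \<open>g\<close> fixes every \<open>b + g b\<close>, and these vectors together with \<open>c\<close> span.\<close>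

lemma involution_near_reflection:
  assumes v: "lor v v = 1" and c: "c \<in> H5" "lor c v < 0" and \<epsilon>: "\<epsilon> > 0"
  shows "\<exists>\<eta>>0. \<forall>g\<in>carrier Isom_H5. (\<forall>x\<in>H5. g (g x) = x) \<longrightarrow>
    (\<forall>x\<in>insert c (range H5_basis). dist (g x) (reflection_in v x) < \<eta>) \<longrightarrow>
    (\<exists>v'. lor v' v' = 1 \<and> dist v' v < \<epsilon> \<and> g = reflection_in v')"
proof -
  \<comment> \<open>For the reflection in \<open>v\<close> itself, the sums
    \<open>b + lrefl v b\<close> span the orthogonal complement of \<open>v\<close>, and
    \<open>c\<close> lies off it; hence \<open>h\<close> vanishes only at 0.\<close>
  define h where "h y = (\<Sum>i\<in>UNIV. \<bar>lor y (H5_basis i + lrefl v (H5_basis i))\<bar>) + \<bar>lor y c\<bar>" for y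
  have cont: "continuous_on UNIV h" unfolding h_def by (intro continuous_intros)
  have h0: "0 \<le> h y" for y unfolding h_def by (intro add_nonneg_nonneg sum_nonneg) auto
  have scale: "h (t *\<^sub>R y) = \<bar>t\<bar> * h y" for t y
    unfolding h_def by (simp add: lor_linear(3) abs_mult distrib_left sum_distrib_left)
  have pos: "y = 0" if "h y = 0" for y
  proof -
    have "0 \<le> (\<Sum>i\<in>UNIV. \<bar>lor y (H5_basis i + lrefl v (H5_basis i))\<bar>)" by (intro sum_nonneg) auto
    hence s: "(\<Sum>i\<in>UNIV. \<bar>lor y (H5_basis i + lrefl v (H5_basis i))\<bar>) = 0" "lor y c = 0"
      using that unfolding h_def by linarith+
    have "lor y (H5_basis i + lrefl v (H5_basis i)) = 0" for i
      using s(1) by (subst (asm) sum_nonneg_eq_0_iff) auto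
    moreover have "lor y (b + lrefl v b) = 2 * lor (y - lor y v *\<^sub>R v) b" for b
      unfolding lrefl_def lor_add lor_linear(1-4) by (simp add: lor_commute)
    ultimately have "lor (y - lor y v *\<^sub>R v) (H5_basis i) = 0" for i by simp
    hence y: "y = lor y v *\<^sub>R v" using H5_basis_zero[of "y - lor y v *\<^sub>R v"] by simp
    have "lor y v * lor v c = 0" using s(2) by (subst (asm) y) (simp add: lor_linear(3))
    thus ?thesis using y c(2) by (simp add: lor_commute)
  qed
  obtain \<kappa> where \<kappa>: "\<kappa> > 0" "\<And>y. \<kappa> * norm y \<le> h y"
    using homogeneous_lower_bound[of h, OF cont h0 scale pos] by blast
  obtain B where B: "B > 0" "\<And>a b. \<bar>lor a b\<bar> \<le> norm a * norm b * B"
    using bounded_bilinear.pos_bounded[OF bounded_bilinear_lor] by auto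
  define nv where "nv w = (1 / sqrt (lor (w - c) (w - c))) *\<^sub>R (w - c)" for w
  \<comment> \<open>Since \<open>c\<close> is on the negative side of \<open>v\<close>,
    \<open>s\<close> is positive and the bisector normal comes out as \<open>v\<close>, not as
    \<open>- v\<close>.\<close>
  define s where "s = - 2 * lor c v"
  have s: "s > 0" using c by (simp add: s_def)
  have w0: "lrefl v c - c = s *\<^sub>R v" by (simp add: lrefl_def s_def)
  have l0: "lor (lrefl v c - c) (lrefl v c - c) = s * s" unfolding w0 using v by (simp add: lor_linear(3,4))
  have nv0: "nv (lrefl v c) = v" using l0 s unfolding nv_def w0 by simp
  have "isCont nv (lrefl v c)"
    unfolding nv_def by (intro continuous_intros) (use l0 s in auto)
  then obtain \<eta>1 where \<eta>1: "\<eta>1 > 0" "\<And>w. dist w (lrefl v c) < \<eta>1 \<Longrightarrow> dist (nv w) v < \<epsilon>"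
    using \<epsilon> unfolding continuous_at_eps_delta nv0 by metis
  have "isCont (\<lambda>w. lor (w - c) (w - c)) (lrefl v c)" by (intro continuous_intros)
  moreover have "s * s > 0" using s by simp
  ultimately obtain \<eta>2 where \<eta>2: "\<eta>2 > 0" "\<And>w. dist w (lrefl v c) < \<eta>2 \<Longrightarrow> lor (w - c) (w - c) > 0"
    unfolding continuous_at_eps_delta l0 dist_real_def by (metis abs_diff_less_iff diff_self)
  \<comment> \<open>Each of the six basis points contributes an error of at most
    \<open>norm y * \<eta> * B\<close>; the 7 leaves a strict margin over 6.\<close>
  define \<eta> where "\<eta> = min (min \<eta>1 \<eta>2) (\<kappa> / (7 * B))"
  have \<eta>: "\<eta> > 0" using \<eta>1 \<eta>2 \<kappa> B by (simp add: \<eta>_def)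
  have "\<exists>v'. lor v' v' = 1 \<and> dist v' v < \<epsilon> \<and> g = reflection_in v'"
    if g: "g \<in> carrier Isom_H5" and inv: "\<And>x. x \<in> H5 \<Longrightarrow> g (g x) = x"
      and near: "\<And>x. x \<in> insert c (range H5_basis) \<Longrightarrow> dist (g x) (reflection_in v x) < \<eta>" for g
  proof -
    have cc: "lor c c = -1" using c by (simp add: H5_def)
    have dc: "dist (g c) (lrefl v c) < \<eta>" using near[of c] c by (simp add: reflection_in_lrefl)
    define w where "w = g c"
    have w: "w \<in> H5" using Isom_mem[OF g c(1)] by (simp add: w_def)
    hence ww: "lor w w = -1" by (simp add: H5_def)
    have wc: "lor (w - c) (w - c) > 0" using \<eta>2(2)[of w] dc by (simp add: w_def \<eta>_def)
    define v' where "v' = nv w"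
    have v'1: "lor v' v' = 1" using wc by (simp add: v'_def nv_def lor_linear(3,4))
    have refl: "lrefl v' z = z - (2 * lor z (w - c) / lor (w - c) (w - c)) *\<^sub>R (w - c)" for z
      using wc by (simp add: v'_def nv_def lrefl_def lor_linear(4))
    have fix_c: "lrefl v' c = w"
    proof -
      have "2 * lor c (w - c) = - lor (w - c) (w - c)"
        using cc ww by (simp add: lor_linear(1,2) lor_commute)
      thus ?thesis unfolding refl using wc by simp
    qed
    have "g x = lrefl v' x" if x: "x \<in> H5" for x
    proof -
      \<comment> \<open>\<open>y\<close> is the failure of \<open>g\<close> followed by
        \<open>lrefl v'\<close> to fix \<open>x\<close>. It is orthogonal to \<open>c\<close> and to
        all \<open>b + g b\<close>, and the lower bound for \<open>h\<close> then makes it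
        zero.\<close>
      define y where "y = lrefl v' (g x) - x"
      have yb: "lor y (b + g b) = 0" if b: "b \<in> H5" for b
      proof -
        have gb: "g b \<in> H5" "g x \<in> H5" using Isom_mem[OF g] b x by auto
        have "lor (g b) w = lor b c" using Isom_lor[OF g b c(1)] by (simp add: w_def)
        moreover have "lor (g b) c = lor b w"
          using Isom_lor[OF g gb(1) c(1)] inv[OF b] by (simp add: w_def)
        ultimately have "lor (b + g b) (w - c) = 0" by (simp add: lor_simps)
        hence "lrefl v' (b + g b) = b + g b" unfolding refl by simp
        moreover have "lor (g x) b = lor x (g b)" using Isom_lor[OF g gb(2) b] inv[OF x] by simp
        moreover have "lor (g x) (g b) = lor x b" by (rule Isom_lor[OF g x b])
        ultimately show ?thesis
          unfolding y_def lor_linear(1) lrefl_self_adjoint[of v'] by (simp add: lor_add(2))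
      qed
      have "lor y c = 0"
        using Isom_lor[OF g x c(1)] by (simp add: y_def lor_linear(1) lrefl_self_adjoint fix_c w_def)
      moreover have "\<bar>lor y (H5_basis i + lrefl v (H5_basis i))\<bar> \<le> norm y * \<eta> * B" for i
      proof -
        let ?b = "H5_basis i"
        have "lor y (?b + lrefl v ?b) = lor y (lrefl v ?b - g ?b)"
          using yb[OF H5_basis_H5[of i]] by (simp add: lor_simps)
        also have "\<bar>\<dots>\<bar> \<le> norm y * norm (lrefl v ?b - g ?b) * B" by (rule B)
        also have "\<dots> \<le> norm y * \<eta> * B"
          using near[of ?b] B(1) H5_basis_H5[of i]
          by (intro mult_right_mono mult_left_mono) (auto simp: reflection_in_lrefl dist_norm norm_minus_commute)
        finally show ?thesis .
      qed
      hence "(\<Sum>i\<in>UNIV. \<bar>lor y (H5_basis i + lrefl v (H5_basis i))\<bar>) \<le> of_nat (CARD(6)) * (norm y * \<eta> * B)"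
        by (intro sum_bounded_above) auto
      ultimately have "\<kappa> * norm y \<le> 6 * (norm y * \<eta> * B)" using \<kappa>(2)[of y] by (simp add: h_def)
      moreover have "\<eta> * (7 * B) \<le> \<kappa>"
      proof -
        have "\<eta> \<le> \<kappa> / (7 * B)" by (simp add: \<eta>_def)
        thus ?thesis using B(1) by (simp add: field_simps)
      qed
      hence "norm y * (\<eta> * (7 * B)) \<le> norm y * \<kappa>" by (intro mult_left_mono) auto
      ultimately have "norm y * \<eta> * B \<le> 0" by (simp add: algebra_simps)
      hence "norm y = 0" using \<eta> B(1) by (simp add: mult_le_0_iff zero_less_mult_iff)
      hence "lrefl v' (g x) = x" by (simp add: y_def)
      thus ?thesis using lrefl_lrefl[OF v'1, of "g x"] by simp
    qed
    hence "g = reflection_in v'"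
      by (intro Isom_ext[OF g reflection_in_Isom[OF v'1]]) (simp add: reflection_in_lrefl)
    moreover have "dist v' v < \<epsilon>" using \<eta>1(2)[of w] dc by (simp add: v'_def w_def \<eta>_def)
    ultimately show ?thesis using v'1 by blast
  qed
  thus ?thesis using \<eta> by blast
qed

text \<open>Commuting reflections have orthogonal or proportional normals, and the bound on the
  product excludes proportional ones.\<close>

lemma commuting_reflections_orthogonal:
  assumes a: "lor a a = 1" and b: "lor b b = 1" and ab: "\<bar>lor a b\<bar> < 1"
    and comm: "\<And>x. x \<in> H5 \<Longrightarrow> lrefl a (lrefl b x) = lrefl b (lrefl a x)"
  shows "lor a b = 0"
proof (rule ccontr)
  assume nz: "lor a b \<noteq> 0"
  have "lor a x = 0" if x: "x \<in> H5" for x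
  proof -
    have ba: "lor b a = lor a b" by (rule lor_commute)
    have "lrefl a (lrefl b x) - lrefl b (lrefl a x) =
        (4 * lor a b) *\<^sub>R (lor x b *\<^sub>R a - lor x a *\<^sub>R b)"
      unfolding lrefl_def lor_linear(1,3) ba by (simp add: vec_eq_iff algebra_simps)
    hence e: "lor x b *\<^sub>R a = lor x a *\<^sub>R b" using comm[OF x] nz by simp
    have "lor x b = lor x a * lor a b"
      using arg_cong[OF e, of "\<lambda>z. lor z a"] a ba by (simp add: lor_linear(3))
    moreover have "lor x b * lor a b = lor x a"
      using arg_cong[OF e, of "\<lambda>z. lor z b"] b by (simp add: lor_linear(3))
    ultimately have "lor x a * (1 - (lor a b)\<^sup>2) = 0" by (simp add: power2_eq_square algebra_simps)
    moreover have "(lor a b)\<^sup>2 < 1" using ab by (simp add: abs_square_less_1)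
    ultimately show ?thesis by (simp add: lor_commute)
  qed
  hence "a = 0" by (rule H5_zero)
  thus False using a by (simp add: lor_zero)
qed

subsection \<open>The space of representations\<close>

lemma Hom_carrier: "\<rho> \<in> Hom_Isom \<Gamma> \<Longrightarrow> \<gamma> \<in> \<Gamma> \<Longrightarrow> \<rho> \<gamma> \<in> carrier Isom_H5"
  by (auto simp: Hom_Isom_def hom_def)

lemma Hom_mult:
  "\<rho> \<in> Hom_Isom \<Gamma> \<Longrightarrow> \<gamma> \<in> \<Gamma> \<Longrightarrow> \<delta> \<in> \<Gamma> \<Longrightarrow>
    \<rho> (\<gamma> \<otimes>\<^bsub>Isom_H5\<^esub> \<delta>) = \<rho> \<gamma> \<otimes>\<^bsub>Isom_H5\<^esub> \<rho> \<delta>"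
  by (auto simp: Hom_Isom_def hom_def)

lemma Hom_one:
  assumes \<rho>: "\<rho> \<in> Hom_Isom \<Gamma>" and one: "\<one>\<^bsub>Isom_H5\<^esub> \<in> \<Gamma>"
  shows "\<rho> \<one>\<^bsub>Isom_H5\<^esub> = \<one>\<^bsub>Isom_H5\<^esub>"
proof -
  interpret group Isom_H5 by (rule group_Isom_H5)
  have "\<rho> \<one>\<^bsub>Isom_H5\<^esub> \<otimes>\<^bsub>Isom_H5\<^esub> \<rho> \<one>\<^bsub>Isom_H5\<^esub> = \<rho> \<one>\<^bsub>Isom_H5\<^esub>"
    using Hom_mult[OF \<rho> one one] by simp
  thus ?thesis using Hom_carrier[OF \<rho> one] by (simp add: r_cancel_one')
qed

lemma Isom_extensional: "f \<in> carrier Isom_H5 \<Longrightarrow> f \<in> extensional H5"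
  using Bij_imp_extensional[of f H5] by (simp add: Isom_carrier)

lemma topspace_Isom: "topspace Isom_topology = carrier Isom_H5"
proof -
  have "carrier Isom_H5 \<subseteq> (\<Pi>\<^sub>E x\<in>H5. H5)"
  proof
    fix f assume "f \<in> carrier Isom_H5"
    hence "f \<in> Bij H5" by (simp add: Isom_carrier)
    thus "f \<in> (\<Pi>\<^sub>E x\<in>H5. H5)"
      using Bij_imp_extensional[of f H5] Bij_imp_funcset[of f H5] by (simp add: PiE_def)
  qed
  thus ?thesis by (auto simp: Isom_topology_def topspace_subtopology)
qed

lemma topspace_Hom: "topspace (Hom_topology \<Gamma>) = Hom_Isom \<Gamma>"
proof -
  have "Hom_Isom \<Gamma> \<subseteq> (\<Pi>\<^sub>E \<gamma>\<in>\<Gamma>. carrier Isom_H5)"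
    by (auto simp: PiE_def Hom_carrier) (auto simp: Hom_Isom_def)
  thus ?thesis by (auto simp: Hom_topology_def topspace_subtopology topspace_Isom)
qed

lemma continuous_map_Hom_eval:
  assumes "\<gamma> \<in> \<Gamma>" "x \<in> H5"
  shows "continuous_map (Hom_topology \<Gamma>) euclidean (\<lambda>\<rho>. \<rho> \<gamma> x)"
proof -
  have "continuous_map (Hom_topology \<Gamma>) Isom_topology (\<lambda>\<rho>. \<rho> \<gamma>)"
    unfolding Hom_topology_def
    by (intro continuous_map_from_subtopology continuous_map_product_projection assms)
  moreover have "continuous_map Isom_topology (top_of_set H5) (\<lambda>f. f x)"
    unfolding Isom_topology_def
    by (intro continuous_map_from_subtopology continuous_map_product_projection assms)
  ultimately have "continuous_map (Hom_topology \<Gamma>) (top_of_set H5) ((\<lambda>f. f x) \<circ> (\<lambda>\<rho>. \<rho> \<gamma>))"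
    by (rule continuous_map_compose)
  thus ?thesis by (simp add: continuous_map_in_subtopology o_def)
qed

text \<open>Both layers carry topologies of pointwise convergence, so continuity can be tested by
  evaluating at a group element and then at a point.\<close>

lemma continuous_map_into_Hom:
  assumes F: "\<And>t. t \<in> topspace T \<Longrightarrow> F t \<in> Hom_Isom \<Gamma>"
    and cont: "\<And>\<gamma> x. \<gamma> \<in> \<Gamma> \<Longrightarrow> x \<in> H5 \<Longrightarrow> continuous_map T euclidean (\<lambda>t. F t \<gamma> x)"
  shows "continuous_map T (Hom_topology \<Gamma>) F"
  unfolding Hom_topology_def continuous_map_in_subtopology continuous_map_componentwise Isom_topology_def
proof (intro conjI ballI)
  show "F ` topspace T \<subseteq> extensional \<Gamma>" "F \<in> topspace T \<rightarrow> Hom_Isom \<Gamma>"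
    using F by (auto simp: Hom_Isom_def)
  fix \<gamma> assume \<gamma>: "\<gamma> \<in> \<Gamma>"
  have C: "F t \<gamma> \<in> carrier Isom_H5" if "t \<in> topspace T" for t using Hom_carrier F that \<gamma> by blast
  thus "(\<lambda>t. F t \<gamma>) \<in> topspace T \<rightarrow> carrier Isom_H5" by auto
  show "(\<lambda>t. F t \<gamma>) ` topspace T \<subseteq> extensional H5"
    using Isom_extensional[OF C] by auto
  fix x assume x: "x \<in> H5"
  show "continuous_map T euclidean (\<lambda>t. F t \<gamma> x)" by (rule cont[OF \<gamma> x])
  show "(\<lambda>t. F t \<gamma> x) \<in> topspace T \<rightarrow> H5" using Isom_mem[OF C x] by auto
qed

lemma reflection_in_involution:
  assumes v: "lor v v = 1"
  shows "reflection_in v \<otimes>\<^bsub>Isom_H5\<^esub> reflection_in v = \<one>\<^bsub>Isom_H5\<^esub>"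
proof (rule Isom_ext)
  interpret group Isom_H5 by (rule group_Isom_H5)
  note C = reflection_in_Isom[OF v]
  show "reflection_in v \<otimes>\<^bsub>Isom_H5\<^esub> reflection_in v \<in> carrier Isom_H5" "\<one>\<^bsub>Isom_H5\<^esub> \<in> carrier Isom_H5"
    using C by simp_all
  show "(reflection_in v \<otimes>\<^bsub>Isom_H5\<^esub> reflection_in v) x = \<one>\<^bsub>Isom_H5\<^esub> x" if "x \<in> H5" for x
    using that by (simp add: Isom_mult[OF C C] Isom_one reflection_in_lrefl lrefl_H5 lrefl_lrefl v)
qed

lemma conjugate_rep_eval:
  assumes L: "L \<in> even_maps" and M: "M \<in> even_maps" "\<And>x. L (M x) = x"
    and \<rho>: "\<rho> \<in> Hom_Isom \<Gamma>" and \<gamma>: "\<gamma> \<in> \<Gamma>" and x: "x \<in> H5"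
  shows "conjugate_rep \<Gamma> (H5_map L) \<rho> \<gamma> x = L (\<rho> \<gamma> (M x))"
  using conjugate_H5_map[OF L M Hom_carrier[OF \<rho> \<gamma>] x] \<gamma> by (simp add: conjugate_rep_def)

lemma conjugate_rep_Hom:
  assumes f: "f \<in> carrier Isom_H5" and \<Gamma>: "subgroup \<Gamma> Isom_H5" and \<rho>: "\<rho> \<in> Hom_Isom \<Gamma>"
  shows "conjugate_rep \<Gamma> f \<rho> \<in> Hom_Isom \<Gamma>"
proof -
  interpret group Isom_H5 by (rule group_Isom_H5)
  have "f \<otimes>\<^bsub>Isom_H5\<^esub> (a \<otimes>\<^bsub>Isom_H5\<^esub> b) \<otimes>\<^bsub>Isom_H5\<^esub> inv\<^bsub>Isom_H5\<^esub> f =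
      (f \<otimes>\<^bsub>Isom_H5\<^esub> a \<otimes>\<^bsub>Isom_H5\<^esub> inv\<^bsub>Isom_H5\<^esub> f) \<otimes>\<^bsub>Isom_H5\<^esub>
      (f \<otimes>\<^bsub>Isom_H5\<^esub> b \<otimes>\<^bsub>Isom_H5\<^esub> inv\<^bsub>Isom_H5\<^esub> f)"
    if "a \<in> carrier Isom_H5" "b \<in> carrier Isom_H5" for a b
  proof -
    have "inv\<^bsub>Isom_H5\<^esub> f \<otimes>\<^bsub>Isom_H5\<^esub> (f \<otimes>\<^bsub>Isom_H5\<^esub> z) = z" if "z \<in> carrier Isom_H5" for z
      using f that by (metis inv_closed l_inv l_one m_assoc)
    thus ?thesis using f that by (simp add: m_assoc)
  qed
  thus ?thesis
    using f Hom_carrier[OF \<rho>] Hom_mult[OF \<rho>] subgroup.m_closed[OF \<Gamma>]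
    by (auto simp: Hom_Isom_def hom_def conjugate_rep_def)
qed

lemma conjugate_rep_comp:
  assumes f: "f \<in> carrier Isom_H5" and g: "g \<in> carrier Isom_H5" and \<rho>: "\<rho> \<in> Hom_Isom \<Gamma>"
  shows "conjugate_rep \<Gamma> f (conjugate_rep \<Gamma> g \<rho>) = conjugate_rep \<Gamma> (f \<otimes>\<^bsub>Isom_H5\<^esub> g) \<rho>"
proof -
  interpret group Isom_H5 by (rule group_Isom_H5)
  show ?thesis
  proof (rule ext)
    fix \<gamma>
    show "conjugate_rep \<Gamma> f (conjugate_rep \<Gamma> g \<rho>) \<gamma> = conjugate_rep \<Gamma> (f \<otimes>\<^bsub>Isom_H5\<^esub> g) \<rho> \<gamma>"
    proof (cases "\<gamma> \<in> \<Gamma>")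
      case True
      note Hom_carrier[OF \<rho> True]
      thus ?thesis using f g True by (simp add: conjugate_rep_def inv_mult_group m_assoc)
    qed (simp add: conjugate_rep_def)
  qed
qed

lemma H5_map_comp: "L \<in> even_maps \<Longrightarrow> M \<in> even_maps \<Longrightarrow> H5_map L \<otimes>\<^bsub>Isom_H5\<^esub> H5_map M = H5_map (\<lambda>x. L (M x))"
proof (rule Isom_ext)
  assume L: "L \<in> even_maps" and M: "M \<in> even_maps"
  interpret group Isom_H5 by (rule group_Isom_H5)
  show "H5_map L \<otimes>\<^bsub>Isom_H5\<^esub> H5_map M \<in> carrier Isom_H5" using L M by (simp add: H5_map_carrier)
  show "H5_map (\<lambda>x. L (M x)) \<in> carrier Isom_H5" by (rule H5_map_carrier[OF even_maps_comp[OF L M]])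
  fix x assume "x \<in> H5"
  thus "(H5_map L \<otimes>\<^bsub>Isom_H5\<^esub> H5_map M) x = H5_map (\<lambda>x. L (M x)) x"
    using even_maps_H5[OF M] by (simp add: Isom_mult[OF H5_map_carrier[OF L] H5_map_carrier[OF M]]) (simp add: H5_map_def)
qed

lemma H5_map_id: "H5_map (\<lambda>x. x) = \<one>\<^bsub>Isom_H5\<^esub>"
  by (simp add: H5_map_def Isom_H5_def BijGroup_def restrict_def)

lemma conjugate_rep_one: "\<rho> \<in> Hom_Isom \<Gamma> \<Longrightarrow> conjugate_rep \<Gamma> \<one>\<^bsub>Isom_H5\<^esub> \<rho> = \<rho>"
proof -
  assume \<rho>: "\<rho> \<in> Hom_Isom \<Gamma>"
  interpret group Isom_H5 by (rule group_Isom_H5)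
  show ?thesis
    by (rule extensionalityI[of _ \<Gamma>])
      (use \<rho> Hom_carrier[OF \<rho>] in \<open>auto simp: conjugate_rep_def Hom_Isom_def\<close>)
qed

lemma continuous_map_conjugate_rep:
  assumes L: "L \<in> even_maps" and \<Gamma>: "subgroup \<Gamma> Isom_H5"
  shows "continuous_map (Hom_topology \<Gamma>) (Hom_topology \<Gamma>) (conjugate_rep \<Gamma> (H5_map L))"
proof (rule continuous_map_into_Hom)
  show "conjugate_rep \<Gamma> (H5_map L) \<rho> \<in> Hom_Isom \<Gamma>" if "\<rho> \<in> topspace (Hom_topology \<Gamma>)" for \<rho>
    using conjugate_rep_Hom[OF H5_map_carrier[OF L] \<Gamma>] that by (simp add: topspace_Hom)
  fix \<gamma> x assume \<gamma>: "\<gamma> \<in> \<Gamma>" and x: "x \<in> H5"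
  obtain M where M: "M \<in> even_maps" "\<And>x. L (M x) = x" using even_maps_inverse[OF L] by blast
  have "continuous_map euclidean euclidean L"
    using linear_continuous_on[of L UNIV] even_maps_linear[OF L] by (simp add: linear_conv_bounded_linear)
  from continuous_map_compose[OF continuous_map_Hom_eval[OF \<gamma> even_maps_H5[OF M(1) x]] this]
  show "continuous_map (Hom_topology \<Gamma>) euclidean (\<lambda>\<rho>. conjugate_rep \<Gamma> (H5_map L) \<rho> \<gamma> x)"
    by (rule continuous_map_eq) (simp add: conjugate_rep_eval[OF L M _ \<gamma> x] topspace_Hom)
qed

section \<open>Connectedness of the orbit\<close>

text \<open>The quadric is a continuous image of the product of a 4-sphere and a line: the direction
  of the first five coordinates, and the last coordinate.\<close>

lemma connected_unit_spacelike: "connected {a. lor a a = 1}"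
proof -
  let ?f = "\<lambda>(u::real^5, t::real). (vector [sqrt (1 + t\<^sup>2) * u$1, sqrt (1 + t\<^sup>2) * u$2,
     sqrt (1 + t\<^sup>2) * u$3, sqrt (1 + t\<^sup>2) * u$4, sqrt (1 + t\<^sup>2) * u$5, t] :: real^6)"
  have n5: "norm u = 1 \<longleftrightarrow> u$1*u$1 + u$2*u$2 + u$3*u$3 + u$4*u$4 + u$5*u$5 = 1" for u :: "real^5"
  proof -
    have U: "(UNIV :: 5 set) = {1,2,3,4,5}"
    proof -
      have "card {1,2,3,4,5::5} = 5" by simp
      thus ?thesis by (intro sym[OF card_subset_eq]) auto
    qed
    have "norm u = 1 \<longleftrightarrow> u \<bullet> u = 1" by (simp add: norm_eq_1)
    moreover have "u \<bullet> u = u$1*u$1 + u$2*u$2 + u$3*u$3 + u$4*u$4 + u$5*u$5"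
      unfolding inner_vec_def U by simp
    ultimately show ?thesis by simp
  qed
  have "connected (sphere (0::real^5) 1 \<times> (UNIV::real set))"
    by (intro connected_Times connected_sphere) auto
  moreover have "continuous_on (sphere 0 1 \<times> UNIV) ?f"
  proof -
    have v6: "(vector [a,b,c,d,e,f] :: real^6) =
      a *\<^sub>R axis 1 1 + b *\<^sub>R axis 2 1 + c *\<^sub>R axis 3 1 + d *\<^sub>R axis 4 1 + e *\<^sub>R axis 5 1 + f *\<^sub>R axis 6 1"
      for a b c d e f :: real unfolding vec_eq_iff forall_6 by (simp add: vector_6 axis_def)
    show ?thesis unfolding v6 case_prod_unfold by (intro continuous_intros)
  qed
  ultimately have "connected (?f ` (sphere 0 1 \<times> UNIV))" using connected_continuous_image by blast
  moreover have "?f ` (sphere 0 1 \<times> UNIV) = {a. lor a a = 1}"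
  proof (intro subset_antisym subsetI)
    fix a assume "a \<in> ?f ` (sphere 0 1 \<times> UNIV)"
    then obtain u t where u: "norm u = 1" and a: "a = ?f (u, t)" by auto
    have s: "sqrt (1 + t\<^sup>2) * x * (sqrt (1 + t\<^sup>2) * x) = (1 + t\<^sup>2) * (x * x)" for x
      by (metis abs_of_nonneg add_nonneg_nonneg mult.assoc mult.left_commute real_sqrt_mult_self zero_le_one zero_le_power2)
    have "lor a a = (1 + t\<^sup>2) * (u$1*u$1 + u$2*u$2 + u$3*u$3 + u$4*u$4 + u$5*u$5) - t * t"
      unfolding a lor_def case_prod_conv vector_6 s by (simp add: algebra_simps)
    thus "a \<in> {a. lor a a = 1}" using u unfolding n5 by (simp add: power2_eq_square)
  next
    fix a :: "real^6" assume "a \<in> {a. lor a a = 1}"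
    hence l: "a$1*a$1 + a$2*a$2 + a$3*a$3 + a$4*a$4 + a$5*a$5 = 1 + (a$6)\<^sup>2"
      by (simp add: lor_def power2_eq_square)
    define r where "r = sqrt (1 + (a$6)\<^sup>2)"
    have r: "r > 0" "r * r = 1 + (a$6)\<^sup>2" by (simp_all add: r_def add_pos_nonneg)
    define u :: "real^5" where "u = (\<chi> i. (if i = 1 then a$1 else if i = 2 then a$2 else if i = 3 then a$3
      else if i = 4 then a$4 else a$5) / r)"
    have u: "u$1 = a$1/r" "u$2 = a$2/r" "u$3 = a$3/r" "u$4 = a$4/r" "u$5 = a$5/r" by (simp_all add: u_def)
    have "norm u = 1"
    proof -
      have "u$1*u$1 + u$2*u$2 + u$3*u$3 + u$4*u$4 + u$5*u$5 =
          (a$1*a$1 + a$2*a$2 + a$3*a$3 + a$4*a$4 + a$5*a$5) / (r * r)"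
        unfolding u by (simp add: add_divide_distrib)
      also have "\<dots> = 1" unfolding l r(2)[symmetric] using r(1) by simp
      finally show ?thesis unfolding n5 .
    qed
    moreover have "a = ?f (u, a$6)"
      unfolding vec_eq_iff forall_6 using r(1) by (simp add: vector_6 u flip: r_def)
    ultimately show "a \<in> ?f ` (sphere 0 1 \<times> UNIV)" by (intro image_eqI[of _ _ "(u, a$6)"]) auto
  qed
  ultimately show ?thesis by simp
qed

text \<open>A group element will be applied to a moving point; its linear extension makes the result
  continuous.\<close>

lemma generated_by_reflections_linear:
  assumes T: "T \<subseteq> reflections" and \<gamma>: "\<gamma> \<in> generate Isom_H5 T"
  shows "\<exists>W. linear W \<and> (\<forall>x\<in>H5. \<gamma> x = W x)"
proof -
  interpret group Isom_H5 by (rule group_Isom_H5)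
  have TC: "T \<subseteq> carrier Isom_H5" using T reflection_in_Isom by (auto simp: reflections_def)
  show ?thesis using \<gamma>
  proof (induction rule: generate.induct)
    case one
    show ?case by (intro exI[of _ "\<lambda>x. x"]) (use linear_id in \<open>auto simp: Isom_one id_def\<close>)
  next
    case (incl h)
    then obtain v where "h = reflection_in v" using T by (auto simp: reflections_def)
    thus ?case using linear_lrefl reflection_in_lrefl by blast
  next
    case (inv h)
    then obtain v where v: "h = reflection_in v" "lor v v = 1" using T by (auto simp: reflections_def)
    hence "inv\<^bsub>Isom_H5\<^esub> h = h"
      using inv_equality[OF reflection_in_involution] reflection_in_Isom by simp
    thus ?case using v linear_lrefl reflection_in_lrefl by metis
  next
    case (eng h1 h2)
    then obtain W1 W2 where W: "linear W1" "linear W2" "\<And>x. x \<in> H5 \<Longrightarrow> h1 x = W1 x" "\<And>x. x \<in> H5 \<Longrightarrow> h2 x = W2 x"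
      by blast
    have C: "h1 \<in> carrier Isom_H5" "h2 \<in> carrier Isom_H5" using eng.hyps generate_in_carrier[OF TC] by auto
    have "(h1 \<otimes>\<^bsub>Isom_H5\<^esub> h2) x = W1 (W2 x)" if "x \<in> H5" for x
      using Isom_mult[OF C that] W(3)[OF Isom_mem[OF C(2) that]] W(4)[OF that] by simp
    thus ?case using linear_compose[OF W(2,1)] by (auto simp: o_def)
  qed
qed

lemma Hom_eq_on_generators:
  assumes T: "T \<subseteq> reflections" and \<rho>: "\<rho> \<in> Hom_Isom (generate Isom_H5 T)" and \<sigma>: "\<sigma> \<in> Hom_Isom (generate Isom_H5 T)"
    and eq: "\<And>s. s \<in> T \<Longrightarrow> \<rho> s = \<sigma> s"
  shows "\<rho> = \<sigma>"
proof -
  interpret group Isom_H5 by (rule group_Isom_H5)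
  have TC: "T \<subseteq> carrier Isom_H5" using T reflection_in_Isom by (auto simp: reflections_def)
  have "\<rho> \<gamma> = \<sigma> \<gamma>" if "\<gamma> \<in> generate Isom_H5 T" for \<gamma> using that
  proof (induction rule: generate.induct)
    case one show ?case using Hom_one[OF \<rho> generate.one] Hom_one[OF \<sigma> generate.one] by simp
  next
    case (incl h) thus ?case by (rule eq)
  next
    case (inv h)
    then obtain v where v: "h = reflection_in v" "lor v v = 1" using T by (auto simp: reflections_def)
    hence "inv\<^bsub>Isom_H5\<^esub> h = h"
      using inv_equality[OF reflection_in_involution] reflection_in_Isom by simp
    thus ?case using eq inv by simp
  next
    case (eng h1 h2)
    thus ?case using Hom_mult[OF \<rho>] Hom_mult[OF \<sigma>] by simp
  qed
  thus ?thesis using \<rho> \<sigma> by (intro extensionalityI[of \<rho> "generate Isom_H5 T"]) (auto simp: Hom_Isom_def)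
qed


text \<open>This set will be the neighborhood \<open>U\<^sub>0\<close> of the theorem.\<close>

definition even_orbit :: "(real^6 \<Rightarrow> real^6) set \<Rightarrow> ((real^6 \<Rightarrow> real^6) \<Rightarrow> (real^6 \<Rightarrow> real^6)) set" where
  "even_orbit \<Gamma> = {conjugate_rep \<Gamma> (H5_map L) (inclusion \<Gamma>) | L. L \<in> even_maps}"

lemma inclusion_Hom: "subgroup \<Gamma> Isom_H5 \<Longrightarrow> inclusion \<Gamma> \<in> Hom_Isom \<Gamma>"
  using subgroup.subset[of \<Gamma> Isom_H5] subgroup.m_closed[of \<Gamma> Isom_H5]
  by (auto simp: inclusion_def Hom_Isom_def hom_def)

text \<open>Moving one reflecting vector of an even product until it cancels its neighbour shortens
  the product by two.\<close>

lemma connectedin_even_orbit: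
  assumes T: "T \<subseteq> reflections" and \<Gamma>_def: "\<Gamma> = generate Isom_H5 T"
  shows "connectedin (Hom_topology \<Gamma>) (even_orbit \<Gamma>)"
proof -
  interpret group Isom_H5 by (rule group_Isom_H5)
  have TC: "T \<subseteq> carrier Isom_H5" using T reflection_in_Isom by (auto simp: reflections_def)
  have \<Gamma>: "subgroup \<Gamma> Isom_H5" unfolding \<Gamma>_def by (rule generate_is_subgroup[OF TC])
  note \<rho>0 = inclusion_Hom[OF \<Gamma>]
  define c where "c L = conjugate_rep \<Gamma> (H5_map L) (inclusion \<Gamma>)" for L
  have c_Hom: "c L \<in> Hom_Isom \<Gamma>" if "L \<in> even_maps" for L
    unfolding c_def by (rule conjugate_rep_Hom[OF H5_map_carrier[OF that] \<Gamma> \<rho>0])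
  have "\<exists>C. connectedin (Hom_topology \<Gamma>) C \<and> C \<subseteq> even_orbit \<Gamma> \<and> c (\<lambda>x. x) \<in> C \<and> c L \<in> C"
    if "L \<in> even_maps" for L using that
  proof (induction rule: even_maps.induct)
    case even_id
    show ?case
      by (intro exI[of _ "{c (\<lambda>x. x)}"])
        (use c_Hom[OF even_maps.even_id] even_maps.even_id in \<open>auto simp: topspace_Hom even_orbit_def c_def\<close>)
  next
    case (even_step L a b)
    then obtain C where C: "connectedin (Hom_topology \<Gamma>) C" "C \<subseteq> even_orbit \<Gamma>" "c (\<lambda>x. x) \<in> C" "c L \<in> C"
      by blast
    obtain M where M: "M \<in> even_maps" "\<And>x. L (M x) = x" using even_maps_inverse[OF even_step.hyps(1)] by blast
    let ?S = "{a. lor a a = 1}"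
    \<comment> \<open>At \<open>a' = b\<close> the two outer reflections cancel and leave
      \<open>L\<close>; at \<open>a' = a\<close> the new product appears.\<close>
    define W where "W a' = (\<lambda>x. lrefl a' (lrefl b (L x)))" for a'
    have W: "W a' \<in> even_maps" if "a' \<in> ?S" for a'
      unfolding W_def using even_maps.even_step[OF even_step.hyps(1) _ even_step.hyps(3)] that by blast
    have V: "(\<lambda>x. M (lrefl b (lrefl a' x))) \<in> even_maps" if "a' \<in> ?S" for a'
      using even_maps_comp[OF M(1) even_maps_two[OF even_step.hyps(3)]] that by blast
    have "continuous_map (top_of_set ?S) (Hom_topology \<Gamma>) (\<lambda>a'. c (W a'))"
    proof (rule continuous_map_into_Hom)
      show "c (W a') \<in> Hom_Isom \<Gamma>" if "a' \<in> topspace (top_of_set ?S)" for a'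
        using that W by (intro c_Hom) auto
      fix \<gamma> x assume \<gamma>: "\<gamma> \<in> \<Gamma>" and x: "x \<in> H5"
      obtain G where G: "linear G" "\<And>x. x \<in> H5 \<Longrightarrow> \<gamma> x = G x"
        using generated_by_reflections_linear[OF T] \<gamma> unfolding \<Gamma>_def by blast
      \<comment> \<open>Writing out the inverse of \<open>W a'\<close> exposes both places where
        \<open>a'\<close> enters, each through a reflection.\<close>
      have e: "c (W a') \<gamma> x = lrefl a' (lrefl b (L (G (M (lrefl b (lrefl a' x))))))" if a': "a' \<in> ?S" for a'
      proof -
        have "W a' (M (lrefl b (lrefl a' z))) = z" for z
          using M(2) a' even_step.hyps(3) by (simp add: W_def lrefl_lrefl)
        hence "c (W a') \<gamma> x = W a' (inclusion \<Gamma> \<gamma> (M (lrefl b (lrefl a' x))))"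
          unfolding c_def by (rule conjugate_rep_eval[OF W[OF a'] V[OF a'] _ \<rho>0 \<gamma> x])
        thus ?thesis using G(2)[OF even_maps_H5[OF V[OF a'] x]] \<gamma> by (simp add: inclusion_def W_def)
      qed
      have continuous_on_lrefl: "continuous_on A (\<lambda>a'. lrefl (f a') (g a'))"
        if "continuous_on A f" "continuous_on A g" for A f and g :: "real^6 \<Rightarrow> real^6"
        unfolding lrefl_def by (intro continuous_intros that)
      have lin: "continuous_on A (\<lambda>a'. F (f a'))" if "linear F" "continuous_on A f" for A f and F :: "real^6 \<Rightarrow> real^6"
        using continuous_on_compose2[OF linear_continuous_on[of F UNIV]] that by (simp add: linear_conv_bounded_linear)
      have "continuous_on ?S (\<lambda>a'. lrefl a' (lrefl b (L (G (M (lrefl b (lrefl a' x)))))))"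
        by (rule continuous_on_lrefl[OF continuous_on_id lin[OF linear_lrefl
              lin[OF even_maps_linear[OF even_step.hyps(1)] lin[OF G(1) lin[OF even_maps_linear[OF M(1)]
                lin[OF linear_lrefl continuous_on_lrefl[OF continuous_on_id continuous_on_const]]]]]]])
      hence "continuous_on ?S (\<lambda>a'. c (W a') \<gamma> x)" by (subst continuous_on_cong[OF refl e]) auto
      thus "continuous_map (top_of_set ?S) euclidean (\<lambda>a'. c (W a') \<gamma> x)" by simp
    qed
    hence conn: "connectedin (Hom_topology \<Gamma>) ((\<lambda>a'. c (W a')) ` ?S)"
      using connected_unit_spacelike by (intro connectedin_continuous_map_image) (auto simp: connectedin_subtopology)
    have "W b = L" using even_step.hyps(3) by (simp add: W_def fun_eq_iff lrefl_lrefl)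
    hence cL: "c L \<in> (\<lambda>a'. c (W a')) ` ?S" using even_step.hyps(3) by (intro image_eqI[of _ _ b]) auto
    have ca: "c (W a) \<in> (\<lambda>a'. c (W a')) ` ?S" using even_step.hyps(2) by auto
    have sub: "(\<lambda>a'. c (W a')) ` ?S \<subseteq> even_orbit \<Gamma>" using W by (auto simp: even_orbit_def c_def)
    have "connectedin (Hom_topology \<Gamma>) (C \<union> (\<lambda>a'. c (W a')) ` ?S)"
      using C(4) cL by (intro connectedin_Un C(1) conn) auto
    thus ?case unfolding W_def[symmetric] using C ca sub by (intro exI[of _ "C \<union> (\<lambda>a'. c (W a')) ` ?S"]) auto
  qed
  then obtain C where C: "\<And>L. L \<in> even_maps \<Longrightarrow> connectedin (Hom_topology \<Gamma>) (C L) \<and> C L \<subseteq> even_orbit \<Gamma> \<and>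
      c (\<lambda>x. x) \<in> C L \<and> c L \<in> C L"
    by metis
  have "even_orbit \<Gamma> = \<Union>(C ` even_maps)"
    using C by (fastforce simp: even_orbit_def c_def)
  moreover have "connectedin (Hom_topology \<Gamma>) (\<Union>(C ` even_maps))"
    using C by (intro connectedin_Union) auto
  ultimately show ?thesis by simp
qed

section \<open>Openness of the orbit\<close>

lemma openin_finite_ball:
  assumes "finite Z" "\<And>z. z \<in> Z \<Longrightarrow> openin X {\<rho> \<in> topspace X. P z \<rho>}"
  shows "openin X {\<rho> \<in> topspace X. \<forall>z\<in>Z. P z \<rho>}"
  using assms
proof (induction Z)
  case empty show ?case by simp
next
  case (insert z Z)
  have eq: "{\<rho> \<in> topspace X. \<forall>z\<in>insert z Z. P z \<rho>} = {\<rho> \<in> topspace X. P z \<rho>} \<inter> {\<rho> \<in> topspace X. \<forall>z\<in>Z. P z \<rho>}"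
    by auto
  show ?case unfolding eq using insert.IH insert.prems by (intro openin_Int) simp_all
qed

lemma conjugate_reflection:
  assumes L: "L \<in> even_maps" and a: "lor a a = 1"
  shows "H5_map L \<otimes>\<^bsub>Isom_H5\<^esub> reflection_in a \<otimes>\<^bsub>Isom_H5\<^esub> inv\<^bsub>Isom_H5\<^esub> (H5_map L) = reflection_in (L a)"
proof (rule Isom_ext)
  interpret group Isom_H5 by (rule group_Isom_H5)
  have La: "lor (L a) (L a) = 1" using a by (simp add: even_maps_lor[OF L])
  show "H5_map L \<otimes>\<^bsub>Isom_H5\<^esub> reflection_in a \<otimes>\<^bsub>Isom_H5\<^esub> inv\<^bsub>Isom_H5\<^esub> (H5_map L) \<in> carrier Isom_H5"
    using H5_map_carrier[OF L] reflection_in_Isom[OF a] by simp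
  show "reflection_in (L a) \<in> carrier Isom_H5" by (rule reflection_in_Isom[OF La])
  obtain M where M: "M \<in> even_maps" "\<And>x. L (M x) = x" using even_maps_inverse[OF L] by blast
  fix x assume x: "x \<in> H5"
  have "L (lrefl a (M x)) = lrefl (L a) x"
  proof -
    have "lor (M x) a = lor x (L a)" using even_maps_lor[OF L, of "M x" a] M(2) by simp
    thus ?thesis using linear_diff[OF even_maps_linear[OF L]] linear_scale[OF even_maps_linear[OF L]] M(2)
      by (simp add: lrefl_def)
  qed
  thus "(H5_map L \<otimes>\<^bsub>Isom_H5\<^esub> reflection_in a \<otimes>\<^bsub>Isom_H5\<^esub> inv\<^bsub>Isom_H5\<^esub> (H5_map L)) x = reflection_in (L a) x"
    unfolding conjugate_H5_map[OF L M reflection_in_Isom[OF a] x]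
    using even_maps_H5[OF M(1) x] x by (simp add: reflection_in_lrefl)
qed

lemma conjugate_rep_inverse:
  assumes L: "L \<in> even_maps" and M: "M \<in> even_maps" "\<And>x. L (M x) = x" and \<rho>: "\<rho> \<in> Hom_Isom \<Gamma>"
  shows "conjugate_rep \<Gamma> (H5_map L) (conjugate_rep \<Gamma> (H5_map M) \<rho>) = \<rho>"
  unfolding conjugate_rep_comp[OF H5_map_carrier[OF L] H5_map_carrier[OF M(1)] \<rho>] H5_map_comp[OF L M(1)] M(2) H5_map_id
  by (rule conjugate_rep_one[OF \<rho>])

lemma dist_config_less:
  assumes "\<And>i. dist (x$i) (y$i) < \<epsilon> / real CARD(normal_index)"
  shows "dist (x :: config) y < \<epsilon>"
proof -
  have "dist x y \<le> (\<Sum>i\<in>UNIV. dist (x$i) (y$i))"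
    unfolding dist_vec_def by (rule L2_set_le_sum) simp
  also have "\<dots> < (\<Sum>i\<in>(UNIV::normal_index set). \<epsilon> / real CARD(normal_index))"
    using assms by (intro sum_strict_mono) auto
  finally show ?thesis by simp
qed

text \<open>Supplies the bound required by \<open>commuting_reflections_orthogonal\<close>.\<close>

lemma base_config_adjacent_small:
  "\<exists>\<epsilon>>0. \<forall>x. dist x base_config < \<epsilon> \<longrightarrow>
    (\<forall>i j. lor (nrm i) (nrm j) = 0 \<longrightarrow> \<bar>lor (x$i) (x$j)\<bar> < 1)"
proof -
  have "\<forall>\<^sub>F x in nhds base_config. lor (nrm i) (nrm j) = 0 \<longrightarrow> \<bar>lor (x$i) (x$j)\<bar> < 1" for i j
  proof (cases "lor (nrm i) (nrm j) = 0")
    case True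
    have "isCont (\<lambda>x. \<bar>lor (x$i) (x$j)\<bar>) base_config" by (intro continuous_intros)
    hence "((\<lambda>x. \<bar>lor (x$i) (x$j)\<bar>) \<longlongrightarrow> 0) (nhds base_config)"
      using True by (simp add: base_config_def isCont_def tendsto_nhds_iff)
    hence "\<forall>\<^sub>F x in nhds base_config. \<bar>lor (x$i) (x$j)\<bar> < 1" by (rule order_tendstoD(2)) simp
    thus ?thesis by (rule eventually_mono) simp
  qed simp
  hence "\<forall>\<^sub>F x in nhds base_config. \<forall>i j. lor (nrm i) (nrm j) = 0 \<longrightarrow> \<bar>lor (x$i) (x$j)\<bar> < 1"
    by (intro eventually_all_finite)
  thus ?thesis unfolding eventually_nhds_metric by (simp add: dist_commute)
qed

text \<open>One point serves as \<open>c\<close> in \<open>involution_near_reflection\<close> for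
  all generators at once.\<close>

lemma unit_center: "(1 / sqrt 2) *\<^sub>R center \<in> H5" "v \<in> normals \<Longrightarrow> lor ((1 / sqrt 2) *\<^sub>R center) v < 0"
proof -
  have "lor center center = -2" "center$6 > 0" by (simp_all add: center_def lor_def vector_6)
  thus "(1 / sqrt 2) *\<^sub>R center \<in> H5" using H5_normalize[of center] by simp
  show "v \<in> normals \<Longrightarrow> lor ((1 / sqrt 2) *\<^sub>R center) v < 0"
    using lor_center_normals by (simp add: lor_linear(3) divide_neg_pos)
qed

text \<open>Closeness is imposed on finitely many generators at finitely many points, an open
  condition. It makes the image of every generator a nearby reflection, and the commutation
  relations make the new normals an admissible configuration.\<close>

lemma near_inclusion_in_even_orbit:
  assumes K: "covering K" and \<Gamma>_def: "\<Gamma> = generate Isom_H5 (reflection_in ` K)"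
  shows "\<exists>U. openin (Hom_topology \<Gamma>) U \<and> inclusion \<Gamma> \<in> U \<and> U \<subseteq> even_orbit \<Gamma>"
proof -
  interpret group Isom_H5 by (rule group_Isom_H5)
  have KN: "K \<subseteq> normals" using K by (simp add: covering_def)
  hence fin: "finite K" using finite_normals finite_subset by blast
  have Ku: "lor v v = 1" if "v \<in> K" for v using that KN normals_unit by blast
  let ?T = "reflection_in ` K"
  have T: "?T \<subseteq> reflections" using Ku by (auto simp: reflections_def)
  have TC: "?T \<subseteq> carrier Isom_H5" using reflection_in_Isom Ku by auto
  have \<Gamma>: "subgroup \<Gamma> Isom_H5" unfolding \<Gamma>_def by (rule generate_is_subgroup[OF TC])
  have r\<Gamma>: "reflection_in v \<in> \<Gamma>" if "v \<in> K" for v unfolding \<Gamma>_def using that by (intro generate.incl) auto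
  obtain \<epsilon>1 where \<epsilon>1: "\<epsilon>1 > 0" and rigid: "\<And>x. dist x base_config < \<epsilon>1 \<Longrightarrow> admissible K x \<Longrightarrow>
      (\<exists>L\<in>even_maps. \<forall>i. nrm i \<in> K \<longrightarrow> L (x$i) = nrm i)"
    using admissible_locally_rigid[OF K] by blast
  obtain \<epsilon>2 where \<epsilon>2: "\<epsilon>2 > 0" and small: "\<And>x i j. dist x base_config < \<epsilon>2 \<Longrightarrow> lor (nrm i) (nrm j) = 0 \<Longrightarrow>
      \<bar>lor (x$i) (x$j)\<bar> < 1"
    using base_config_adjacent_small by blast
  \<comment> \<open>The division lets closeness of every single entry bound the distance of the
    configurations.\<close>
  define \<epsilon> where "\<epsilon> = min \<epsilon>1 \<epsilon>2 / real CARD(normal_index)"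
  have \<epsilon>: "\<epsilon> > 0" using \<epsilon>1 \<epsilon>2 by (simp add: \<epsilon>_def)
  let ?B = "insert ((1 / sqrt 2) *\<^sub>R center) (range H5_basis)"
  have BH: "?B \<subseteq> H5" using unit_center(1) H5_basis_H5 by auto
  have "\<forall>v\<in>K. \<exists>\<eta>>0. \<forall>g\<in>carrier Isom_H5. (\<forall>x\<in>H5. g (g x) = x) \<longrightarrow>
      (\<forall>x\<in>?B. dist (g x) (reflection_in v x) < \<eta>) \<longrightarrow>
      (\<exists>v'. lor v' v' = 1 \<and> dist v' v < \<epsilon> \<and> g = reflection_in v')"
    using involution_near_reflection[OF Ku unit_center(1) unit_center(2) \<epsilon>] KN by blast
  then obtain \<eta> where \<eta>: "\<And>v. v \<in> K \<Longrightarrow> \<eta> v > 0"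
    and near: "\<And>v g. v \<in> K \<Longrightarrow> g \<in> carrier Isom_H5 \<Longrightarrow> (\<forall>x\<in>H5. g (g x) = x) \<Longrightarrow>
      (\<forall>x\<in>?B. dist (g x) (reflection_in v x) < \<eta> v) \<Longrightarrow>
      (\<exists>v'. lor v' v' = 1 \<and> dist v' v < \<epsilon> \<and> g = reflection_in v')"
    by metis
  define U where "U = {\<rho> \<in> topspace (Hom_topology \<Gamma>). \<forall>v\<in>K. \<forall>x\<in>?B.
      dist (\<rho> (reflection_in v) x) (reflection_in v x) < \<eta> v}"
  have "openin (Hom_topology \<Gamma>) U"
  proof -
    have "openin (Hom_topology \<Gamma>) {\<rho> \<in> topspace (Hom_topology \<Gamma>).
        dist (\<rho> (reflection_in v) x) (reflection_in v x) < \<eta> v}" if "v \<in> K" "x \<in> ?B" for v x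
    proof -
      have "x \<in> H5" using that(2) BH by blast
      from openin_continuous_map_preimage[OF continuous_map_Hom_eval[OF r\<Gamma>[OF that(1)] this],
          of "ball (reflection_in v x) (\<eta> v)"]
      show ?thesis by (simp add: dist_commute)
    qed
    thus ?thesis unfolding U_def by (intro openin_finite_ball fin) auto
  qed
  moreover have "inclusion \<Gamma> \<in> U"
    using inclusion_Hom[OF \<Gamma>] \<eta> r\<Gamma> by (simp add: U_def topspace_Hom) (simp add: inclusion_def)
  moreover have "\<rho> \<in> even_orbit \<Gamma>" if U: "\<rho> \<in> U" for \<rho>
  proof -
    have \<rho>: "\<rho> \<in> Hom_Isom \<Gamma>" using U by (simp add: U_def topspace_Hom)
    have \<rho>_one: "\<rho> \<one>\<^bsub>Isom_H5\<^esub> = \<one>\<^bsub>Isom_H5\<^esub>"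
      by (rule Hom_one[OF \<rho> subgroup.one_closed[OF \<Gamma>]])
    have "\<exists>v'. lor v' v' = 1 \<and> dist v' v < \<epsilon> \<and> \<rho> (reflection_in v) = reflection_in v'" if v: "v \<in> K" for v
    proof (rule near[OF v])
      note C = Hom_carrier[OF \<rho> r\<Gamma>[OF v]]
      show "\<rho> (reflection_in v) \<in> carrier Isom_H5" by (rule C)
      have "\<rho> (reflection_in v) \<otimes>\<^bsub>Isom_H5\<^esub> \<rho> (reflection_in v) = \<one>\<^bsub>Isom_H5\<^esub>"
        using Hom_mult[OF \<rho> r\<Gamma>[OF v] r\<Gamma>[OF v]] \<rho>_one by (simp add: reflection_in_involution Ku v)
      thus "\<forall>x\<in>H5. \<rho> (reflection_in v) (\<rho> (reflection_in v) x) = x"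
        using Isom_mult[OF C C] Isom_one by metis
      show "\<forall>x\<in>?B. dist (\<rho> (reflection_in v) x) (reflection_in v x) < \<eta> v"
        using U v unfolding U_def by blast
    qed
    then obtain v' where v': "\<And>v. v \<in> K \<Longrightarrow> lor (v' v) (v' v) = 1" "\<And>v. v \<in> K \<Longrightarrow> dist (v' v) v < \<epsilon>"
      "\<And>v. v \<in> K \<Longrightarrow> \<rho> (reflection_in v) = reflection_in (v' v)" by metis
    \<comment> \<open>The base values off \<open>K\<close> add nothing to the distance.\<close>
    define x :: config where "x = (\<chi> i. if nrm i \<in> K then v' (nrm i) else nrm i)"
    have "dist x base_config < min \<epsilon>1 \<epsilon>2"
      using v'(2) \<epsilon> by (intro dist_config_less) (simp add: x_def base_config_def flip: \<epsilon>_def)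
    hence d: "dist x base_config < \<epsilon>1" "dist x base_config < \<epsilon>2" by auto
    have "admissible K x"
      unfolding admissible_def
    proof (intro conjI allI impI)
      show "lor (x$i) (x$i) = 1" if "nrm i \<in> K" for i using that v'(1) by (simp add: x_def)
      fix i j assume ij: "nrm i \<in> K" "nrm j \<in> K" "lor (nrm i) (nrm j) = 0"
      let ?v = "nrm i" and ?w = "nrm j"
      note u = v'(1)[OF ij(1)] v'(1)[OF ij(2)]
      \<comment> \<open>Reflections in orthogonal normals commute in the group, and
        \<open>\<rho>\<close> carries this relation over to the images.\<close>
      have lc: "lrefl ?v (lrefl ?w y) = lrefl ?w (lrefl ?v y)" for y
        using ij(3) by (simp add: lrefl_def lor_simps lor_commute[of ?w ?v])
      have "reflection_in ?v \<otimes>\<^bsub>Isom_H5\<^esub> reflection_in ?w = reflection_in ?w \<otimes>\<^bsub>Isom_H5\<^esub> reflection_in ?v"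
      proof (rule Isom_ext)
        note C = reflection_in_Isom[OF Ku[OF ij(1)]] reflection_in_Isom[OF Ku[OF ij(2)]]
        show "reflection_in ?v \<otimes>\<^bsub>Isom_H5\<^esub> reflection_in ?w \<in> carrier Isom_H5"
          "reflection_in ?w \<otimes>\<^bsub>Isom_H5\<^esub> reflection_in ?v \<in> carrier Isom_H5" using C by simp_all
        fix y assume "y \<in> H5"
        thus "(reflection_in ?v \<otimes>\<^bsub>Isom_H5\<^esub> reflection_in ?w) y = (reflection_in ?w \<otimes>\<^bsub>Isom_H5\<^esub> reflection_in ?v) y"
          using lrefl_H5 Ku ij lc by (simp add: Isom_mult C reflection_in_lrefl)
      qed
      hence comm: "reflection_in (v' ?v) \<otimes>\<^bsub>Isom_H5\<^esub> reflection_in (v' ?w) =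
          reflection_in (v' ?w) \<otimes>\<^bsub>Isom_H5\<^esub> reflection_in (v' ?v)"
        using Hom_mult[OF \<rho> r\<Gamma>[OF ij(1)] r\<Gamma>[OF ij(2)]] Hom_mult[OF \<rho> r\<Gamma>[OF ij(2)] r\<Gamma>[OF ij(1)]] v'(3) ij
        by simp
      note C = reflection_in_Isom[OF u(1)] reflection_in_Isom[OF u(2)]
      have "lrefl (v' ?v) (lrefl (v' ?w) y) = lrefl (v' ?w) (lrefl (v' ?v) y)" if y: "y \<in> H5" for y
        using fun_cong[OF comm, of y] y lrefl_H5[OF u(1)] lrefl_H5[OF u(2)]
        by (simp add: Isom_mult C reflection_in_lrefl)
      moreover have "\<bar>lor (v' ?v) (v' ?w)\<bar> < 1" using small[OF d(2) ij(3)] ij by (simp add: x_def)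
      ultimately have "lor (v' ?v) (v' ?w) = 0" using u by (intro commuting_reflections_orthogonal) auto
      thus "lor (x$i) (x$j) = 0" using ij by (simp add: x_def)
    qed
    then obtain L where L: "L \<in> even_maps" "\<And>i. nrm i \<in> K \<Longrightarrow> L (x$i) = nrm i" using rigid[OF d(1)] by blast
    obtain M where M: "M \<in> even_maps" "\<And>x. M (L x) = x" "\<And>x. L (M x) = x" using even_maps_inverse[OF L(1)] by blast
    have "conjugate_rep \<Gamma> (H5_map L) \<rho> = inclusion \<Gamma>"
    proof (rule Hom_eq_on_generators[OF T, folded \<Gamma>_def])
      show "conjugate_rep \<Gamma> (H5_map L) \<rho> \<in> Hom_Isom \<Gamma>" by (rule conjugate_rep_Hom[OF H5_map_carrier[OF L(1)] \<Gamma> \<rho>])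
      show "inclusion \<Gamma> \<in> Hom_Isom \<Gamma>" by (rule inclusion_Hom[OF \<Gamma>])
      fix s assume "s \<in> ?T"
      then obtain v where v: "v \<in> K" "s = reflection_in v" by blast
      obtain i where i: "v = nrm i" using v KN Abs_normal_index_inverse[of v] by (metis subsetD)
      have "L (v' v) = v" using L(2)[of i] v i by (simp add: x_def)
      thus "conjugate_rep \<Gamma> (H5_map L) \<rho> s = inclusion \<Gamma> s"
        using conjugate_reflection[OF L(1) v'(1)[OF v(1)]] v r\<Gamma> v'(3)
        by (simp add: conjugate_rep_def inclusion_def)
    qed
    hence "\<rho> = conjugate_rep \<Gamma> (H5_map M) (inclusion \<Gamma>)"
      using conjugate_rep_inverse[OF M(1) L(1) M(2) \<rho>] by simp
    thus ?thesis using M(1) unfolding even_orbit_def by blast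
  qed
  ultimately show ?thesis by blast
qed

text \<open>Conjugating a point of the orbit back to the inclusion is continuous, so the known
  neighborhood of the inclusion pulls back to one of that point; composition of even maps keeps it
  inside the orbit.\<close>

lemma openin_even_orbit:
  assumes K: "covering K" and \<Gamma>_def: "\<Gamma> = generate Isom_H5 (reflection_in ` K)"
  shows "openin (Hom_topology \<Gamma>) (even_orbit \<Gamma>)"
proof (subst openin_subopen, intro ballI)
  interpret group Isom_H5 by (rule group_Isom_H5)
  have "reflection_in ` K \<subseteq> carrier Isom_H5"
    using K reflection_in_Isom normals_unit by (auto simp: covering_def)
  hence \<Gamma>: "subgroup \<Gamma> Isom_H5" unfolding \<Gamma>_def by (rule generate_is_subgroup)
  obtain U where U: "openin (Hom_topology \<Gamma>) U" "inclusion \<Gamma> \<in> U" "U \<subseteq> even_orbit \<Gamma>"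
    using near_inclusion_in_even_orbit[OF assms] by blast
  fix \<rho> assume "\<rho> \<in> even_orbit \<Gamma>"
  then obtain L where L: "L \<in> even_maps" and \<rho>: "\<rho> = conjugate_rep \<Gamma> (H5_map L) (inclusion \<Gamma>)"
    by (auto simp: even_orbit_def)
  obtain M where M: "M \<in> even_maps" "\<And>x. M (L x) = x" "\<And>x. L (M x) = x" using even_maps_inverse[OF L] by blast
  define V where "V = {\<sigma> \<in> topspace (Hom_topology \<Gamma>). conjugate_rep \<Gamma> (H5_map M) \<sigma> \<in> U}"
  have "openin (Hom_topology \<Gamma>) V"
    unfolding V_def by (rule openin_continuous_map_preimage[OF continuous_map_conjugate_rep[OF M(1) \<Gamma>] U(1)])
  moreover have "\<rho> \<in> V"
    using U(2) conjugate_rep_inverse[OF M(1) L M(2) inclusion_Hom[OF \<Gamma>]]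
      conjugate_rep_Hom[OF H5_map_carrier[OF L] \<Gamma> inclusion_Hom[OF \<Gamma>]]
    by (simp add: V_def topspace_Hom \<rho>)
  moreover have "\<sigma> \<in> even_orbit \<Gamma>" if \<sigma>V: "\<sigma> \<in> V" for \<sigma>
  proof -
    have \<sigma>: "\<sigma> \<in> Hom_Isom \<Gamma>" using \<sigma>V by (simp add: V_def topspace_Hom)
    obtain N where N: "N \<in> even_maps" "conjugate_rep \<Gamma> (H5_map M) \<sigma> = conjugate_rep \<Gamma> (H5_map N) (inclusion \<Gamma>)"
      using \<sigma>V U(3) unfolding V_def even_orbit_def by blast
    have "\<sigma> = conjugate_rep \<Gamma> (H5_map L) (conjugate_rep \<Gamma> (H5_map N) (inclusion \<Gamma>))"
      using conjugate_rep_inverse[OF L M(1,3) \<sigma>] N(2) by simp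
    also have "\<dots> = conjugate_rep \<Gamma> (H5_map (\<lambda>x. L (N x))) (inclusion \<Gamma>)"
      unfolding conjugate_rep_comp[OF H5_map_carrier[OF L] H5_map_carrier[OF N(1)] inclusion_Hom[OF \<Gamma>]] H5_map_comp[OF L N(1)] ..
    finally show ?thesis using even_maps_comp[OF L N(1)] unfolding even_orbit_def by blast
  qed
  ultimately show "\<exists>T. openin (Hom_topology \<Gamma>) T \<and> \<rho> \<in> T \<and> T \<subseteq> even_orbit \<Gamma>" by blast
qed

theorem theorem1:
  fixes \<F> :: "(real^6) set set"
  assumes "\<F> \<subseteq> facets" and "\<F> \<noteq> {}" and "pairwise disjnt \<F>"
  shows "(\<exists>U\<^sub>0. openin (Hom_topology (Gamma_F \<F>)) U\<^sub>0 \<and>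
            connectedin (Hom_topology (Gamma_F \<F>)) U\<^sub>0 \<and>
            inclusion (Gamma_F \<F>) \<in> U\<^sub>0 \<and>
            (\<forall>\<rho>\<in>U\<^sub>0. \<forall>s\<in>standard_generators \<F>. \<rho> s \<in> reflections) \<and>
            (\<forall>\<rho>\<in>U\<^sub>0. \<exists>f\<in>carrier Isom_H5.
               conjugate_rep (Gamma_F \<F>) f \<rho> = inclusion (Gamma_F \<F>)))
         \<and> locally_rigid (Gamma_F \<F>)"
proof -
  interpret group Isom_H5 by (rule group_Isom_H5)
  let ?\<Gamma> = "Gamma_F \<F>"
  define K where "K = {v \<in> normals. facet v \<notin> \<F>}"
  have K: "covering K" unfolding K_def by (rule covering_remaining_facets[OF assms(3)])
  have gens: "standard_generators \<F> = reflection_in ` K" by (auto simp: standard_generators_def K_def)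
  have \<Gamma>_def: "?\<Gamma> = generate Isom_H5 (reflection_in ` K)" by (simp add: Gamma_F_def gens)
  have Ku: "lor v v = 1" if "v \<in> K" for v using that normals_unit by (simp add: K_def)
  have T: "reflection_in ` K \<subseteq> reflections" using Ku by (auto simp: reflections_def)
  have \<Gamma>: "subgroup ?\<Gamma> Isom_H5"
    unfolding \<Gamma>_def using Ku reflection_in_Isom by (intro generate_is_subgroup) auto
  note \<rho>0 = inclusion_Hom[OF \<Gamma>]
  have op: "openin (Hom_topology ?\<Gamma>) (even_orbit ?\<Gamma>)" by (rule openin_even_orbit[OF K \<Gamma>_def])
  have conn: "connectedin (Hom_topology ?\<Gamma>) (even_orbit ?\<Gamma>)" by (rule connectedin_even_orbit[OF T \<Gamma>_def])
  have base: "inclusion ?\<Gamma> \<in> even_orbit ?\<Gamma>"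
    using near_inclusion_in_even_orbit[OF K \<Gamma>_def] by blast
  have refl: "\<rho> s \<in> reflections" if \<rho>: "\<rho> \<in> even_orbit ?\<Gamma>" and s: "s \<in> standard_generators \<F>" for \<rho> s
  proof -
    obtain L where L: "L \<in> even_maps" "\<rho> = conjugate_rep ?\<Gamma> (H5_map L) (inclusion ?\<Gamma>)"
      using \<rho> by (auto simp: even_orbit_def)
    obtain v where v: "v \<in> K" "s = reflection_in v" using s gens by auto
    have "s \<in> ?\<Gamma>" using v unfolding \<Gamma>_def by (intro generate.incl) auto
    hence "\<rho> s = reflection_in (L v)"
      using conjugate_reflection[OF L(1) Ku[OF v(1)]] by (simp add: L(2) v(2) conjugate_rep_def inclusion_def)
    thus ?thesis using Ku[OF v(1)] even_maps_lor[OF L(1)] by (auto simp: reflections_def)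
  qed
  have conj: "\<exists>f\<in>carrier Isom_H5. conjugate_rep ?\<Gamma> f \<rho> = inclusion ?\<Gamma>" if \<rho>: "\<rho> \<in> even_orbit ?\<Gamma>" for \<rho>
  proof -
    obtain L where L: "L \<in> even_maps" "\<rho> = conjugate_rep ?\<Gamma> (H5_map L) (inclusion ?\<Gamma>)"
      using \<rho> by (auto simp: even_orbit_def)
    obtain M where M: "M \<in> even_maps" "\<And>x. M (L x) = x" using even_maps_inverse[OF L(1)] by blast
    show ?thesis
      using conjugate_rep_inverse[OF M(1) L(1) M(2) \<rho>0] H5_map_carrier[OF M(1)] unfolding L(2) by blast
  qed
  have "locally_rigid ?\<Gamma>"
    unfolding locally_rigid_def
    using op base H5_map_carrier by (intro exI[of _ "even_orbit ?\<Gamma>"]) (auto simp: even_orbit_def)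
  thus ?thesis using op conn base refl conj by blast
qed

end
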